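(* There exists $\delta_0>0$ such that for all $0<\delta\le\delta_0$ and each $\varphi^\delta\in[\varphi_{A^\delta}-\Delta_1,\varphi_{A^\delta}+\Delta_2]$, $$W_\delta\big(A^\delta,q_\delta(\varphi^\delta)\big)=W^{red}_\delta(\varphi_{A^\delta},\varphi^\delta)+O(\delta^3|\log\delta|^3),$$ where the constant in $O(\cdot)$ is independent of $\delta$ and $\varphi^\delta$.
   Context: Setting. $\langle\cdot,\cdot\rangle$, $\|\cdot\|$ are the Euclidean scalar product and norm on $\mathbb R^n$. $V\in C^4(\mathbb R^n,\mathbb R)$, $G\in C^2(\mathbb R^n,\mathbb R^n)$, and $H[X]$ is the Hessian matrix of $V$ at $X$. $M\subset\mathbb R^n$ is a compact simple closed curve of class $C^3$ with $\nabla V=0$ and $V=0$ on $M$, and there is $\lambda>0$ such that for all $X\in M$, all $v$ tangent to $M$ at $X$ and all $w$ orthogonal to the tangent line at $X$: $H[X]v=0$ and $\langle H[X]w,w\rangle\ge\lambda\|w\|^2$. $L$ is the length of $M$ and $q:\mathbb R/L\mathbb R\to M$ is a parametrization with $\|q'(\theta)\|=1$. Perturbed curve. For $\delta>0$ consider the flow $\dot X=-\nabla V[X]+\delta G[X]$. By the persistence theorem for normally hyperbolic manifolds, for all small $\delta$ there is a $C^2$ map $\phi_\delta:\mathbb R/L\mathbb R\to\mathbb R^n$ with $\langle\phi_\delta(\theta),q'(\theta)\rangle=0$ and $\sup_\theta\{\|\phi_\delta(\theta)\|,\|\phi_\delta'(\theta)\|,\|\phi_\delta''(\theta)\|\}=O(\delta)$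 such that, with $\tilde q_\delta(\theta):=q(\theta)+\phi_\delta(\theta)$, the curve $M^\delta=\{\tilde q_\delta(\theta):\theta\in\mathbb R/L\mathbb R\}$ is an invariant, stable normally hyperbolic manifold of this flow. $L_\delta$ is the length of $M^\delta$ and $q_\delta:\mathbb R/L_\delta\mathbb R\to M^\delta$ is a parametrization with $\|q_\delta'(\varphi)\|=1$ (with the same orientation as $\tilde q_\delta$). Reduced dynamics. Let $b(\theta)=\delta\langle G[q(\theta)],q'(\theta)\rangle$ and $b_\delta(\varphi)=\langle-\nabla V[q_\delta(\varphi)]+\delta G[q_\delta(\varphi)],q_\delta'(\varphi)\rangle$. It is assumed that $b$ has a stable fixed point $\theta^0$ ($b(\theta^0)=0$, $b'(\theta^0)<0$), and $\Delta_1,\Delta_2>0$ are such that $[\theta^0-\Delta_1,\theta^0+\Delta_2]$ is contained in the basin of attraction of $\theta^0$ for $\dot\theta=b(\theta)$. For $\delta$ small, the flow on $M^\delta$ has a stable hyperbolic fixed point $A^\delta=\tilde q_\delta(\theta^\delta_0)=q_\delta(\varphi_{A^\delta})$ with $|\theta_0^\delta-\theta^0|=O(\delta)$, and $[\varphi_{A^\delta}-\Delta_1,\varphi_{A^\delta}+\Delta_2]$ is contained in the basin of attraction of $\varphi_{A^\delta}$ for $\dot\varphi=b_\delta(\varphi)$; $A^\delta$ is a stable fixed point of the perturbed flow in $\mathbb R^n$. Quasipotentials. For $P_1,P_2\in\mathbb R^n$, $$W_\delta(P_1,P_2)=\inf\Big\{\tfrac12\int_T^0\|\dot Y_t+\nabla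 V[Y_t]-\delta G[Y_t]\|^2dt\Big\},$$ over $T<0$ and absolutely continuous $Y:[T,0]\to\mathbb R^n$ with $Y_T=P_1$, $Y_0=P_2$. For $\varphi_1,\varphi_2\in\mathbb R/L_\delta\mathbb R$, $$W^{red}_\delta(\varphi_1,\varphi_2)=\inf\Big\{\tfrac12\int_T^0|\dot\varphi_t-b_\delta(\varphi_t)|^2dt\Big\},$$ over $T<0$ and absolutely continuous $\varphi:[T,0]\to\mathbb R/L_\delta\mathbb R$ with $\varphi_T=\varphi_1$, $\varphi_0=\varphi_2$. *)

theory Defs
  imports "HOL-Analysis.Analysis"
begin

text \<open>Class \<open>C\<^sup>k\<close> on the whole space, by recursion on all directional derivatives.\<close>

fun C_class :: "nat \<Rightarrow> ('a::real_normed_vector \<Rightarrow> 'b::real_normed_vector) \<Rightarrow> bool" where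
  "C_class 0 f \<longleftrightarrow> continuous_on UNIV f"
| "C_class (Suc k) f \<longleftrightarrow>
     (\<forall>x. f differentiable (at x)) \<and>
     (\<forall>v. C_class k (\<lambda>x. frechet_derivative f (at x) v))"

definition grad :: "(real ^ 'n \<Rightarrow> real) \<Rightarrow> real ^ 'n \<Rightarrow> real ^ 'n" where
  "grad V X = (\<chi> i. frechet_derivative V (at X) (axis i 1))"

definition hessian :: "(real ^ 'n \<Rightarrow> real) \<Rightarrow> real ^ 'n \<Rightarrow> real ^ 'n ^ 'n" where
  "hessian V X = jacobian (grad V) (at X)"

definition perturbed_field ::
    "(real ^ 'n \<Rightarrow> real) \<Rightarrow> (real ^ 'n \<Rightarrow> real ^ 'n) \<Rightarrow> real \<Rightarrow> real ^ 'n \<Rightarrow> real ^ 'n" where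
  "perturbed_field V G \<delta> X = - grad V X + \<delta> *\<^sub>R G X"

definition is_solution ::
    "('a::real_normed_vector \<Rightarrow> 'a) \<Rightarrow> real set \<Rightarrow> (real \<Rightarrow> 'a) \<Rightarrow> bool" where
  "is_solution F I x \<longleftrightarrow> (\<forall>t\<in>I. (x has_vector_derivative F (x t)) (at t within I))"

text \<open>
  Functions and points on the circle \<open>\<real>/L\<int>\<close> are represented by \<open>L\<close>-periodic functions on
  \<open>\<real>\<close> and by real representatives.
\<close>

abbreviation velocity :: "(real \<Rightarrow> 'a::real_normed_vector) \<Rightarrow> real \<Rightarrow> 'a" where
  "velocity \<gamma> \<theta> \<equiv> vector_derivative \<gamma> (at \<theta>)"

definition curve_length :: "real \<Rightarrow> (real \<Rightarrow> 'a::real_normed_vector) \<Rightarrow> real" where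
  "curve_length L \<gamma> = integral {0..L} (\<lambda>\<theta>. norm (velocity \<gamma> \<theta>))"

text \<open>
  \<open>M\<close> is a simple closed curve of class \<open>C\<^sup>k\<close> and \<open>\<gamma>\<close> is a bijective unit speed
  parametrization of it by \<open>\<real>/L\<int>\<close>; in particular \<open>M\<close> is compact and its length is \<open>L\<close>.
\<close>

definition unit_speed_param ::
    "nat \<Rightarrow> real \<Rightarrow> 'a::real_normed_vector set \<Rightarrow> (real \<Rightarrow> 'a) \<Rightarrow> bool" where
  "unit_speed_param k L M \<gamma> \<longleftrightarrow>
     L > 0 \<and> C_class k \<gamma> \<and> (\<forall>\<theta>. norm (velocity \<gamma> \<theta>) = 1) \<and>
     (\<forall>s t. \<gamma> s = \<gamma> t \<longleftrightarrow> (\<exists>m::int. s = t + of_int m * L)) \<and> range \<gamma> = M"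

text \<open>
  For the locally Lipschitz fields considered here, solutions are unique, so the solution below
  is the flow line through \<open>p\<close>.
\<close>

definition invariant_under_flow :: "('a::real_normed_vector \<Rightarrow> 'a) \<Rightarrow> 'a set \<Rightarrow> bool" where
  "invariant_under_flow F M \<longleftrightarrow>
     (\<forall>p\<in>M. \<exists>x. is_solution F UNIV x \<and> x 0 = p \<and> range x \<subseteq> M)"

text \<open>
  \<open>range \<gamma>\<close> is invariant, and along it there is a continuous splitting of the ambient space into
  the tangent line (the range of \<open>P p\<close>) and a complement (the kernel of \<open>P p\<close>). The splitting is
  invariant under the linearized flow \<open>\<dot>v = DF(x) v\<close>, which contracts the complement at a
  rate \<open>\<mu>\<close> strictly larger than the rate \<open>\<nu>\<close> bounding its growth, in both time directions, on the
  tangent line.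
\<close>

definition stable_normally_hyperbolic ::
    "('a::real_normed_vector \<Rightarrow> 'a) \<Rightarrow> (real \<Rightarrow> 'a) \<Rightarrow> bool" where
  "stable_normally_hyperbolic F \<gamma> \<longleftrightarrow>
     invariant_under_flow F (range \<gamma>) \<and>
     (\<exists>(P :: 'a \<Rightarrow> 'a \<Rightarrow>\<^sub>L 'a) C \<nu> \<mu>.
        0 \<le> \<nu> \<and> \<nu> < \<mu> \<and> continuous_on (range \<gamma>) P \<and>
        (\<forall>p\<in>range \<gamma>. P p o\<^sub>L P p = P p) \<and>
        (\<forall>\<theta>. range (blinfun_apply (P (\<gamma> \<theta>))) = span {velocity \<gamma> \<theta>}) \<and>
        (\<forall>x v. is_solution F UNIV x \<and> range x \<subseteq> range \<gamma> \<and>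
           (\<forall>t. (v has_vector_derivative frechet_derivative F (at (x t)) (v t)) (at t)) \<longrightarrow>
             (P (x 0) (v 0) = v 0 \<longrightarrow>
                (\<forall>t. P (x t) (v t) = v t \<and>
                     norm (v t) \<le> C * exp (\<nu> * \<bar>t\<bar>) * norm (v 0))) \<and>
             (P (x 0) (v 0) = 0 \<longrightarrow>
                (\<forall>t. P (x t) (v t) = 0) \<and>
                (\<forall>t\<ge>0. norm (v t) \<le> C * exp (- \<mu> * t) * norm (v 0)))))"

definition asymptotically_stable_point :: "('a::real_normed_vector \<Rightarrow> 'a) \<Rightarrow> 'a \<Rightarrow> bool" where
  "asymptotically_stable_point F p \<longleftrightarrow>
     F p = 0 \<and>
     (\<forall>\<epsilon>>0. \<exists>\<eta>>0. \<forall>x T. is_solution F {0..T} x \<and> dist (x 0) p < \<eta> \<longrightarrow>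
        (\<forall>t\<in>{0..T}. dist (x t) p < \<epsilon>)) \<and>
     (\<exists>\<eta>>0. \<forall>x. is_solution F {0..} x \<and> dist (x 0) p < \<eta> \<longrightarrow> (x \<longlongrightarrow> p) at_top)"

definition stable_hyperbolic_zero :: "(real \<Rightarrow> real) \<Rightarrow> real \<Rightarrow> bool" where
  "stable_hyperbolic_zero f p \<longleftrightarrow> f p = 0 \<and> (\<exists>D<0. (f has_real_derivative D) (at p))"

text \<open>Convergence on the circle \<open>\<real>/L\<int>\<close> is convergence of a lift to some representative of \<open>p\<close>.\<close>

definition circle_basin :: "real \<Rightarrow> (real \<Rightarrow> real) \<Rightarrow> real \<Rightarrow> real set" where
  "circle_basin L f p =
     {y. \<exists>x. is_solution f {0..} x \<and> x 0 = y \<and>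
             (\<exists>m::int. (x \<longlongrightarrow> p + of_int m * L) at_top)}"

definition b_unpert ::
    "('a::real_inner \<Rightarrow> 'a) \<Rightarrow> (real \<Rightarrow> 'a) \<Rightarrow> real \<Rightarrow> real \<Rightarrow> real" where
  "b_unpert G q \<delta> \<theta> = \<delta> * (G (q \<theta>) \<bullet> velocity q \<theta>)"

definition b_pert :: "('a::real_inner \<Rightarrow> 'a) \<Rightarrow> (real \<Rightarrow> 'a) \<Rightarrow> real \<Rightarrow> real" where
  "b_pert F \<gamma> \<phi> = F (\<gamma> \<phi>) \<bullet> velocity \<gamma> \<phi>"

definition abs_continuous :: "real \<Rightarrow> real \<Rightarrow> (real \<Rightarrow> 'a::real_normed_vector) \<Rightarrow> bool" where
  "abs_continuous s t Y \<longleftrightarrow>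
     (\<forall>\<epsilon>>0. \<exists>\<eta>>0. \<forall>(n::nat) a b.
        (\<forall>i<n. s \<le> a i \<and> a i \<le> b i \<and> b i \<le> t) \<and>
        (\<forall>i<n. \<forall>j<n. i \<noteq> j \<longrightarrow> {a i<..<b i} \<inter> {a j<..<b j} = {}) \<and>
        (\<Sum>i<n. b i - a i) < \<eta> \<longrightarrow>
        (\<Sum>i<n. norm (Y (b i) - Y (a i))) < \<epsilon>)"

text \<open>
  For absolutely continuous \<open>Y\<close> the derivative exists almost everywhere on \<open>[T, 0]\<close>. The action
  may be infinite, hence the extended nonnegative values.
\<close>

definition action :: "('a::real_normed_vector \<Rightarrow> 'a) \<Rightarrow> real \<Rightarrow> (real \<Rightarrow> 'a) \<Rightarrow> ennreal" where
  "action F T Y =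
     (\<integral>\<^sup>+ t\<in>{T..0}. ennreal ((norm (vector_derivative Y (at t) - F (Y t)))\<^sup>2 / 2) \<partial>lebesgue)"

definition quasipotential :: "('a::real_normed_vector \<Rightarrow> 'a) \<Rightarrow> 'a \<Rightarrow> 'a \<Rightarrow> ennreal" where
  "quasipotential F P1 P2 =
     Inf {action F T Y |T Y. T < 0 \<and> abs_continuous T 0 Y \<and> Y T = P1 \<and> Y 0 = P2}"

text \<open>
  The same for paths in \<open>\<real>/L\<int>\<close> and \<open>L\<close>-periodic \<open>f\<close>: an absolutely continuous path in the
  circle is represented by its lifts, whose end points need only agree with \<open>p1\<close> and \<open>p2\<close>
  modulo \<open>L\<close>.
\<close>

definition circle_quasipotential ::
    "real \<Rightarrow> (real \<Rightarrow> real) \<Rightarrow> real \<Rightarrow> real \<Rightarrow> ennreal" where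
  "circle_quasipotential L f p1 p2 =
     Inf {action f T Y |T Y. T < 0 \<and> abs_continuous T 0 Y \<and>
            (\<exists>m::int. Y T = p1 + of_int m * L) \<and> (\<exists>m::int. Y 0 = p2 + of_int m * L)}"

end

theory Submission
  imports Defs
begin

text \<open>
  Let \<open>B\<close> be the primitive, vanishing at \<open>\<phi>A\<close>, of the part of \<open>-2b\<^sub>\<delta>\<close> that has to be paid for when
  moving away from \<open>\<phi>A\<close>. Moving along the curve at speed \<open>\<bar>b\<^sub>\<delta>\<bar> + \<epsilon>\<close> shows that both quasipotentials are
  at most \<open>B\<close> at every lift of the target. Conversely, \<open>B\<close> calibrates the reduced problem exactly, while
  in \<open>\<real>\<^sup>n\<close> the function \<open>(1 - C \<delta>\<^sup>2) B + (\<lambda>/2) \<bar>w\<bar>\<^sup>2\<close>, with \<open>w\<close> the displacement from the invariant curve in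
  the direction normal to \<open>M\<close>, is a subsolution of the Hamilton-Jacobi equation in a tube around \<open>M\<close>
  of size independent of \<open>\<delta>\<close>: the terms that couple \<open>w\<close> to the tangential momentum \<open>p\<close> are
  \<open>O(\<delta> \<bar>p\<bar> \<bar>w\<bar>)\<close>, hence absorbed by \<open>\<delta>\<^sup>2 p\<^sup>2 + \<bar>w\<bar>\<^sup>2\<close>. Paths leaving the tube cost a fixed positive amount,
  whereas \<open>B = O(\<delta>)\<close>. So the two quasipotentials differ by \<open>O(\<delta>\<^sup>2) B = O(\<delta>\<^sup>3)\<close>.
\<close>

section \<open>Absolutely continuous functions\<close>

text \<open>\<open>B\<close> need not be periodic, so the subsolution is not a function on the tube.
  It depends on a foot parameter that has to be followed continuously along each path and that ends
  at an unknown lift of the target; hence bounds for arbitrary lifts.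

  Two facts make the loss second order in \<delta>. The Hessian is symmetric and annihilates the
  tangent, so no tangential force of order |w| with a coefficient of order one appears. And the
  speed of the perturbed curve differs from the Jacobian \<open>1 - \<phi> \<bullet> q2\<close> of
  the foot equation only through the part of the derivative of \<open>\<phi>\<close> normal to M,
  which enters squared.

  The weight lam/2 is the optimal one: a normal gradient k w contributes at most (k^2/2 - k lam)
  |w|^2 to leading order, which is smallest at k = lam and leaves - lam^2/2 |w|^2 for the errors.

  Absolute continuity is the epsilon-delta notion, whereas the action reads off pointwise
  derivatives. Potentials along paths can be integrated only once differentiability almost
  everywhere and the fundamental theorem of calculus are available; the former rests on Vitali
  coverings.\<close>

definition incr :: "(real \<Rightarrow> 'a::real_normed_vector) \<Rightarrow> real set \<Rightarrow> 'a" where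
  "incr f k = f (Sup k) - f (Inf k)"

lemma incr_interval [simp]: "u \<le> v \<Longrightarrow> incr f {u..v} = f v - f u"
  by (simp add: incr_def)

definition nonoverlapping :: "real \<Rightarrow> real \<Rightarrow> real \<Rightarrow> nat \<Rightarrow> (nat \<Rightarrow> real) \<Rightarrow> (nat \<Rightarrow> real) \<Rightarrow> bool" where
  "nonoverlapping s t d n a b \<longleftrightarrow>
        (\<forall>i<n. s \<le> a i \<and> a i \<le> b i \<and> b i \<le> t) \<and>
        (\<forall>i<n. \<forall>j<n. i \<noteq> j \<longrightarrow> {a i<..<b i} \<inter> {a j<..<b j} = {}) \<and>
        (\<Sum>i<n. b i - a i) < d"

lemma nonoverlapping_mem:
  assumes "nonoverlapping s t d n a b" "i < n"
  shows "a i \<in> {s..t}" "b i \<in> {s..t}"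
proof -
  have "s \<le> a i \<and> a i \<le> b i \<and> b i \<le> t" using assms by (simp add: nonoverlapping_def)
  then show "a i \<in> {s..t}" "b i \<in> {s..t}" by auto
qed

lemma nonoverlapping_mono:
  assumes "nonoverlapping s' t' d' n a b" "s \<le> s'" "t' \<le> t" "d' \<le> d"
  shows "nonoverlapping s t d n a b"
proof -
  have "s \<le> a i \<and> a i \<le> b i \<and> b i \<le> t" if "i < n" for i
  proof -
    have "s' \<le> a i \<and> a i \<le> b i \<and> b i \<le> t'" using assms(1) that by (simp add: nonoverlapping_def)
    then show ?thesis using assms(2,3) by simp
  qed
  moreover have "(\<Sum>i<n. b i - a i) < d" using assms(1,4) by (simp add: nonoverlapping_def)
  ultimately show ?thesis using assms(1) by (simp add: nonoverlapping_def)
qed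

lemma abs_continuousD:
  assumes "abs_continuous s t f" "e > 0"
  obtains d where "d > 0"
    "\<And>n a b. nonoverlapping s t d n a b \<Longrightarrow> (\<Sum>i<n. norm (f (b i) - f (a i))) < e"
proof -
  have "\<exists>d>0. \<forall>n a b. nonoverlapping s t d n a b \<longrightarrow> (\<Sum>i<n. norm (f (b i) - f (a i))) < e"
    using assms unfolding abs_continuous_def nonoverlapping_def by simp
  then show thesis using that by blast
qed

lemma abs_continuousI:
  assumes "\<And>e. e > 0 \<Longrightarrow> \<exists>d>0. \<forall>n a b. nonoverlapping s t d n a b \<longrightarrow> 
     (\<Sum>i<n. norm (f (b i) - f (a i))) < e"
  shows "abs_continuous s t f"
  unfolding abs_continuous_def
proof (intro allI impI)
  fix e :: real assume "e > 0"
  from assms[OF this] show "\<exists>\<eta>>0. \<forall>(n::nat) a b.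
        (\<forall>i<n. s \<le> a i \<and> a i \<le> b i \<and> b i \<le> t) \<and>
        (\<forall>i<n. \<forall>j<n. i \<noteq> j \<longrightarrow> {a i<..<b i} \<inter> {a j<..<b j} = {}) \<and>
        (\<Sum>i<n. b i - a i) < \<eta> \<longrightarrow>
        (\<Sum>i<n. norm (f (b i) - f (a i))) < e"
    unfolding nonoverlapping_def .
qed

lemma abs_continuous_subset:
  assumes "abs_continuous s t f" "s \<le> s'" "t' \<le> t"
  shows "abs_continuous s' t' f"
proof (rule abs_continuousI)
  fix e :: real assume "e > 0"
  obtain d where "d > 0" and d: "\<And>n a b. nonoverlapping s t d n a b \<Longrightarrow> (\<Sum>i<n. norm (f (b i) - f (a i))) < e"
    using abs_continuousD[OF assms(1) \<open>e > 0\<close>] by blast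
  show "\<exists>\<eta>>0. \<forall>n a b. nonoverlapping s' t' \<eta> n a b \<longrightarrow>
             (\<Sum>i<n. norm (f (b i) - f (a i))) < e"
  proof (intro exI[of _ d] conjI allI impI)
    fix n :: nat and a b :: "nat \<Rightarrow> real"
    assume "nonoverlapping s' t' d n a b"
    then show "(\<Sum>i<n. norm (f (b i) - f (a i))) < e"
      using assms(2,3) by (intro d) (auto intro: nonoverlapping_mono)
  qed fact
qed

text \<open>A modulus for \<open>f\<close>, taken at a scaled tolerance, works for \<open>g\<close>.
  This one rule yields absolute continuity of components, of potentials along a path and of the foot
  parameter.\<close>

lemma abs_continuous_dominated:
  fixes f :: "real \<Rightarrow> 'a::real_normed_vector" and g :: "real \<Rightarrow> 'b::real_normed_vector"
  assumes f: "abs_continuous s t f"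
    and dom: "\<And>x y. x \<in> {s..t} \<Longrightarrow> y \<in> {s..t} \<Longrightarrow> norm (g y - g x) \<le> C * norm (f y - f x)"
  shows "abs_continuous s t g"
proof (rule abs_continuousI)
  fix e :: real assume "e > 0"
  define C' where "C' = \<bar>C\<bar> + 1"
  have "C' > 0" by (simp add: C'_def)
  have dom': "norm (g y - g x) \<le> C' * norm (f y - f x)" if "x \<in> {s..t}" "y \<in> {s..t}" for x y
    using dom[OF that] by (rule order_trans) (auto simp: C'_def intro!: mult_right_mono)
  have "e / C' > 0" using \<open>e > 0\<close> \<open>C' > 0\<close> by simp
  obtain d where "d > 0" and d: "\<And>n a b. nonoverlapping s t d n a b \<Longrightarrow> (\<Sum>i<n. norm (f (b i) - f (a i))) < e / C'"
    using abs_continuousD[OF f \<open>e / C' > 0\<close>] by blast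
  show "\<exists>\<eta>>0. \<forall>n a b. nonoverlapping s t \<eta> n a b \<longrightarrow>
             (\<Sum>i<n. norm (g (b i) - g (a i))) < e"
  proof (intro exI[of _ d] conjI allI impI)
    fix n :: nat and a b
    assume H: "nonoverlapping s t d n a b"
    have "(\<Sum>i<n. norm (g (b i) - g (a i))) \<le> (\<Sum>i<n. C' * norm (f (b i) - f (a i)))"
      by (intro sum_mono dom' nonoverlapping_mem[OF H]) auto
    also have "\<dots> = C' * (\<Sum>i<n. norm (f (b i) - f (a i)))"
      by (simp add: sum_distrib_left)
    also have "\<dots> < e"
      using d[OF H] \<open>C' > 0\<close> by (simp add: field_simps)
    finally show "(\<Sum>i<n. norm (g (b i) - g (a i))) < e" .
  qed fact
qed

lemma abs_continuous_lipschitz: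
  assumes "\<And>x y. x \<in> {s..t} \<Longrightarrow> y \<in> {s..t} \<Longrightarrow> norm (g y - g x) \<le> C * \<bar>y - x\<bar>"
  shows "abs_continuous s t g"
proof (rule abs_continuous_dominated[where f = "\<lambda>x. x"])
  show "abs_continuous s t (\<lambda>x::real. x)"
  proof (rule abs_continuousI)
    fix e :: real assume "e > 0"
    show "\<exists>\<eta>>0. \<forall>n a b. nonoverlapping s t \<eta> n a b \<longrightarrow>
             (\<Sum>i<n. norm (b i - a i)) < e"
      using \<open>e > 0\<close> by (intro exI[of _ e]) (auto simp: nonoverlapping_def intro!: sum.cong order.strict_trans1[OF eq_refl])
  qed
qed (use assms in auto)

lemma abs_continuous_add:
  assumes "abs_continuous s t f" "abs_continuous s t g"
  shows "abs_continuous s t (\<lambda>x. f x + g x)"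
proof (rule abs_continuousI)
  fix e :: real assume "e > 0"
  then have "e / 2 > 0" by simp
  obtain d1 where "d1 > 0" and d1: "\<And>n a b. nonoverlapping s t d1 n a b \<Longrightarrow> (\<Sum>i<n. norm (f (b i) - f (a i))) < e / 2"
    using abs_continuousD[OF assms(1) \<open>e / 2 > 0\<close>] by blast
  obtain d2 where "d2 > 0" and d2: "\<And>n a b. nonoverlapping s t d2 n a b \<Longrightarrow> (\<Sum>i<n. norm (g (b i) - g (a i))) < e / 2"
    using abs_continuousD[OF assms(2) \<open>e / 2 > 0\<close>] by blast
  show "\<exists>\<eta>>0. \<forall>n a b. nonoverlapping s t \<eta> n a b \<longrightarrow>
             (\<Sum>i<n. norm (f (b i) + g (b i) - (f (a i) + g (a i)))) < e"
  proof (intro exI[of _ "min d1 d2"] conjI allI impI)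
    fix n :: nat and a b
    assume H: "nonoverlapping s t (min d1 d2) n a b"
    have "(\<Sum>i<n. norm (f (b i) + g (b i) - (f (a i) + g (a i)))) 
        \<le> (\<Sum>i<n. norm (f (b i) - f (a i)) + norm (g (b i) - g (a i)))"
      by (intro sum_mono) (metis add_diff_add norm_triangle_ineq)
    also have "\<dots> < e / 2 + e / 2"
      unfolding sum.distrib by (intro add_strict_mono d1 d2 nonoverlapping_mono[OF H]) auto
    finally show "(\<Sum>i<n. norm (f (b i) + g (b i) - (f (a i) + g (a i)))) < e" by simp
  qed (use \<open>d1>0\<close> \<open>d2>0\<close> in auto)
qed

section \<open>Interval families and Vitali coverings\<close>

definition interval_family :: "real \<Rightarrow> real \<Rightarrow> real set set \<Rightarrow> bool" where
  "interval_family s t D \<longleftrightarrow> finite D \<and> (\<forall>k\<in>D. k \<subseteq> {s..t} \<and> (\<exists>u v. u \<le> v \<and> k = {u..v})) \<and>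
     (\<forall>k\<in>D. \<forall>l\<in>D. k \<noteq> l \<longrightarrow> interior k \<inter> interior l = {})"

text \<open>Coverings and divisions arrive as sets of intervals, so the indexed definition is
  transported along an enumeration of the set; every interval is recovered from its
  \<open>Inf\<close> and \<open>Sup\<close>.\<close>

lemma abs_continuous_family:
  fixes f :: "real \<Rightarrow> 'a::real_normed_vector"
  assumes f: "abs_continuous s t f" and "e > 0"
  obtains d where "d > 0"
    "\<And>D. \<lbrakk>interval_family s t D;
       (\<Sum>k\<in>D. measure lborel k) < d\<rbrakk> \<Longrightarrow> (\<Sum>k\<in>D. norm (incr f k)) < e"
proof -
  obtain d where "d > 0" and d: "\<And>n a b. nonoverlapping s t d n a b \<Longrightarrow> (\<Sum>i<n. norm (f (b i) - f (a i))) < e"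
    using abs_continuousD[OF assms] by blast
  show thesis
  proof
    show "d > 0" by fact
    fix D :: "real set set" assume fam: "interval_family s t D"
      and small: "(\<Sum>k\<in>D. measure lborel k) < d"
    have fin: "finite D" and D: "\<And>k. k \<in> D \<Longrightarrow> k \<subseteq> {s..t} \<and> (\<exists>u v. u \<le> v \<and> k = {u..v})"
      and disj: "\<And>k l. k \<in> D \<Longrightarrow> l \<in> D \<Longrightarrow> k \<noteq> l \<Longrightarrow> interior k \<inter> interior l = {}"
      using fam by (auto simp: interval_family_def)
    obtain h where h: "bij_betw h {..<card D} D"
      using ex_bij_betw_nat_finite[OF fin] by (auto simp: lessThan_atLeast0)
    have hD: "h i \<in> D" if "i < card D" for i
      using bij_betwE[OF h] that by auto
    have k: "k = {Inf k..Sup k} \<and> Inf k \<le> Sup k \<and> s \<le> Inf k \<and> Sup k \<le> t" if kD: "k \<in> D" for k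
    proof -
      obtain u v where "u \<le> v" "k = {u..v}" "k \<subseteq> {s..t}" using D[OF kD] by blast
      then show ?thesis by auto
    qed
    have int: "interior k = {Inf k<..<Sup k}" if kD: "k \<in> D" for k
      using k[OF kD] by (metis interior_atLeastAtMost_real)
    have cont: "measure lborel k = Sup k - Inf k" if kD: "k \<in> D" for k
      using k[OF kD] by (metis content_real)
    have reindex: "(\<Sum>i<card D. g (h i)) = (\<Sum>k\<in>D. g k)" for g :: "real set \<Rightarrow> real"
      using sum.reindex_bij_betw[OF h] .
    have "(\<Sum>i<card D. norm (f (Sup (h i)) - f (Inf (h i)))) < e"
    proof (rule d, unfold nonoverlapping_def, intro conjI allI impI)
      fix i j assume "i < card D" "j < card D" "i \<noteq> j"
      moreover have "h i \<noteq> h j"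
        using h calculation unfolding bij_betw_def inj_on_def by auto
      ultimately show "{Inf (h i)<..<Sup (h i)} \<inter> {Inf (h j)<..<Sup (h j)} = {}"
        using disj[of "h i" "h j"] hD int by auto
    next
      have "(\<Sum>i<card D. Sup (h i) - Inf (h i)) = (\<Sum>i<card D. measure lborel (h i))"
        using hD cont by (intro sum.cong) auto
      also have "\<dots> < d" using small reindex[of "measure lborel"] by simp
      finally show "(\<Sum>i<card D. Sup (h i) - Inf (h i)) < d" .
    qed (use hD k in auto)
    also have "(\<Sum>i<card D. norm (f (Sup (h i)) - f (Inf (h i)))) = (\<Sum>k\<in>D. norm (incr f k))"
      using reindex[of "\<lambda>k. norm (incr f k)"] by (simp add: incr_def)
    finally show "(\<Sum>k\<in>D. norm (incr f k)) < e" .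
  qed
qed

lemma abs_continuous_imp_continuous_on:
  fixes f :: "real \<Rightarrow> 'a::real_normed_vector"
  assumes f: "abs_continuous s t f"
  shows "continuous_on {s..t} f"
  unfolding continuous_on_iff
proof (intro ballI allI impI)
  fix x e :: real assume x: "x \<in> {s..t}" and "e > 0"
  obtain d where "d > 0" and d: "\<And>D. \<lbrakk>interval_family s t D;
       (\<Sum>k\<in>D. measure lborel k) < d\<rbrakk> \<Longrightarrow> (\<Sum>k\<in>D. norm (incr f k)) < e"
    using abs_continuous_family[OF f \<open>e > 0\<close>] by blast
  have *: "norm (f v - f u) < e" if "u \<le> v" "v - u < d" "s \<le> u" "v \<le> t" for u v
    using d[of "{{u..v}}"] that by (auto simp: interval_family_def)
  show "\<exists>d>0. \<forall>x'\<in>{s..t}. dist x' x < d \<longrightarrow> dist (f x') (f x) < e"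
  proof (intro exI[of _ d] conjI ballI impI)
    fix y assume y: "y \<in> {s..t}" "dist y x < d"
    show "dist (f y) (f x) < e"
    proof (cases "x \<le> y")
      case True then show ?thesis using * [of x y] x y by (auto simp: dist_norm)
    next
      case False then show ?thesis using * [of y x] x y by (auto simp: dist_norm norm_minus_commute)
    qed
  qed fact
qed

text \<open>The Vitali theorem gives countably many disjoint intervals exhausting \<open>S\<close>
  up to a null set; a finite subfamily then misses less than \<open>e\<close>. Confinement to
  \<open>G\<close> caps the total length from above.\<close>

lemma Vitali_intervals:
  fixes S G :: "real set"
  assumes S: "S \<in> lmeasurable" and G: "G \<in> lmeasurable" and "e > 0"
    and cover: "\<And>x d. x \<in> S \<Longrightarrow> d > 0 \<Longrightarrow> \<exists>u v. u < v \<and> x \<in> {u..v} \<and> v - u < d \<and> {u..v} \<subseteq> G \<and> P u v"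
  shows "\<exists>D. finite D \<and> (\<forall>k\<in>D. k \<subseteq> G \<and> (\<exists>u v. u < v \<and> k = {u..v} \<and> P u v)) \<and>
    disjoint D \<and> (\<Sum>k\<in>D. measure lborel k) > measure lebesgue S - e \<and> (\<Sum>k\<in>D. measure lborel k) \<le> measure lebesgue G"
proof -
  define K where "K = {(u,v). u < v \<and> {u..v} \<subseteq> G \<and> P u v}"
  define a where "a = (\<lambda>(u::real,v). (u + v) / 2)"
  define r where "r = (\<lambda>(u::real,v). (v - u) / 2)"
  have cb: "cball (a i) (r i) = {fst i..snd i}" for i
    unfolding a_def r_def cball_eq_atLeastAtMost by (auto simp: case_prod_beta field_simps)
  obtain C where C: "countable C" "C \<subseteq> K"
     "pairwise (\<lambda>i j. disjnt (cball (a i) (r i)) (cball (a j) (r j))) C"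
     "negligible (S - (\<Union>i \<in> C. cball (a i) (r i)))"
  proof (rule Vitali_covering_theorem_cballs[of K r S a])
    show "0 < r i" if "i \<in> K" for i using that by (auto simp: K_def r_def)
    show "\<exists>i. i \<in> K \<and> x \<in> cball (a i) (r i) \<and> r i < d" if xd: "x \<in> S" "0 < d" for x d
    proof -
      obtain u v where "u < v" "x \<in> {u..v}" "v - u < d" "{u..v} \<subseteq> G" "P u v"
        using cover[OF xd] by blast
      then show ?thesis
        by (intro exI[of _ "(u,v)"]) (auto simp: K_def cb, auto simp: r_def)
    qed
  qed
  define I where "I = (\<lambda>i::real\<times>real. {fst i..snd i})"
  have C_neg: "negligible (S - (\<Union>i \<in> C. I i))" using C(4) unfolding cb I_def .
  have dis: "disjnt (I i) (I j)" if "i \<in> C" "j \<in> C" "i \<noteq> j" for i j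
    using C(3) that unfolding pairwise_def cb I_def by blast
  have Ine: "fst i < snd i" "I i \<subseteq> G" "P (fst i) (snd i)" if "i \<in> C" for i 
  proof -
    have "i \<in> K" using that C(2) by blast
    then show "fst i < snd i" "I i \<subseteq> G" "P (fst i) (snd i)" 
      unfolding I_def K_def by (auto simp: case_prod_beta)
  qed
  have inj: "inj_on I C"
  proof (rule inj_onI)
    fix i j assume "i \<in> C" "j \<in> C" "I i = I j"
    then show "i = j" using Ine(1)[of i] Ine(1)[of j] by (auto simp: I_def prod_eq_iff)
  qed
  have meas: "measure lebesgue (\<Union>i\<in>F. I i) = (\<Sum>k\<in>I ` F. measure lborel k)" if "finite F" "F \<subseteq> C" for F
  proof -
    have "measure lebesgue (\<Union>i\<in>F. I i) = (\<Sum>i\<in>F. measure lebesgue (I i))"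
    proof (intro measure_finite_Union)
      show "disjoint_family_on I F"
        unfolding disjoint_family_on_def using that(2) dis unfolding disjnt_def by blast
      show "emeasure lebesgue (I i) \<noteq> \<infinity>" if "i \<in> F" for i 
        using emeasure_lborel_cbox_finite[of "fst i" "snd i"] by (simp add: I_def less_top)
    qed (use that in \<open>auto simp: I_def\<close>)
    also have "\<dots> = (\<Sum>i\<in>F. measure lborel (I i))"
      by (intro sum.cong) (auto simp: I_def)
    also have "\<dots> = (\<Sum>k\<in>I ` F. measure lborel k)"
      using inj that by (subst sum.reindex) (auto intro: inj_on_subset)
    finally show ?thesis .
  qed
  \<comment> \<open>Were every finite union at most \<open>measure lebesgue S - e\<close> in
    measure, so would be the countable one, although it covers \<open>S\<close> up to a null
    set.\<close>
  have "\<exists>F. finite F \<and> F \<subseteq> C \<and> measure lebesgue (\<Union>i\<in>F. I i) > measure lebesgue S - e"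
  proof (rule ccontr)
    assume neg: "\<not> ?thesis"
    have b: "measure lebesgue (\<Union>i\<in>F. I i) \<le> measure lebesgue S - e" if "F \<subseteq> C" "finite F" for F
      using neg that by (meson not_le)
    have fmI: "I i \<in> lmeasurable" for i by (simp add: I_def)
    have 1: "(\<Union>i\<in>C. I i) \<in> lmeasurable" 
      using fmeasurable_UN_bound[OF C(1) fmI b] by auto
    have 2: "measure lebesgue (\<Union>i\<in>C. I i) \<le> measure lebesgue S - e"
      using measure_UN_bound[OF C(1) fmI b] by auto
    have "measure lebesgue S \<le> measure lebesgue ((\<Union>i\<in>C. I i) \<union> (S - (\<Union>i \<in> C. I i)))"
      using 1 S by (intro measure_mono_fmeasurable) (auto intro: fmeasurable.Un fmeasurable.Diff)
    also have "\<dots> \<le> measure lebesgue (\<Union>i\<in>C. I i) + measure lebesgue (S - (\<Union>i \<in> C. I i))"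
      using 1 S by (intro measure_Un_le) auto
    also have "\<dots> \<le> measure lebesgue S - e"
      using 2 C_neg by (simp add: negligible_imp_measure0)
    finally show False using \<open>e > 0\<close> by simp
  qed
  then obtain F where F: "finite F" "F \<subseteq> C" "measure lebesgue (\<Union>i\<in>F. I i) > measure lebesgue S - e"
    by blast
  show ?thesis
  proof (intro exI[of _ "I ` F"] conjI ballI)
    show "finite (I ` F)" using F by simp
    fix k assume "k \<in> I ` F"
    then obtain i where i: "i \<in> C" "k = I i" using F(2) by blast
    show "k \<subseteq> G" using i Ine(2) by simp
    show "\<exists>u v. u < v \<and> k = {u..v} \<and> P u v" using i Ine[of i] by (auto simp: I_def)
  next
    show "disjoint (I ` F)" 
    proof (rule pairwise_imageI)
      show "disjnt (I i) (I j)" if "i \<in> F" "j \<in> F" "i \<noteq> j" "I i \<noteq> I j" for i j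
        using dis[of i j] that F(2) by blast
    qed
    show "(\<Sum>k\<in>I ` F. measure lborel k) > measure lebesgue S - e" using F meas by simp
    have "measure lebesgue (\<Union>i\<in>F. I i) \<le> measure lebesgue G"
      using Ine(2) F(2) by (intro measure_mono_fmeasurable[OF _ _ G] UN_least sets.finite_UN F(1)) (auto simp: I_def)
    then show "(\<Sum>k\<in>I ` F. measure lborel k) \<le> measure lebesgue G" using F meas by simp
  qed
qed

text \<open>Tagging each cell with its left end point turns the division into a tagged one, for
  which the telescoping sum is known.\<close>

lemma incr_division:
  fixes f :: "real \<Rightarrow> real"
  assumes "q division_of {a..b}" "a \<le> b"
  shows "(\<Sum>k\<in>q. incr f k) = f b - f a"
proof -
  have k: "\<exists>u v. u \<le> v \<and> k = {u..v}" if "k \<in> q" for k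
    using division_ofD(3,4)[OF assms(1) that] by (metis atLeastatMost_empty_iff2 box_real(2) linorder_not_le order_less_imp_le)
  have td: "(\<lambda>k. (Inf k, k)) ` q tagged_division_of {a..b}"
    unfolding tagged_division_of
  proof (intro conjI allI impI)
    show "finite ((\<lambda>k. (Inf k, k)) ` q)" using assms(1) by auto
    fix x K assume "(x, K) \<in> (\<lambda>k. (Inf k, k)) ` q"
    then have K: "K \<in> q" "x = Inf K" by auto
    then show "x \<in> K" using k[of K] by auto
    show "K \<subseteq> {a..b}" using division_ofD(2)[OF assms(1) K(1)] .
    show "\<exists>a b. K = cbox a b" using division_ofD(4)[OF assms(1) K(1)] .
  next
    fix x1 K1 x2 K2
    assume "(x1, K1) \<in> (\<lambda>k. (Inf k, k)) ` q \<and> (x2, K2) \<in> (\<lambda>k. (Inf k, k)) ` q \<and> (x1, K1) \<noteq> (x2, K2)"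
    then show "interior K1 \<inter> interior K2 = {}"
      using division_ofD(5)[OF assms(1)] by auto
  next
    show "\<Union> {K. \<exists>x. (x, K) \<in> (\<lambda>k. (Inf k, k)) ` q} = {a..b}"
      using division_ofD(6)[OF assms(1)] by (auto simp: image_iff)
  qed
  have "f b - f a = (\<Sum>(x,K)\<in>(\<lambda>k. (Inf k, k)) ` q. f (Sup K) - f (Inf K))"
    by (rule additive_tagged_division_1[OF assms(2) td, symmetric])
  also have "\<dots> = (\<Sum>k\<in>q. incr f k)"
    by (subst sum.reindex) (auto simp: inj_on_def incr_def)
  finally show ?thesis by simp
qed

text \<open>
  Cover \<open>S\<close> by disjoint intervals \<open>I\<close> of negative increment, and then \<open>S\<close> again by disjoint intervals \<open>J\<close>
  of slope at least \<open>c\<close>, each inside some \<open>I\<close>. The intervals \<open>J\<close> nearly exhaust the \<open>I\<close>, so by absolute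
  continuity the two total increments are close, although they have opposite signs.
\<close>

lemma null_two_slopes:
  fixes f :: "real \<Rightarrow> real"
  assumes f: "abs_continuous s t f" and "c > 0" and S: "S \<in> lmeasurable"
    and up: "\<And>x d. x \<in> S \<Longrightarrow> d > 0 \<Longrightarrow> \<exists>u v. u < x \<and> x < v \<and> v - u < d \<and> s \<le> u \<and> v \<le> t \<and> c * (v - u) < f v - f u"
    and down: "\<And>x d. x \<in> S \<Longrightarrow> d > 0 \<Longrightarrow> \<exists>u v. u < x \<and> x < v \<and> v - u < d \<and> s \<le> u \<and> v \<le> t \<and> f v - f u < - c * (v - u)"
  shows "negligible S"
proof (rule ccontr)
  assume "\<not> negligible S"
  define m where "m = measure lebesgue S"
  have m: "m > 0"
    using \<open>\<not> negligible S\<close> S negligible_iff_measure0 unfolding m_def by (metis measure_nonneg order_le_less)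
  have "c * m / 4 > 0" using m \<open>c > 0\<close> by simp
  obtain d where "d > 0" and d: "\<And>D. \<lbrakk>interval_family s t D; (\<Sum>k\<in>D. measure lborel k) < d\<rbrakk> \<Longrightarrow> (\<Sum>k\<in>D. norm (incr f k)) < c * m / 4"
    using abs_continuous_family[OF f \<open>c * m / 4 > 0\<close>] by blast
  \<comment> \<open>The cells left over by the \<open>J\<close> have total length below
    \<open>(m + e) - (m - 3 * e) = 4 * e < d\<close>, so their increments stay below
    \<open>c * m / 4\<close>. The \<open>J\<close> have total length at least
    \<open>m - 3 * e \<ge> 3 * m / 4\<close>, so they gain at least
    \<open>3 * c * m / 4\<close>.\<close>
  define e where "e = min (m / 12) (d / 8)"
  have e: "e > 0" "3 * e \<le> m / 4" "4 * e < d" using m \<open>d > 0\<close> by (auto simp: e_def min_def)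
  obtain G where G: "open G" "S \<subseteq> G" "G - S \<in> lmeasurable" "emeasure lebesgue (G - S) < ennreal e"
    using sets_lebesgue_outer_open[OF _ e(1)] S by blast
  have GS: "measure lebesgue (G - S) < e"
    using G e(1) by (simp add: emeasure_eq_measure2 measure_nonneg ennreal_less_iff)
  have Gm: "G \<in> lmeasurable"
    using fmeasurable.Un[OF S G(3)] G(2) by (simp add: Un_absorb1)
  have mG: "measure lebesgue G \<le> m + e"
    using measure_Un_le[of S lebesgue "G - S"] S G(2,3) GS unfolding m_def
    by (simp add: Un_absorb1 fmeasurableD)
  have "\<exists>I. finite I \<and> (\<forall>k\<in>I. k \<subseteq> G \<and> (\<exists>u v. u < v \<and> k = {u..v} \<and> s \<le> u \<and> v \<le> t \<and> f v - f u < - c * (v - u))) \<and>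
    disjoint I \<and> (\<Sum>k\<in>I. measure lborel k) > measure lebesgue S - e \<and> (\<Sum>k\<in>I. measure lborel k) \<le> measure lebesgue G"
  proof (rule Vitali_intervals[OF S Gm e(1), where P = "\<lambda>u v. s \<le> u \<and> v \<le> t \<and> f v - f u < - c * (v - u)"])
    fix x d' :: real assume x: "x \<in> S" "0 < d'"
    obtain r where "r > 0" "ball x r \<subseteq> G" using G x by (meson openE subsetD)
    then obtain u v where uv: "u < x" "x < v" "v - u < min d' r" "s \<le> u" "v \<le> t" "f v - f u < - c * (v - u)"
      using down[OF x(1), of "min d' r"] x(2) by auto
    have "{u..v} \<subseteq> ball x r" using uv by (auto simp: dist_real_def)
    then show "\<exists>u v. u < v \<and> x \<in> {u..v} \<and> v - u < d' \<and> {u..v} \<subseteq> G \<and> s \<le> u \<and> v \<le> t \<and> f v - f u < - c * (v - u)"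
      using uv \<open>ball x r \<subseteq> G\<close> by (intro exI[of _ u] exI[of _ v]) auto
  qed
  then obtain I where I: "finite I" "\<forall>k\<in>I. k \<subseteq> G \<and> (\<exists>u v. u < v \<and> k = {u..v} \<and> s \<le> u \<and> v \<le> t \<and> f v - f u < - c * (v - u))"
    "disjoint I" "(\<Sum>k\<in>I. measure lborel k) > measure lebesgue S - e" "(\<Sum>k\<in>I. measure lborel k) \<le> measure lebesgue G"
    by (elim exE conjE) (rule that; assumption)
  have I_int: "\<exists>u v. u < v \<and> k = {u..v} \<and> s \<le> u \<and> v \<le> t \<and> f v - f u < - c * (v - u)" if "k \<in> I" for k
    using I(2) that by blast
  have Imeas: "measure lebesgue (\<Union>I) = (\<Sum>k\<in>I. measure lborel k)"
  proof -
    have "measure lebesgue (\<Union>k\<in>I. k) = (\<Sum>k\<in>I. measure lebesgue k)"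
      using I(1,3) I_int by (intro measure_finite_Union) (auto simp: disjoint_family_on_def pairwise_def disjnt_def dest!: I_int)
    also have "\<dots> = (\<Sum>k\<in>I. measure lborel k)"
      by (intro sum.cong) (auto dest!: I_int)
    finally show ?thesis by simp
  qed
  \<comment> \<open>Only points of \<open>S\<close> interior to some \<open>I\<close> admit short
    intervals inside it. The loss is null for the end points and at most \<open>2 * e\<close> for
    the part of \<open>G\<close> outside the \<open>I\<close>.\<close>
  define S' where "S' = (\<Union>k\<in>I. S \<inter> interior k)"
  have S'm: "S' \<in> lmeasurable"
    unfolding S'_def using I(1) S by (intro fmeasurable.finite_UN) (auto intro: fmeasurable_Int_fmeasurable simp: fmeasurableD)
  have Ilm: "\<Union>I \<in> lmeasurable"
    using I(1) I_int by (intro fmeasurable.finite_Union) (auto dest!: I_int)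
  have fr: "negligible (\<Union>I - (\<Union>k\<in>I. interior k))"
  proof -
    have "\<Union>I - (\<Union>k\<in>I. interior k) \<subseteq> (\<Union>k\<in>I. {Inf k, Sup k})"
    proof
      fix x assume "x \<in> \<Union>I - (\<Union>k\<in>I. interior k)"
      then obtain k where k: "k \<in> I" "x \<in> k" "x \<notin> interior k" by blast
      obtain u v where "u < v" "k = {u..v}" using I_int[OF k(1)] by blast
      then have "x \<in> {Inf k, Sup k}" using k(2,3) by (auto simp: interior_atLeastAtMost_real)
      then show "x \<in> (\<Union>k\<in>I. {Inf k, Sup k})" using k(1) by blast
    qed
    moreover have "negligible (\<Union>k\<in>I. {Inf k, Sup k})"
      using I(1) by (intro negligible_finite) auto
    ultimately show ?thesis by (rule negligible_subset[rotated])
  qed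
  have frm: "\<Union>I - (\<Union>k\<in>I. interior k) \<in> lmeasurable"
    using fr by (rule negligible_imp_measurable)
  have mS': "m - 2 * e \<le> measure lebesgue S'"
  proof -
    have sub: "S \<subseteq> S' \<union> (\<Union>I - (\<Union>k\<in>I. interior k)) \<union> (G - \<Union>I)"
      using G(2) unfolding S'_def by blast
    have "m \<le> measure lebesgue (S' \<union> (\<Union>I - (\<Union>k\<in>I. interior k)) \<union> (G - \<Union>I))"
      unfolding m_def using S
      by (intro measure_mono_fmeasurable[OF sub] fmeasurable.Un S'm frm fmeasurable.Diff Gm) (auto simp: fmeasurableD Ilm)
    also have "\<dots> \<le> measure lebesgue S' + measure lebesgue (\<Union>I - (\<Union>k\<in>I. interior k)) + measure lebesgue (G - \<Union>I)"
      using S'm frm Gm Ilm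
      by (intro order_trans[OF measure_Un_le] add_right_mono measure_Un_le sets.Un) (blast intro: fmeasurableD sets.Diff)+
    also have "measure lebesgue (\<Union>I - (\<Union>k\<in>I. interior k)) = 0"
      using fr by (rule negligible_imp_measure0)
    also have "measure lebesgue (G - \<Union>I) = measure lebesgue G - measure lebesgue (\<Union>I)"
      using Gm Ilm I(2) by (intro measurable_measure_Diff) (auto simp: fmeasurableD)
    finally show ?thesis using mG I(4) Imeas unfolding m_def by linarith
  qed
  have "\<exists>J. finite J \<and> (\<forall>k\<in>J. k \<subseteq> G \<and> (\<exists>u v. u < v \<and> k = {u..v} \<and> (\<exists>l\<in>I. {u..v} \<subseteq> l) \<and> c * (v - u) < f v - f u)) \<and>
    disjoint J \<and> (\<Sum>k\<in>J. measure lborel k) > measure lebesgue S' - e \<and> (\<Sum>k\<in>J. measure lborel k) \<le> measure lebesgue G"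
  proof (rule Vitali_intervals[OF S'm Gm e(1), where P = "\<lambda>u v. (\<exists>l\<in>I. {u..v} \<subseteq> l) \<and> c * (v - u) < f v - f u"])
    fix x d' :: real assume x: "x \<in> S'" "0 < d'"
    then obtain l where l: "l \<in> I" "x \<in> interior l" "x \<in> S" by (auto simp: S'_def)
    obtain r where "r > 0" "ball x r \<subseteq> interior l" using l(2) open_interior by (meson openE)
    then obtain u v where uv: "u < x" "x < v" "v - u < min d' r" "c * (v - u) < f v - f u"
      using up[OF l(3), of "min d' r"] x(2) by auto
    have "{u..v} \<subseteq> ball x r" using uv by (auto simp: dist_real_def)
    then have "{u..v} \<subseteq> l" using \<open>ball x r \<subseteq> interior l\<close> interior_subset by blast
    then show "\<exists>u v. u < v \<and> x \<in> {u..v} \<and> v - u < d' \<and> {u..v} \<subseteq> G \<and> (\<exists>l\<in>I. {u..v} \<subseteq> l) \<and> c * (v - u) < f v - f u"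
      using uv l(1) I(2)[rule_format, OF l(1)] by (intro exI[of _ u] exI[of _ v]) auto
  qed
  then obtain J where J: "finite J" "\<forall>k\<in>J. k \<subseteq> G \<and> (\<exists>u v. u < v \<and> k = {u..v} \<and> (\<exists>l\<in>I. {u..v} \<subseteq> l) \<and> c * (v - u) < f v - f u)"
    "disjoint J" "(\<Sum>k\<in>J. measure lborel k) > measure lebesgue S' - e" "(\<Sum>k\<in>J. measure lborel k) \<le> measure lebesgue G"
    by (elim exE conjE) (rule that; assumption)
  define JJ where "JJ l = {k\<in>J. k \<subseteq> l}" for l
  have J_int: "\<exists>u v. u < v \<and> k = {u..v} \<and> (\<exists>l\<in>I. {u..v} \<subseteq> l) \<and> c * (v - u) < f v - f u" if "k \<in> J" for k
    using J(2) that by blast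
  \<comment> \<open>The chosen subintervals of \<open>l\<close> are completed to a division of
    \<open>l\<close>, so that increments over \<open>l\<close> split into the part
    \<open>JJ l\<close> and the remainder \<open>R l\<close>.\<close>
  have "\<exists>q. JJ l \<subseteq> q \<and> q division_of l" if l: "l \<in> I" for l
  proof -
    obtain u v where uv: "u < v" "l = {u..v}" using I_int[OF l] by blast
    have "JJ l division_of \<Union>(JJ l)"
      unfolding division_of_def
    proof (intro conjI ballI impI)
      show "finite (JJ l)" using J(1) by (simp add: JJ_def)
      fix k assume k: "k \<in> JJ l"
      show "k \<subseteq> \<Union>(JJ l)" using k by blast
      show "k \<noteq> {}" "\<exists>a b. k = cbox a b" using k J_int[of k] by (auto simp: JJ_def box_real)
      fix k' assume k': "k' \<in> JJ l" "k \<noteq> k'"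
      then have "k \<inter> k' = {}" using k J(3) by (auto simp: JJ_def pairwise_def disjnt_def)
      then show "interior k \<inter> interior k' = {}" using interior_subset by blast
    qed simp
    moreover have "\<Union>(JJ l) \<subseteq> cbox u v" using uv by (auto simp: JJ_def)
    ultimately show ?thesis
      using partial_division_extend_interval uv by (metis box_real(2))
  qed
  then obtain q where q: "\<And>l. l \<in> I \<Longrightarrow> JJ l \<subseteq> q l" "\<And>l. l \<in> I \<Longrightarrow> q l division_of l"
    by metis
  define R where "R l = q l - JJ l" for l
  have qI: "\<exists>u v. u \<le> v \<and> k = {u..v} \<and> k \<subseteq> l" if "l \<in> I" "k \<in> q l" for l k
    using division_ofD(2,3,4)[OF q(2)[OF that(1)] that(2)]
    by (metis atLeastatMost_empty_iff2 box_real(2) linorder_not_le order_less_imp_le)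
  have finq: "finite (q l)" if "l \<in> I" for l using division_ofD(1)[OF q(2)[OF that]] .
  have sumq: "(\<Sum>k\<in>q l. g k) = (\<Sum>k\<in>JJ l. g k) + (\<Sum>k\<in>R l. g k)" if "l \<in> I" for l and g :: "real set \<Rightarrow> real"
    unfolding R_def using sum.subset_diff[OF q(1)[OF that] finq[OF that], of g] by simp
  have disI: "l \<inter> l' = {}" if "l \<in> I" "l' \<in> I" "l \<noteq> l'" for l l'
    using I(3) that by (auto simp: pairwise_def disjnt_def)
  have qne: "k \<noteq> {}" if "l \<in> I" "k \<in> q l" for l k using qI[OF that] by auto
  have disq: "q l \<inter> q l' = {}" if "l \<in> I" "l' \<in> I" "l \<noteq> l'" for l l'
  proof (rule ccontr)
    assume "q l \<inter> q l' \<noteq> {}"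
    then obtain k where k: "k \<in> q l" "k \<in> q l'" by blast
    then have "k \<subseteq> l" "k \<subseteq> l'" "k \<noteq> {}" using qI[OF that(1) k(1)] qI[OF that(2) k(2)] qne[OF that(1) k(1)] by blast+
    then show False using disI[OF that] by blast
  qed
  have disJ: "JJ l \<inter> JJ l' = {}" and disR: "R l \<inter> R l' = {}" if "l \<in> I" "l' \<in> I" "l \<noteq> l'" for l l'
    using disq[OF that] q(1)[OF that(1)] q(1)[OF that(2)] by (auto simp: R_def)
  have JU: "J = (\<Union>l\<in>I. JJ l)"
    using J_int unfolding JJ_def by blast
  have sumJ: "(\<Sum>l\<in>I. \<Sum>k\<in>JJ l. g k) = (\<Sum>k\<in>J. g k)" for g :: "real set \<Rightarrow> real"
    unfolding JU using disJ J(1) by (intro sum.UNION_disjoint[symmetric] I(1)) (auto simp: JJ_def)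
  define RR where "RR = (\<Union>l\<in>I. R l)"
  have sumR: "(\<Sum>l\<in>I. \<Sum>k\<in>R l. g k) = (\<Sum>k\<in>RR. g k)" for g :: "real set \<Rightarrow> real"
    unfolding RR_def using finq disR by (intro sum.UNION_disjoint[symmetric] I(1)) (auto simp: R_def)
  \<comment> \<open>Used twice: the identity in place of \<open>g\<close> measures the length of the
    remainder, \<open>f\<close> itself gives the contradiction.\<close>
  have tot: "(\<Sum>l\<in>I. g (Sup l) - g (Inf l)) = (\<Sum>k\<in>J. incr g k) + (\<Sum>k\<in>RR. incr g k)" for g :: "real \<Rightarrow> real"
  proof -
    have "(\<Sum>l\<in>I. g (Sup l) - g (Inf l)) = (\<Sum>l\<in>I. \<Sum>k\<in>q l. incr g k)"
    proof (intro sum.cong refl)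
      fix l assume l: "l \<in> I"
      obtain u v where uv: "u < v" "l = {u..v}" using I_int[OF l] by blast
      show "g (Sup l) - g (Inf l) = (\<Sum>k\<in>q l. incr g k)"
        using incr_division[of "q l" u v g] q(2)[OF l] uv by simp
    qed
    then show ?thesis using sumq sumJ sumR by (simp add: sum.distrib)
  qed
  have incr_id: "incr (\<lambda>x. x) k = measure lborel k" if "\<exists>u v. u \<le> v \<and> k = {u..v}" for k :: "real set"
    using that by auto
  have RRint: "\<exists>u v. u \<le> v \<and> k = {u..v}" if kR: "k \<in> RR" for k
  proof -
    obtain l where "l \<in> I" "k \<in> q l" using kR by (auto simp: RR_def R_def)
    then show ?thesis using qI by blast
  qed
  have lenR: "(\<Sum>k\<in>RR. measure lborel k) < d"
  proof -
    have "(\<Sum>k\<in>I. measure lborel k) = (\<Sum>l\<in>I. Sup l - Inf l)"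
      by (intro sum.cong) (auto dest!: I_int)
    also have "\<dots> = (\<Sum>k\<in>J. incr (\<lambda>x. x) k) + (\<Sum>k\<in>RR. incr (\<lambda>x. x) k)"
      using tot[of "\<lambda>x. x"] .
    also have "(\<Sum>k\<in>J. incr (\<lambda>x. x) k) = (\<Sum>k\<in>J. measure lborel k)"
      by (intro sum.cong refl incr_id) (auto dest!: J_int intro: less_imp_le)
    also have "(\<Sum>k\<in>RR. incr (\<lambda>x. x) k) = (\<Sum>k\<in>RR. measure lborel k)"
      by (intro sum.cong refl incr_id RRint)
    finally show ?thesis using I(5) mG J(4) mS' e by linarith
  qed
  have "interval_family s t RR"
    unfolding interval_family_def
  proof (intro conjI ballI impI)
    show "finite RR" using I(1) finq by (auto simp: RR_def R_def)
    fix k assume k: "k \<in> RR"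
    show "\<exists>u v. u \<le> v \<and> k = {u..v}" using RRint[OF k] .
    obtain l where l: "l \<in> I" "k \<in> q l" using k by (auto simp: RR_def R_def)
    have "k \<subseteq> l" using qI[OF l] by blast
    moreover have "l \<subseteq> {s..t}" using I_int[OF l(1)] by auto
    ultimately show "k \<subseteq> {s..t}" by blast
    fix k' assume k': "k' \<in> RR" "k \<noteq> k'"
    obtain l' where l': "l' \<in> I" "k' \<in> q l'" using k' by (auto simp: RR_def R_def)
    show "interior k \<inter> interior k' = {}"
    proof (cases "l = l'")
      case True
      then show ?thesis using division_ofD(5)[OF q(2)[OF l(1)]] l l' k' by blast
    next
      case False
      have "k \<subseteq> l" "k' \<subseteq> l'" using qI[OF l] qI[OF l'] by blast+
      then have "k \<inter> k' = {}" using disI[OF l(1) l'(1) False] by blast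
      then show ?thesis using interior_subset by blast
    qed
  qed
  then have "(\<Sum>k\<in>RR. norm (incr f k)) < c * m / 4" using d lenR by blast
  moreover have "\<bar>\<Sum>k\<in>RR. incr f k\<bar> \<le> (\<Sum>k\<in>RR. norm (incr f k))"
    using norm_sum[of "incr f" RR] by simp
  moreover have "(\<Sum>l\<in>I. f (Sup l) - f (Inf l)) \<le> 0"
  proof (intro sum_nonpos)
    fix l assume "l \<in> I"
    then obtain u v where uv: "u < v" "l = {u..v}" "f v - f u < - c * (v - u)" using I_int by blast
    have "c * (v - u) > 0" using uv \<open>c > 0\<close> by simp
    then show "f (Sup l) - f (Inf l) \<le> 0" using uv by simp
  qed
  moreover have "c * (m - 3 * e) \<le> (\<Sum>k\<in>J. incr f k)"
  proof -
    have "c * (m - 3 * e) \<le> c * (\<Sum>k\<in>J. measure lborel k)"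
      using J(4) mS' \<open>c > 0\<close> by (intro mult_left_mono) auto
    also have "\<dots> = (\<Sum>k\<in>J. c * measure lborel k)" by (simp add: sum_distrib_left)
    also have "\<dots> \<le> (\<Sum>k\<in>J. incr f k)"
      by (intro sum_mono) (auto dest!: J_int intro: less_imp_le)
    finally show ?thesis .
  qed
  moreover have "c * (m - 3 * e) \<ge> c * (3 * m / 4)"
    using e \<open>c > 0\<close> by (intro mult_left_mono) auto
  ultimately show False using tot[of f] m \<open>c > 0\<close> \<open>c * m / 4 > 0\<close> by (simp add: field_simps)
qed


text \<open>Inside a ball of length \<open>d / 2\<close>, disjoint intervals have increments summing
  to less than 1. If \<open>S\<close> had measure \<open>m > 0\<close> there, disjoint intervals of
  slope above \<open>2 / m\<close> and total length above \<open>m / 2\<close> would gain at least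
  1.\<close>

lemma null_infinite_slope:
  fixes f :: "real \<Rightarrow> real"
  assumes f: "abs_continuous s t f" and S: "S \<in> lmeasurable"
    and up: "\<And>x d c. x \<in> S \<Longrightarrow> d > 0 \<Longrightarrow> \<exists>u v. u < x \<and> x < v \<and> v - u < d \<and> s \<le> u \<and> v \<le> t \<and> c * (v - u) < f v - f u"
  shows "negligible S"
proof -
  obtain d where "d > 0" and d: "\<And>D. \<lbrakk>interval_family s t D; (\<Sum>k\<in>D. measure lborel k) < d\<rbrakk> \<Longrightarrow> (\<Sum>k\<in>D. norm (incr f k)) < 1"
    using abs_continuous_family[OF f zero_less_one] by blast
  have "negligible (S \<inter> ball p (d / 4))" (is "negligible ?T") for p
  proof (rule ccontr)
    assume neg: "\<not> negligible ?T"
    have T: "?T \<in> lmeasurable" using S by (intro fmeasurable_Int_fmeasurable) auto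
    define m where "m = measure lebesgue ?T"
    have m: "m > 0"
      using neg T negligible_iff_measure0 unfolding m_def by (metis measure_nonneg order_le_less)
    then have "m / 2 > 0" by simp
    have G: "ball p (d/4) \<in> lmeasurable" by simp
    have "\<exists>D. finite D \<and> (\<forall>k\<in>D. k \<subseteq> ball p (d/4) \<and> (\<exists>u v. u < v \<and> k = {u..v} \<and> s \<le> u \<and> v \<le> t \<and> 2 / m * (v - u) < f v - f u)) \<and>
      disjoint D \<and> (\<Sum>k\<in>D. measure lborel k) > measure lebesgue ?T - m / 2 \<and> (\<Sum>k\<in>D. measure lborel k) \<le> measure lebesgue (ball p (d/4))"
    proof (rule Vitali_intervals[OF T G \<open>m / 2 > 0\<close>, where P = "\<lambda>u v. s \<le> u \<and> v \<le> t \<and> 2 / m * (v - u) < f v - f u"])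
      fix x d' :: real assume x: "x \<in> ?T" "0 < d'"
      obtain r where r: "r > 0" "ball x r \<subseteq> ball p (d/4)" using x by (meson IntD2 openE open_ball)
      then obtain u v where uv: "u < x" "x < v" "v - u < min d' r" "s \<le> u" "v \<le> t" "2 / m * (v - u) < f v - f u"
        using up[of x "min d' r" "2 / m"] x by auto
      have "{u..v} \<subseteq> ball x r" using uv by (auto simp: dist_real_def)
      then show "\<exists>u v. u < v \<and> x \<in> {u..v} \<and> v - u < d' \<and> {u..v} \<subseteq> ball p (d/4) \<and> s \<le> u \<and> v \<le> t \<and> 2 / m * (v - u) < f v - f u"
        using uv r(2) by (intro exI[of _ u] exI[of _ v]) auto
    qed
    then obtain D where D: "finite D" "\<forall>k\<in>D. k \<subseteq> ball p (d/4) \<and> (\<exists>u v. u < v \<and> k = {u..v} \<and> s \<le> u \<and> v \<le> t \<and> 2 / m * (v - u) < f v - f u)"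
      "disjoint D" "(\<Sum>k\<in>D. measure lborel k) > measure lebesgue ?T - m / 2" "(\<Sum>k\<in>D. measure lborel k) \<le> measure lebesgue (ball p (d/4))"
      by (elim exE conjE) (rule that; assumption)
    have D_int: "\<exists>u v. u < v \<and> k = {u..v} \<and> s \<le> u \<and> v \<le> t \<and> 2 / m * (v - u) < f v - f u" if "k \<in> D" for k
      using D(2) that by blast
    have "interval_family s t D"
      unfolding interval_family_def
    proof (intro conjI ballI impI D(1))
      fix k assume k: "k \<in> D"
      show "k \<subseteq> {s..t}" "\<exists>u v. u \<le> v \<and> k = {u..v}" using D_int[OF k] by auto
      fix l assume l: "l \<in> D" "k \<noteq> l"
      then have "k \<inter> l = {}" using k D(3) by (auto simp: pairwise_def disjnt_def)
      then show "interior k \<inter> interior l = {}" using interior_subset by blast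
    qed
    moreover have "ball p (d/4) = {p - d/4<..<p + d/4}" by (simp add: ball_eq_greaterThanLessThan)
    then have "measure lebesgue (ball p (d/4)) = d / 2" using \<open>d > 0\<close> by simp
    ultimately have "(\<Sum>k\<in>D. norm (incr f k)) < 1" using d D(5) \<open>d > 0\<close> by simp
    moreover have "2 / m * (\<Sum>k\<in>D. measure lborel k) \<le> (\<Sum>k\<in>D. norm (incr f k))"
      unfolding sum_distrib_left
      by (intro sum_mono) (auto dest!: D_int)
    moreover have "2 / m * (m / 2) \<le> 2 / m * (\<Sum>k\<in>D. measure lborel k)"
      using D(4) m by (intro mult_left_mono) (auto simp: m_def)
    moreover have "2 / m * (m / 2) = 1" using m by simp
    ultimately show False by linarith
  qed
  then show ?thesis
    unfolding locally_negligible_alt[of S]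
  proof (intro ballI)
    fix x assume "x \<in> S" "\<And>p. negligible (S \<inter> ball p (d / 4))"
    then show "\<exists>U. openin (top_of_set S) U \<and> x \<in> U \<and> negligible U"
      using \<open>d > 0\<close> by (intro exI[of _ "S \<inter> ball x (d / 4)"]) (auto intro: openin_open_Int)
  qed
qed

text \<open>Superlevel sets of the upper derivative over intervals that straddle \<open>x\<close>:
  steepness at \<open>c\<close> forces a limsup of slopes at least \<open>c\<close>, and a limsup
  above \<open>c\<close> forces steepness. Straddling is strict and the scales are
  \<open>1 / Suc n\<close>, so the set is a countable intersection of open sets, hence measurable
  whatever \<open>f\<close> is.\<close>

definition steep :: "real \<Rightarrow> real \<Rightarrow> (real \<Rightarrow> real) \<Rightarrow> real \<Rightarrow> real set" where
  "steep s t f c = {x. \<forall>n::nat. \<exists>u v. u < x \<and> x < v \<and> v - u < 1 / Suc n \<and> s \<le> u \<and> v \<le> t \<and> c * (v - u) < f v - f u}"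

lemma steepD:
  assumes "x \<in> steep s t f c" "d > 0"
  shows "\<exists>u v. u < x \<and> x < v \<and> v - u < d \<and> s \<le> u \<and> v \<le> t \<and> c * (v - u) < f v - f u"
proof -
  obtain n where "1 / Suc n < d" using assms(2) nat_approx_posE by blast
  moreover obtain u v where "u < x" "x < v" "v - u < 1 / Suc n" "s \<le> u" "v \<le> t" "c * (v - u) < f v - f u"
    using assms(1) unfolding steep_def by blast
  ultimately show ?thesis by (intro exI[of _ u] exI[of _ v]) auto
qed

lemma not_steepD:
  assumes "x \<notin> steep s t f c"
  shows "\<exists>d>0. \<forall>u v. u < x \<and> x < v \<and> v - u < d \<and> s \<le> u \<and> v \<le> t \<longrightarrow> f v - f u \<le> c * (v - u)"
proof -
  obtain n :: nat where n: "\<not> (\<exists>u v. u < x \<and> x < v \<and> v - u < 1 / Suc n \<and> s \<le> u \<and> v \<le> t \<and> c * (v - u) < f v - f u)"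
    using assms unfolding steep_def by blast
  show ?thesis
  proof (intro exI[of _ "1 / Suc n"] conjI allI impI)
    fix u v assume "u < x \<and> x < v \<and> v - u < 1 / Suc n \<and> s \<le> u \<and> v \<le> t"
    then show "f v - f u \<le> c * (v - u)" using n not_le by blast
  qed simp
qed

lemma steep_borel: "steep s t f c \<in> sets borel"
proof -
  have "steep s t f c = (\<Inter>n::nat. \<Union>(u,v)\<in>{(u,v). v - u < 1 / Suc n \<and> s \<le> u \<and> v \<le> t \<and> c * (v - u) < f v - f u}. {u<..<v})"
    unfolding steep_def by (intro set_eqI) (simp, blast)
  also have "\<dots> \<in> sets borel"
    by (intro sets.countable_INT'') (auto intro!: borel_open open_UN)
  finally show ?thesis .
qed

lemma steep_lmeasurable: "steep s t f c \<in> lmeasurable"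
proof (rule bounded_set_imp_lmeasurable)
  have "steep s t f c \<subseteq> {s..t}" unfolding steep_def by force
  then show "bounded (steep s t f c)" using bounded_subset bounded_closed_interval by blast
  show "steep s t f c \<in> sets lebesgue" using steep_borel by simp
qed

text \<open>Subtracting the linear function of mean slope \<open>\<gamma>\<close> turns slopes above
  \<open>\<beta>\<close> and below \<open>\<alpha>\<close> into slopes above \<open>c\<close> and
  below \<open>- c\<close>, the case of \<open>null_two_slopes\<close>.\<close>

lemma negligible_steep_steep:
  assumes f: "abs_continuous s t f" and "\<alpha> < \<beta>"
  shows "negligible (steep s t f \<beta> \<inter> steep s t (\<lambda>x. - f x) (- \<alpha>))"
proof -
  define \<gamma> where "\<gamma> = (\<alpha> + \<beta>) / 2"
  define c where "c = (\<beta> - \<alpha>) / 2"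
  have "abs_continuous s t (\<lambda>x. - \<gamma> * x)"
  proof (rule abs_continuous_lipschitz)
    show "norm (- \<gamma> * y - - \<gamma> * x) \<le> \<bar>\<gamma>\<bar> * \<bar>y - x\<bar>" for x y
      by (metis abs_minus_cancel abs_mult order_refl real_norm_def right_diff_distrib)
  qed
  from abs_continuous_add[OF f this] have g: "abs_continuous s t (\<lambda>x. f x + - \<gamma> * x)" .
  show ?thesis
  proof (rule null_two_slopes[OF g, of c])
    show "c > 0" using \<open>\<alpha> < \<beta>\<close> by (simp add: c_def)
    show "steep s t f \<beta> \<inter> steep s t (\<lambda>x. - f x) (- \<alpha>) \<in> lmeasurable"
      by (intro fmeasurable_Int_fmeasurable steep_lmeasurable fmeasurableD)
    fix x d :: real assume x: "x \<in> steep s t f \<beta> \<inter> steep s t (\<lambda>x. - f x) (- \<alpha>)" "d > 0"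
    obtain u v where "u < x" "x < v" "v - u < d" "s \<le> u" "v \<le> t" "\<beta> * (v - u) < f v - f u"
      using steepD[of x s t f \<beta> d] x by blast
    then show "\<exists>u v. u < x \<and> x < v \<and> v - u < d \<and> s \<le> u \<and> v \<le> t \<and> c * (v - u) < f v + - \<gamma> * v - (f u + - \<gamma> * u)"
      by (intro exI[of _ u] exI[of _ v]) (auto simp: c_def \<gamma>_def field_simps)
    obtain u v where "u < x" "x < v" "v - u < d" "s \<le> u" "v \<le> t" "- \<alpha> * (v - u) < - f v - - f u"
      using steepD[of x s t "\<lambda>x. - f x" "- \<alpha>" d] x by blast
    then show "\<exists>u v. u < x \<and> x < v \<and> v - u < d \<and> s \<le> u \<and> v \<le> t \<and> f v + - \<gamma> * v - (f u + - \<gamma> * u) < - c * (v - u)"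
      by (intro exI[of _ u] exI[of _ v]) (auto simp: c_def \<gamma>_def field_simps)
  qed
qed

lemma negligible_steep_all:
  assumes f: "abs_continuous s t f"
  shows "negligible (\<Inter>n::nat. steep s t f n)"
proof (rule null_infinite_slope[OF f])
  show "(\<Inter>n::nat. steep s t f n) \<in> lmeasurable"
  proof (rule fmeasurableI2[OF steep_lmeasurable[of s t f "real 0"]])
    show "(\<Inter>n::nat. steep s t f n) \<subseteq> steep s t f (real 0)" by (rule INT_lower) simp
    have "(\<Inter>n::nat. steep s t f n) \<in> sets borel" by (intro sets.countable_INT'') (auto intro: steep_borel)
    then show "(\<Inter>n::nat. steep s t f n) \<in> sets lebesgue" by simp
  qed
  fix x d c :: real assume x: "x \<in> (\<Inter>n::nat. steep s t f n)" "d > 0"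
  obtain n :: nat where n: "c \<le> n" using real_arch_simple by blast
  obtain u v where uv: "u < x" "x < v" "v - u < d" "s \<le> u" "v \<le> t" "real n * (v - u) < f v - f u"
  proof -
    have "x \<in> steep s t f n" using x(1) by (rule INT_D) simp
    from steepD[OF this x(2)] show ?thesis using that by blast
  qed
  have "c * (v - u) \<le> real n * (v - u)" using n uv by (intro mult_right_mono) auto
  then have "c * (v - u) < f v - f u" using uv(6) by linarith
  then show "\<exists>u v. u < x \<and> x < v \<and> v - u < d \<and> s \<le> u \<and> v \<le> t \<and> c * (v - u) < f v - f u"
    using uv by (intro exI[of _ u] exI[of _ v]) auto
qed

text \<open>The derivative is the infimum \<open>D\<close> of the slopes at which \<open>x\<close>
  is not steep. Absence of infinite slopes makes \<open>D\<close> finite, and absence of two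
  separated slopes makes the lower derivative over straddling intervals equal to it.\<close>

lemma differentiable_if_not_steep:
  fixes f :: "real \<Rightarrow> real"
  assumes cont: "isCont f x" and x: "s < x" "x < t"
    and two: "\<And>\<alpha> \<beta>. \<alpha> \<in> \<rat> \<Longrightarrow> \<beta> \<in> \<rat> \<Longrightarrow> \<alpha> < \<beta> \<Longrightarrow> x \<notin> steep s t f \<beta> \<inter> steep s t (\<lambda>x. - f x) (- \<alpha>)"
    and up: "x \<notin> (\<Inter>n::nat. steep s t f n)" and down: "x \<notin> (\<Inter>n::nat. steep s t (\<lambda>x. - f x) n)"
  shows "f differentiable (at x)"
proof -
  define X where "X = {c. x \<notin> steep s t f c}"
  obtain n0 :: nat where n0: "x \<notin> steep s t (\<lambda>x. - f x) n0" using down by blast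
  obtain d0 where "d0 > 0" and d0: "\<And>u v::real. u < x \<Longrightarrow> x < v \<Longrightarrow> v - u < d0 \<Longrightarrow> s \<le> u \<Longrightarrow> v \<le> t \<Longrightarrow> - f v - - f u \<le> n0 * (v - u)"
    using not_steepD[OF n0] by blast
  have "X \<noteq> {}" using up by (auto simp: X_def)
  \<comment> \<open>A slope bounding \<open>f\<close> from above and one bounding it from below are
    compared over a common symmetric interval around \<open>x\<close>.\<close>
  have lower: "- real n0 \<le> c" if "c \<in> X" for c
  proof -
    obtain d1 where "d1 > 0" and d1: "\<And>u v. u < x \<Longrightarrow> x < v \<Longrightarrow> v - u < d1 \<Longrightarrow> s \<le> u \<Longrightarrow> v \<le> t \<Longrightarrow> f v - f u \<le> c * (v - u)"
      using not_steepD[of x s t f c] \<open>c \<in> X\<close> unfolding X_def by blast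
    define r where "r = min (min (d0 / 4) (d1 / 4)) (min (x - s) (t - x))"
    have r: "r > 0" "r \<le> d0 / 4" "r \<le> d1 / 4" "r \<le> x - s" "r \<le> t - x" using \<open>d0 > 0\<close> \<open>d1 > 0\<close> x unfolding r_def by linarith+
    have "- f (x + r) - - f (x - r) \<le> n0 * ((x + r) - (x - r))" using r by (intro d0) auto
    moreover have "f (x + r) - f (x - r) \<le> c * ((x + r) - (x - r))" using r by (intro d1) auto
    ultimately have "0 \<le> (n0 + c) * (2 * r)" by (simp add: algebra_simps)
    then have "0 \<le> n0 + c" using r(1) by (simp add: zero_le_mult_iff)
    then show ?thesis by simp
  qed
  then have bdd: "bdd_below X" by (auto simp: bdd_below_def)
  define D where "D = Inf X"
  have "(f has_real_derivative D) (at x)"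
    unfolding has_field_derivative_def has_derivative_at_alt
  proof (intro conjI allI impI)
    show "bounded_linear ((*) D)" by (rule bounded_linear_mult_right)
    fix e :: real assume "e > 0"
    obtain c where c: "c \<in> X" "c < D + e"
      using \<open>X \<noteq> {}\<close> bdd \<open>e > 0\<close> unfolding D_def by (metis cInf_less_iff less_add_same_cancel1)
    obtain d1 where "d1 > 0" and d1: "\<And>u v. u < x \<Longrightarrow> x < v \<Longrightarrow> v - u < d1 \<Longrightarrow> s \<le> u \<Longrightarrow> v \<le> t \<Longrightarrow> f v - f u \<le> c * (v - u)"
      using not_steepD[of x s t f c] c(1) unfolding X_def by blast
    \<comment> \<open>Since \<open>\<beta> < D\<close>, \<open>x\<close> is steep at
      \<open>\<beta>\<close>; by \<open>two\<close>, the negated function is then not steep at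
      \<open>- \<alpha>\<close>, which gives the lower bound with
      \<open>\<alpha> > D - e\<close>.\<close>
    obtain \<alpha> where \<alpha>: "\<alpha> \<in> \<rat>" "D - e < \<alpha>" "\<alpha> < D" using Rats_dense_in_real[of "D - e" D] \<open>e > 0\<close> by auto
    obtain \<beta> where \<beta>: "\<beta> \<in> \<rat>" "\<alpha> < \<beta>" "\<beta> < D" using Rats_dense_in_real[OF \<alpha>(3)] by auto
    have "\<beta> \<notin> X" using \<beta>(3) bdd unfolding D_def by (meson cInf_lower not_le)
    then have "x \<notin> steep s t (\<lambda>x. - f x) (- \<alpha>)" using two[OF \<alpha>(1) \<beta>(1,2)] by (auto simp: X_def)
    then obtain d2 where "d2 > 0" and d2: "\<And>u v. u < x \<Longrightarrow> x < v \<Longrightarrow> v - u < d2 \<Longrightarrow> s \<le> u \<Longrightarrow> v \<le> t \<Longrightarrow> - f v - - f u \<le> - \<alpha> * (v - u)"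
      using not_steepD by blast
    define r where "r = min (min (d1 / 4) (d2 / 4)) (min (x - s) (t - x))"
    have r: "r > 0" "r \<le> d1 / 4" "r \<le> d2 / 4" "r \<le> x - s" "r \<le> t - x" using \<open>d1 > 0\<close> \<open>d2 > 0\<close> x unfolding r_def by linarith+
    have key: "\<bar>f v - f u - D * (v - u)\<bar> \<le> e * (v - u)" if uv: "u < x" "x < v" "x - r < u" "v < x + r" for u v
    proof -
      have "f v - f u \<le> c * (v - u)" using r uv by (intro d1) auto
      also have "\<dots> \<le> (D + e) * (v - u)" using uv c by (intro mult_right_mono) auto
      finally have 1: "f v - f u \<le> (D + e) * (v - u)" .
      have "- f v - - f u \<le> - \<alpha> * (v - u)" using r uv by (intro d2) auto
      also have "\<dots> \<le> - (D - e) * (v - u)" using uv \<alpha> by (intro mult_right_mono) auto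
      finally show ?thesis using 1 by (auto simp: abs_le_iff algebra_simps)
    qed
    \<comment> \<open>The bound \<open>key\<close> needs \<open>x\<close> strictly inside the
      interval. Letting one end point tend to \<open>x\<close> yields the one-sided difference
      quotients, and this is where continuity enters.\<close>
    have lim: "(f \<longlongrightarrow> f x) (at_left x)" "(f \<longlongrightarrow> f x) (at_right x)"
      using cont by (auto simp: isCont_def intro: filterlim_at_split[THEN iffD1, THEN conjunct1] filterlim_at_split[THEN iffD1, THEN conjunct2])
    have right: "\<bar>f v - f x - D * (v - x)\<bar> \<le> e * (v - x)" if v: "x < v" "v < x + r" for v
    proof (rule tendsto_le[OF _ _ _ ])
      show "((\<lambda>u. e * (v - u)) \<longlongrightarrow> e * (v - x)) (at_left x)" by (intro tendsto_intros)
      show "((\<lambda>u. \<bar>f v - f u - D * (v - u)\<bar>) \<longlongrightarrow> \<bar>f v - f x - D * (v - x)\<bar>) (at_left x)"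
        by (intro tendsto_intros lim)
      show "\<forall>\<^sub>F u in at_left x. \<bar>f v - f u - D * (v - u)\<bar> \<le> e * (v - u)"
        using eventually_at_left_real[of "x - r" x] r(1) v by (auto elim!: eventually_mono intro!: key)
    qed simp
    have left: "\<bar>f x - f u - D * (x - u)\<bar> \<le> e * (x - u)" if u: "u < x" "x - r < u" for u
    proof (rule tendsto_le[OF _ _ _ ])
      show "((\<lambda>v. e * (v - u)) \<longlongrightarrow> e * (x - u)) (at_right x)" by (intro tendsto_intros)
      show "((\<lambda>v. \<bar>f v - f u - D * (v - u)\<bar>) \<longlongrightarrow> \<bar>f x - f u - D * (x - u)\<bar>) (at_right x)"
        by (intro tendsto_intros lim)
      show "\<forall>\<^sub>F v in at_right x. \<bar>f v - f u - D * (v - u)\<bar> \<le> e * (v - u)"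
        using eventually_at_right_real[of x "x + r"] r(1) u by (auto elim!: eventually_mono intro!: key)
    qed simp
    show "\<exists>d>0. \<forall>y. norm (y - x) < d \<longrightarrow> norm (f y - f x - D * (y - x)) \<le> e * norm (y - x)"
    proof (intro exI[of _ r] conjI allI impI)
      fix y assume y: "norm (y - x) < r"
      consider "y = x" | "x < y" | "y < x" by linarith
      then show "norm (f y - f x - D * (y - x)) \<le> e * norm (y - x)"
      proof cases
        case 2 then show ?thesis using right[of y] y by auto
      next
        case 3
        have "f y - f x - D * (y - x) = - (f x - f y - D * (x - y))" by (simp add: algebra_simps)
        then show ?thesis using left[of y] y 3 by (simp only: norm_minus_cancel real_norm_def) auto
      qed simp
    qed (use r in auto)
  qed
  then show ?thesis unfolding real_differentiable_def by blast
qed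

text \<open>Restricting the pairs of slopes to rationals keeps the exceptional set a countable union
  of null sets.\<close>

theorem abs_continuous_differentiable_ae:
  fixes f :: "real \<Rightarrow> real"
  assumes f: "abs_continuous s t f"
  shows "negligible {x \<in> {s<..<t}. \<not> f differentiable (at x)}"
proof -
  have mf: "abs_continuous s t (\<lambda>x. - f x)"
    by (rule abs_continuous_dominated[OF f, of _ 1]) (auto simp: norm_minus_commute)
  define N where "N = (\<Union>(\<alpha>,\<beta>)\<in>{(\<alpha>,\<beta>)\<in>\<rat> \<times> \<rat>. \<alpha> < \<beta>}. steep s t f \<beta> \<inter> steep s t (\<lambda>x. - f x) (- \<alpha>))"
  have cnt: "countable {(\<alpha>::real,\<beta>::real)\<in>\<rat> \<times> \<rat>. \<alpha> < \<beta>}"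
    by (rule countable_subset[of _ "\<rat> \<times> \<rat>"]) (auto intro: countable_rat)
  have "negligible N"
    unfolding N_def negligible_iff_null_sets
    by (rule null_sets_UN'[OF cnt]) (auto simp: negligible_iff_null_sets[symmetric] intro: negligible_steep_steep[OF f])
  then have "negligible (N \<union> (\<Inter>n::nat. steep s t f n) \<union> (\<Inter>n::nat. steep s t (\<lambda>x. - f x) n))"
    using negligible_steep_all[OF f] negligible_steep_all[OF mf] by (intro negligible_Un)
  moreover have "{x \<in> {s<..<t}. \<not> f differentiable (at x)} \<subseteq> N \<union> (\<Inter>n::nat. steep s t f n) \<union> (\<Inter>n::nat. steep s t (\<lambda>x. - f x) n)"
  proof (rule ccontr)
    assume "\<not> ?thesis"
    then obtain x where x: "s < x" "x < t" "\<not> f differentiable (at x)" "x \<notin> N" 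
      "x \<notin> (\<Inter>n::nat. steep s t f n)" "x \<notin> (\<Inter>n::nat. steep s t (\<lambda>x. - f x) n)"
      by (auto simp del: INT_iff)
    have "isCont f x"
      using abs_continuous_imp_continuous_on[OF f] x by (intro continuous_on_interior[of "{s..t}"]) (auto simp: interior_atLeastAtMost_real)
    from differentiable_if_not_steep[OF this x(1,2) _ x(5,6)] x(3,4) show False
      unfolding N_def by blast
  qed
  ultimately show ?thesis using negligible_subset by blast
qed

section \<open>The fundamental theorem of calculus for absolutely continuous functions\<close>

text \<open>Cells may share end points, but their interiors are disjoint and have the same
  measure.\<close>

lemma measure_interval_family:
  assumes fam: "interval_family s t D" and T: "T \<in> lmeasurable" "\<And>k. k \<in> D \<Longrightarrow> k \<subseteq> T"
  shows "(\<Sum>k\<in>D. measure lborel k) \<le> measure lebesgue T"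
proof -
  have fin: "finite D" and D: "\<And>k. k \<in> D \<Longrightarrow> \<exists>u v. u \<le> v \<and> k = {u..v}"
    and dis: "\<And>k l. k \<in> D \<Longrightarrow> l \<in> D \<Longrightarrow> k \<noteq> l \<Longrightarrow> interior k \<inter> interior l = {}"
    using fam by (auto simp: interval_family_def)
  have int: "interior k \<in> lmeasurable" "measure lebesgue (interior k) = measure lborel k" if kD: "k \<in> D" for k
  proof -
    obtain u v where uv: "u \<le> v" "k = {u..v}" using D[OF kD] by blast
    then show "interior k \<in> lmeasurable" "measure lebesgue (interior k) = measure lborel k" 
      by (auto simp: interior_atLeastAtMost_real)
  qed
  have "(\<Sum>k\<in>D. measure lborel k) = (\<Sum>k\<in>D. measure lebesgue (interior k))"
    using int by (intro sum.cong) auto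
  also have "\<dots> = measure lebesgue (\<Union>k\<in>D. interior k)"
  proof (intro measure_finite_Union[symmetric])
    show "emeasure lebesgue (interior k) \<noteq> \<infinity>" if "k \<in> D" for k
      using fmeasurableD2[OF int(1)[OF that]] by simp
  qed (use int dis fin in \<open>auto simp: disjoint_family_on_def fmeasurable_def\<close>)
  also have "\<dots> \<le> measure lebesgue T"
  proof (rule measure_mono_fmeasurable[OF _ _ T(1)])
    show "(\<Union>k\<in>D. interior k) \<subseteq> T" using T(2) interior_subset by blast
    show "(\<Union>k\<in>D. interior k) \<in> sets lebesgue" using int fin by (intro sets.finite_UN) (auto simp: fmeasurable_def)
  qed
  finally show ?thesis .
qed

text \<open>
  The gauge confines the intervals tagged in \<open>N\<close> to an open set of small measure, where absolute
  continuity bounds the sum of the increments; elsewhere the usual straddle estimate applies.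
\<close>

lemma has_integral_abs_continuous_real:
  fixes f :: "real \<Rightarrow> real"
  assumes f: "abs_continuous s t f" and "s \<le> t"
    and N: "negligible N" and k: "\<And>x. x \<in> {s..t} - N \<Longrightarrow> (f has_real_derivative k x) (at x)"
    and k0: "\<And>x. x \<in> N \<Longrightarrow> k x = 0"
  shows "(k has_integral (f t - f s)) {s..t}"
  unfolding has_integral_real
proof (intro allI impI)
  fix e :: real assume "e > 0"
  then have "e / 2 > 0" by simp
  obtain d where "d > 0" and d: "\<And>D. \<lbrakk>interval_family s t D; (\<Sum>k\<in>D. measure lborel k) < d\<rbrakk> \<Longrightarrow> (\<Sum>k\<in>D. norm (incr f k)) < e / 2"
    using abs_continuous_family[OF f \<open>e / 2 > 0\<close>] by blast
  have Nl: "N \<in> lmeasurable" using N by (rule negligible_imp_measurable)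
  obtain T where T: "open T" "N \<subseteq> T" "T - N \<in> lmeasurable" "emeasure lebesgue (T - N) < ennreal d"
    using sets_lebesgue_outer_open[OF fmeasurableD[OF Nl] \<open>d > 0\<close>] by blast
  have Tl: "T \<in> lmeasurable"
    using fmeasurable.Un[OF Nl T(3)] T(2) by (simp add: Un_absorb1)
  have Td: "measure lebesgue T < d"
  proof -
    have "measure lebesgue (T - N) < d" 
      using T \<open>d > 0\<close> by (simp add: emeasure_eq_measure2 measure_nonneg ennreal_less_iff)
    moreover have "measure lebesgue T \<le> measure lebesgue N + measure lebesgue (T - N)"
      using measure_Un_le[of N lebesgue "T - N"] Nl T by (simp add: Un_absorb1 fmeasurableD)
    moreover have "measure lebesgue N = 0" using N by (rule negligible_imp_measure0)
    ultimately show ?thesis by simp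
  qed
  \<comment> \<open>The summand 1 keeps the denominator positive when \<open>s = t\<close>.\<close>
  define e' where "e' = e / (2 * (t - s + 1))"
  have "e' > 0" using \<open>e > 0\<close> \<open>s \<le> t\<close> by (simp add: e'_def)
  have "\<exists>r>0. \<forall>y. \<bar>y - x\<bar> < r \<longrightarrow> \<bar>f y - f x - k x * (y - x)\<bar> \<le> e' * \<bar>y - x\<bar>" if x: "x \<in> {s..t} - N" for x
    using k[OF x] \<open>e' > 0\<close> unfolding has_field_derivative_def has_derivative_at_alt by auto
  then obtain r where r: "\<And>x. x \<in> {s..t} - N \<Longrightarrow> r x > 0"
      "\<And>x y. x \<in> {s..t} - N \<Longrightarrow> \<bar>y - x\<bar> < r x \<Longrightarrow> \<bar>f y - f x - k x * (y - x)\<bar> \<le> e' * \<bar>y - x\<bar>"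
    by metis
  define \<gamma> where "\<gamma> x = (if x \<in> N then T else if x \<in> {s..t} then ball x (r x) else UNIV)" for x
  show "\<exists>\<gamma>. gauge \<gamma> \<and> (\<forall>\<D>. \<D> tagged_division_of {s..t} \<and> \<gamma> fine \<D> \<longrightarrow>
          norm ((\<Sum>(x, K)\<in>\<D>. measure lborel K *\<^sub>R k x) - (f t - f s)) < e)"
  proof (intro exI[of _ \<gamma>] conjI allI impI)
    show "gauge \<gamma>" using T r by (auto simp: gauge_def \<gamma>_def)
    fix D assume D: "D tagged_division_of {s..t} \<and> \<gamma> fine D"
    note td = conjunct1[OF D]
    have fine: "K \<subseteq> \<gamma> x" if "(x,K) \<in> D" for x K using D that by (auto simp: fine_def)
    have finD: "finite D" using td by auto
    have K: "x \<in> {s..t} \<and> (\<exists>u v. u \<le> x \<and> x \<le> v \<and> K = {u..v} \<and> s \<le> u \<and> v \<le> t)" if xK: "(x,K) \<in> D" for x K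
    proof -
      have "x \<in> K" "K \<subseteq> {s..t}" "\<exists>a b. K = cbox a b"
        using tagged_division_ofD(2,3,4)[OF td xK] by auto
      then show ?thesis by (auto simp: box_real)
    qed
    \<comment> \<open>Nonempty interior makes a cell determine its tag, so that sums over tagged
      cells and over cells agree; degenerate cells have increment 0.\<close>
    define P where "P = {(x,K)\<in>D. x \<in> N \<and> interior K \<noteq> {}}"
    have PD: "P \<subseteq> D" by (auto simp: P_def)
    have injP: "inj_on snd P"
    proof (rule inj_onI)
      fix p p' assume p: "p \<in> P" "p' \<in> P" "snd p = snd p'"
      show "p = p'"
      proof (rule ccontr)
        assume "p \<noteq> p'"
        moreover have "(fst p, snd p) \<in> D" "(fst p', snd p') \<in> D" using subsetD[OF PD p(1)] subsetD[OF PD p(2)] by simp_all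
        ultimately have "interior (snd p) \<inter> interior (snd p') = {}"
          using tagged_division_ofD(5)[OF td, of "fst p" "snd p" "fst p'" "snd p'"] by (auto simp: prod_eq_iff)
        then show False using p by (simp add: P_def case_prod_beta)
      qed
    qed
    have fam: "interval_family s t (snd ` P)"
      unfolding interval_family_def
    proof (intro conjI ballI impI)
      show "finite (snd ` P)" using finD PD finite_subset by blast
      fix K assume "K \<in> snd ` P"
      then obtain x where x: "(x,K) \<in> P" by auto
      then have xD: "(x,K) \<in> D" using PD by blast
      show "K \<subseteq> {s..t}" "\<exists>u v. u \<le> v \<and> K = {u..v}" using K[OF xD] by auto
      fix L assume L: "L \<in> snd ` P" "K \<noteq> L"
      obtain y where "(y,L) \<in> P" using L(1) by auto
      then have "(y,L) \<in> D" using PD by blast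
      then show "interior K \<inter> interior L = {}"
        using tagged_division_ofD(5)[OF td xD] L(2) by blast
    qed
    have "(\<Sum>K\<in>snd ` P. measure lborel K) \<le> measure lebesgue T"
    proof (rule measure_interval_family[OF fam Tl])
      fix K assume "K \<in> snd ` P"
      then obtain x where "(x,K) \<in> D" "x \<in> N" by (auto simp: P_def)
      then show "K \<subseteq> T" using fine[of x K] by (simp add: \<gamma>_def)
    qed
    then have "(\<Sum>K\<in>snd ` P. norm (incr f K)) < e / 2" using d[OF fam] Td by simp
    then have smallP: "(\<Sum>p\<in>P. \<bar>incr f (snd p)\<bar>) < e / 2"
      using injP by (simp add: sum.reindex)
    have "\<bar>case p of (x,K) \<Rightarrow> measure lborel K * k x - incr f K\<bar>
        \<le> e' * measure lborel (snd p) + (if p \<in> P then \<bar>incr f (snd p)\<bar> else 0)" if p: "p \<in> D" for p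
    proof -
      obtain x L where xL: "p = (x,L)" by (cases p)
      then obtain u v where uv: "u \<le> x" "x \<le> v" "L = {u..v}" "s \<le> u" "v \<le> t" "x \<in> {s..t}" using K p by blast
      then have L: "measure lborel L = v - u" "incr f L = f v - f u" by auto
      show ?thesis
      proof (cases "x \<in> N")
        case True
        show ?thesis
        proof (cases "interior L = {}")
          case True
          then have "u = v" using uv by (simp add: interior_atLeastAtMost_real)
          then show ?thesis using xL L by simp
        next
          case False
          then have "p \<in> P" using p xL \<open>x \<in> N\<close> by (simp add: P_def)
          moreover have "e' * (v - u) \<ge> 0" using \<open>e' > 0\<close> uv by simp
          ultimately show ?thesis using xL k0[OF \<open>x \<in> N\<close>] L by simp
        qed
      next
        case False
        then have x: "x \<in> {s..t} - N" using uv by simp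
        have "L \<subseteq> ball x (r x)" using fine[of x L] p xL False uv by (simp add: \<gamma>_def)
        moreover have "u \<in> L" "v \<in> L" using uv by simp_all
        ultimately have "u \<in> ball x (r x)" "v \<in> ball x (r x)" by blast+
        then have "\<bar>f u - f x - k x * (u - x)\<bar> \<le> e' * \<bar>u - x\<bar>" "\<bar>f v - f x - k x * (v - x)\<bar> \<le> e' * \<bar>v - x\<bar>"
          using r(2)[OF x] by (auto simp: dist_real_def abs_minus_commute)
        moreover have "(v - u) * k x - (f v - f u) = (f u - f x - k x * (u - x)) - (f v - f x - k x * (v - x))"
          by (simp add: algebra_simps)
        ultimately have "\<bar>(v - u) * k x - (f v - f u)\<bar> \<le> e' * \<bar>u - x\<bar> + e' * \<bar>v - x\<bar>" by linarith
        also have "\<dots> = e' * (v - u)" using uv by (simp add: algebra_simps)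
        finally have "\<bar>case p of (x,K) \<Rightarrow> measure lborel K * k x - incr f K\<bar> \<le> e' * measure lborel (snd p)"
          using xL L by simp
        then show ?thesis by (simp add: add_increasing2)
      qed
    qed
    then have "(\<Sum>p\<in>D. \<bar>case p of (x,K) \<Rightarrow> measure lborel K * k x - incr f K\<bar>)
      \<le> (\<Sum>p\<in>D. e' * measure lborel (snd p) + (if p \<in> P then \<bar>incr f (snd p)\<bar> else 0))"
      by (rule sum_mono)
    also have "\<dots> = e' * (\<Sum>p\<in>D. measure lborel (snd p)) + (\<Sum>p\<in>P. \<bar>incr f (snd p)\<bar>)"
      using finD PD by (simp add: sum.distrib sum_distrib_left sum.If_cases Int_absorb1)
    also have "(\<Sum>p\<in>D. measure lborel (snd p)) = t - s"
      using additive_content_tagged_division[of D s t] td \<open>s \<le> t\<close> by (simp add: case_prod_beta box_real)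
    also have "e' * (t - s) \<le> e / 2"
      using \<open>e > 0\<close> \<open>s \<le> t\<close> by (simp add: e'_def field_simps)
    finally have "(\<Sum>p\<in>D. \<bar>case p of (x,K) \<Rightarrow> measure lborel K * k x - incr f K\<bar>) < e" using smallP by linarith
    then have "\<bar>\<Sum>p\<in>D. case p of (x,K) \<Rightarrow> measure lborel K * k x - incr f K\<bar> < e"
      using sum_abs[of "\<lambda>p. case p of (x,K) \<Rightarrow> measure lborel K * k x - incr f K" D] by linarith
    moreover have "(\<Sum>(x,K)\<in>D. incr f K) = f t - f s"
      using additive_tagged_division_1[OF \<open>s \<le> t\<close> td, of f] by (simp add: incr_def)
    ultimately show "norm ((\<Sum>(x, K)\<in>D. measure lborel K *\<^sub>R k x) - (f t - f s)) < e"
      by (simp add: case_prod_beta sum_subtractf)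
  qed
qed

text \<open>Componentwise. The end points join \<open>N\<close> because the derivative is two-sided
  and values of \<open>Y\<close> outside the interval are arbitrary.\<close>

lemma abs_continuous_vector_derivative_ae:
  fixes Y :: "real \<Rightarrow> 'a::euclidean_space"
  assumes Y: "abs_continuous s t Y"
  obtains N where "negligible N" "{s,t} \<subseteq> N" "\<And>x. x \<in> {s..t} - N \<Longrightarrow> (Y has_vector_derivative vector_derivative Y (at x)) (at x)"
proof
  define N where "N = {s,t} \<union> (\<Union>b\<in>Basis. {x \<in> {s<..<t}. \<not> (\<lambda>x. Y x \<bullet> b) differentiable (at x)})"
  have AC: "abs_continuous s t (\<lambda>x. Y x \<bullet> b)" if "b \<in> Basis" for b
    by (rule abs_continuous_dominated[OF Y, of _ 1]) (use Basis_le_norm[OF that] in \<open>auto simp: inner_diff_left[symmetric]\<close>)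
  show "negligible N"
    unfolding N_def using abs_continuous_differentiable_ae[OF AC] by (intro negligible_Un negligible_Union) auto
  show "{s,t} \<subseteq> N" by (auto simp: N_def)
  fix x assume x: "x \<in> {s..t} - N"
  then have "(\<lambda>x. Y x \<bullet> b) differentiable (at x)" if "b \<in> Basis" for b
    using that by (force simp: N_def)
  then have "Y differentiable (at x)"
    by (subst differentiable_componentwise_within) auto
  then show "(Y has_vector_derivative vector_derivative Y (at x)) (at x)"
    using vector_derivative_works by blast
qed

lemma has_integral_abs_continuous:
  fixes Y :: "real \<Rightarrow> 'a::euclidean_space"
  assumes Y: "abs_continuous s t Y" and "s \<le> t"
  shows "((\<lambda>x. vector_derivative Y (at x)) has_integral (Y t - Y s)) {s..t}"
proof -
  obtain N where N: "negligible N" "{s,t} \<subseteq> N" and der: "\<And>x. x \<in> {s..t} - N \<Longrightarrow> (Y has_vector_derivative vector_derivative Y (at x)) (at x)"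
    using abs_continuous_vector_derivative_ae[OF Y] by blast
  have "((\<lambda>x. vector_derivative Y (at x) \<bullet> b) has_integral ((Y t - Y s) \<bullet> b)) {s..t}" if b: "b \<in> Basis" for b
  proof -
    have AC: "abs_continuous s t (\<lambda>x. Y x \<bullet> b)"
      by (rule abs_continuous_dominated[OF Y, of _ 1]) (use Basis_le_norm[OF that] in \<open>auto simp: inner_diff_left[symmetric]\<close>)
    have "((\<lambda>x. if x \<in> N then 0 else vector_derivative Y (at x) \<bullet> b) has_integral (Y t \<bullet> b - Y s \<bullet> b)) {s..t}"
    proof (rule has_integral_abs_continuous_real[OF AC \<open>s \<le> t\<close> N(1)])
      fix x assume x: "x \<in> {s..t} - N"
      have "((\<lambda>x. Y x \<bullet> b) has_vector_derivative vector_derivative Y (at x) \<bullet> b) (at x)"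
        using bounded_linear.has_vector_derivative[OF bounded_linear_inner_left der[OF x]] by (simp add: o_def)
      then show "((\<lambda>x. Y x \<bullet> b) has_real_derivative (if x \<in> N then 0 else vector_derivative Y (at x) \<bullet> b)) (at x)"
        using x by (simp add: has_real_derivative_iff_has_vector_derivative)
    qed auto
    from has_integral_spike[OF N(1) _ this] show ?thesis by (simp add: inner_diff_left)
  qed
  then show ?thesis by (simp add: has_integral_componentwise_iff[of _ "Y t - Y s"])
qed

text \<open>Integrated form of the calibration arguments below: \<open>f\<close> is a potential
  along a path, \<open>g\<close> the Lagrangian, and the pointwise bound is available only where the
  path has a derivative.\<close>

lemma abs_continuous_increment_le:
  fixes f g :: "real \<Rightarrow> real"
  assumes f: "abs_continuous s t f" and "s \<le> t" and g: "g integrable_on {s..t}"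
    and N: "negligible N" and le: "\<And>x D. x \<in> {s<..<t} - N \<Longrightarrow> (f has_real_derivative D) (at x) \<Longrightarrow> D \<le> g x"
  shows "f t - f s \<le> integral {s..t} g"
proof -
  obtain M where M: "negligible M" "{s,t} \<subseteq> M" and der: "\<And>x. x \<in> {s..t} - M \<Longrightarrow> (f has_vector_derivative vector_derivative f (at x)) (at x)"
    using abs_continuous_vector_derivative_ae[OF f] by blast
  have "((\<lambda>x. vector_derivative f (at x)) has_integral (f t - f s)) {s..t}"
    by (rule has_integral_abs_continuous[OF f \<open>s \<le> t\<close>])
  then have "((\<lambda>x. if x \<in> M \<union> N then g x else vector_derivative f (at x)) has_integral (f t - f s)) {s..t}"
    by (rule has_integral_spike[OF negligible_Un[OF M(1) N], rotated]) auto
  moreover have "(g has_integral integral {s..t} g) {s..t}" using g by (rule integrable_integral)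
  ultimately show ?thesis
  proof (rule has_integral_le)
    fix x assume x: "x \<in> {s..t}"
    show "(if x \<in> M \<union> N then g x else vector_derivative f (at x)) \<le> g x"
    proof (cases "x \<in> M \<union> N")
      case False
      then have "x \<noteq> s" "x \<noteq> t" "x \<notin> N" using M(2) by auto
      then have "x \<in> {s<..<t} - N" using x by simp
      moreover have "(f has_real_derivative vector_derivative f (at x)) (at x)"
        using der[of x] x False by (simp add: has_real_derivative_iff_has_vector_derivative)
      ultimately show ?thesis using le False by auto
    qed simp
  qed
qed

section \<open>The action as a gauge integral\<close>

definition lagrangian :: "('a::real_normed_vector \<Rightarrow> 'a) \<Rightarrow> (real \<Rightarrow> 'a) \<Rightarrow> real \<Rightarrow> real" where
  "lagrangian F Y t = (norm (vector_derivative Y (at t) - F (Y t)))\<^sup>2 / 2"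

lemma lagrangian_nonneg: "lagrangian F Y t \<ge> 0"
  by (simp add: lagrangian_def)

text \<open>Velocity and drift along the path are both integrable, hence measurable, so the
  Lagrangian is measurable and nonnegative; finiteness of its extended integral is then
  integrability.\<close>

lemma action_finite:
  fixes Y :: "real \<Rightarrow> 'a::euclidean_space"
  assumes Y: "abs_continuous T 0 Y" and "T \<le> 0" and F: "continuous_on UNIV F"
    and fin: "action F T Y < \<infinity>"
  shows "lagrangian F Y integrable_on {T..0}" "action F T Y = ennreal (integral {T..0} (lagrangian F Y))"
proof -
  have "((\<lambda>x. vector_derivative Y (at x)) has_integral (Y 0 - Y T)) {T..0}"
    by (rule has_integral_abs_continuous[OF Y \<open>T \<le> 0\<close>])
  from has_integral_implies_lebesgue_measurable[OF this]
  have m1: "(\<lambda>x. indicator {T..0} x *\<^sub>R vector_derivative Y (at x)) \<in> borel_measurable lebesgue" .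
  have "continuous_on {T..0} (\<lambda>x. F (Y x))"
    by (rule continuous_on_compose2[OF F abs_continuous_imp_continuous_on[OF Y]]) auto
  then have "(\<lambda>x. F (Y x)) integrable_on {T..0}" by (rule integrable_continuous_real)
  then have m2: "(\<lambda>x. indicator {T..0} x *\<^sub>R F (Y x)) \<in> borel_measurable lebesgue"
    unfolding integrable_on_def using has_integral_implies_lebesgue_measurable by blast
  define h where "h x = indicator {T..0} x * lagrangian F Y x" for x
  have h_eq: "h = (\<lambda>x. (norm (indicator {T..0} x *\<^sub>R vector_derivative Y (at x) - indicator {T..0} x *\<^sub>R F (Y x)))\<^sup>2 / 2)"
    by (rule ext) (auto simp: h_def lagrangian_def indicator_def)
  have hm: "h \<in> borel_measurable lebesgue"
    unfolding h_eq using m1 m2 by measurable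
  have h0: "h x \<ge> 0" for x by (simp add: h_def lagrangian_nonneg)
  have act: "action F T Y = integral\<^sup>N lebesgue h"
    unfolding action_def by (intro nn_integral_cong) (auto simp: h_def lagrangian_def indicator_def)
  then obtain r where r: "r \<ge> 0" "integral\<^sup>N lebesgue h = ennreal r"
    using fin by (metis ennreal_cases infinity_ennreal_def less_irrefl)
  have "(h has_integral r) UNIV"
    using has_integral_iff_nn_integral_lebesgue[of h r] h0 hm r by auto
  moreover have "h = (\<lambda>x. if x \<in> {T..0} then lagrangian F Y x else 0)"
    by (auto simp: h_def indicator_def)
  ultimately have I: "(lagrangian F Y has_integral r) {T..0}"
    by (simp only: has_integral_restrict_UNIV)
  then show "lagrangian F Y integrable_on {T..0}" by blast
  show "action F T Y = ennreal (integral {T..0} (lagrangian F Y))"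
    using I r act by (simp add: integral_unique)
qed

section \<open>Functions of class \<open>C\<^sup>k\<close>\<close>

lemma C_class_Suc_imp: "C_class (Suc k) f \<Longrightarrow> C_class k f"
proof (induction k arbitrary: f)
  case 0
  then show ?case by (auto intro!: continuous_at_imp_continuous_on differentiable_imp_continuous_within)
qed auto

lemma C_class_mono: "C_class m f \<Longrightarrow> k \<le> m \<Longrightarrow> C_class k f"
  by (induction m) (auto simp del: C_class.simps(2) dest: C_class_Suc_imp elim: le_SucE)

lemma C_class_continuous: "C_class k f \<Longrightarrow> continuous_on S f"
  using C_class_mono[of k f 0] continuous_on_subset by fastforce

text \<open>\<open>C_class\<close> controls each directional derivative separately. Bounding those
  along \<open>Basis\<close> on the compact set and summing bounds the operator norm, and convexity
  allows the mean value inequality.\<close>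

lemma C_class_lipschitz:
  fixes f :: "'a::euclidean_space \<Rightarrow> 'b::real_normed_vector"
  assumes f: "C_class (Suc k) f" and S: "compact S" "convex S"
  obtains C where "C \<ge> 0" "\<And>x y. x \<in> S \<Longrightarrow> y \<in> S \<Longrightarrow> norm (f x - f y) \<le> C * norm (x - y)"
proof -
  have der: "(f has_derivative frechet_derivative f (at x)) (at x)" for x
    using f frechet_derivative_works by auto
  have "\<exists>B\<ge>0. \<forall>x\<in>S. norm (frechet_derivative f (at x) b) \<le> B" for b
  proof -
    have "continuous_on S (\<lambda>x. frechet_derivative f (at x) b)"
      using f by (intro C_class_continuous[of k]) auto
    then have "bounded ((\<lambda>x. frechet_derivative f (at x) b) ` S)"
      using S(1) by (intro compact_imp_bounded compact_continuous_image)
    then obtain B where B: "\<forall>x\<in>S. norm (frechet_derivative f (at x) b) \<le> B"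
      by (auto simp: bounded_iff)
    then show ?thesis by (intro exI[of _ "\<bar>B\<bar>"]) (auto intro: order_trans)
  qed
  then obtain B where B: "\<And>b. B b \<ge> 0" "\<And>b x. x \<in> S \<Longrightarrow> norm (frechet_derivative f (at x) b) \<le> B b"
    by metis
  define C where "C = (\<Sum>b\<in>Basis. B b)"
  have C0: "C \<ge> 0" using B by (simp add: C_def sum_nonneg)
  have on: "onorm (frechet_derivative f (at x)) \<le> C" if x: "x \<in> S" for x
  proof (rule onorm_le)
    fix v :: 'a
    interpret bounded_linear "frechet_derivative f (at x)" using der has_derivative_bounded_linear by blast
    have "frechet_derivative f (at x) v = (\<Sum>b\<in>Basis. (v \<bullet> b) *\<^sub>R frechet_derivative f (at x) b)"
      by (subst euclidean_representation[of v, symmetric]) (simp add: sum scale)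
    also have "norm \<dots> \<le> (\<Sum>b\<in>Basis. \<bar>v \<bullet> b\<bar> * norm (frechet_derivative f (at x) b))"
      by (rule order_trans[OF norm_sum]) simp
    also have "\<dots> \<le> (\<Sum>b\<in>Basis. norm v * B b)"
      using B x by (intro sum_mono mult_mono) (auto simp: Basis_le_norm)
    also have "\<dots> = C * norm v"
      by (simp add: C_def sum_distrib_left[symmetric])
    finally show "norm (frechet_derivative f (at x) v) \<le> C * norm v" .
  qed
  show thesis
  proof (rule that[OF C0])
    fix x y assume "x \<in> S" "y \<in> S"
    then show "norm (f x - f y) \<le> C * norm (x - y)"
      by (intro differentiable_bound[OF S(2) has_derivative_at_withinI[OF der] on])
  qed
qed

section \<open>Gradient and Hessian\<close>

lemma grad_inner:
  assumes "V differentiable (at x)"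
  shows "frechet_derivative V (at x) v = grad V x \<bullet> v"
proof -
  interpret bounded_linear "frechet_derivative V (at x)"
    using assms frechet_derivative_works has_derivative_bounded_linear by blast
  have "frechet_derivative V (at x) v = (\<Sum>i\<in>UNIV. v $ i * frechet_derivative V (at x) (axis i 1))"
    by (subst basis_expansion[of v, symmetric]) (simp add: sum scale scalar_mult_eq_scaleR)
  then show ?thesis by (simp add: grad_def inner_vec_def mult.commute)
qed

context
  fixes V :: "real ^ 'n \<Rightarrow> real"
  assumes V: "C_class 3 V"
begin

lemma C_class_grad_component: "C_class 2 (\<lambda>x. frechet_derivative V (at x) v)"
  using V by (simp add: numeral_3_eq_3 numeral_2_eq_2)

lemma grad_has_derivative: "(grad V has_derivative (\<lambda>w. hessian V x *v w)) (at x)"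
proof -
  have "(\<lambda>x. grad V x \<bullet> axis i 1) differentiable (at x)" for i
    using C_class_grad_component[of "axis i 1"] by (simp add: grad_def inner_axis numeral_2_eq_2)
  then have "grad V differentiable (at x)"
    by (subst differentiable_componentwise_within) (auto simp: Basis_vec_def)
  then show ?thesis unfolding hessian_def using jacobian_works by blast
qed

text \<open>Writes the entries as iterated directional derivatives, the form in which
  \<open>C_class\<close> gives regularity.\<close>

lemma hessian_component: "(hessian V x *v w) $ i = (\<Sum>j\<in>UNIV. w $ j * frechet_derivative (\<lambda>x. frechet_derivative V (at x) (axis i 1)) (at x) (axis j 1))"
proof -
  have "((\<lambda>x. grad V x $ i) has_derivative (\<lambda>w. (hessian V x *v w) $ i)) (at x)"
    using bounded_linear.has_derivative[OF bounded_linear_vec_nth grad_has_derivative] .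
  then have eq: "frechet_derivative (\<lambda>x. frechet_derivative V (at x) (axis i 1)) (at x) = (\<lambda>w. (hessian V x *v w) $ i)"
    by (simp add: grad_def frechet_derivative_at[symmetric])
  have "(hessian V x *v w) $ i = (\<Sum>j\<in>UNIV. w $ j * (hessian V x *v axis j 1) $ i)"
    by (simp add: matrix_vector_mult_def axis_def if_distrib mult.commute cong: if_cong)
  then show ?thesis unfolding eq .
qed

lemma hessian_lipschitz:
  assumes S: "compact S" "convex S"
  obtains C where "C \<ge> 0" "\<And>x y w. x \<in> S \<Longrightarrow> y \<in> S \<Longrightarrow> norm (hessian V x *v w - hessian V y *v w) \<le> C * norm (x - y) * norm w"
proof -
  define h where "h i j x = frechet_derivative (\<lambda>x. frechet_derivative V (at x) (axis i 1)) (at x) (axis j 1)" for i j :: 'n and x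
  have "C_class (Suc 0) (h i j)" for i j
    using C_class_grad_component[of "axis i 1"] unfolding h_def by (simp add: numeral_2_eq_2)
  then have "\<exists>C\<ge>0. \<forall>x\<in>S. \<forall>y\<in>S. norm (h i j x - h i j y) \<le> C * norm (x - y)" for i j
    using C_class_lipschitz[OF _ S] by metis
  then obtain C where C: "\<And>i j. C i j \<ge> 0" "\<And>i j x y. x \<in> S \<Longrightarrow> y \<in> S \<Longrightarrow> \<bar>h i j x - h i j y\<bar> \<le> C i j * norm (x - y)"
    unfolding real_norm_def by metis
  show thesis
  proof
    show "(\<Sum>i\<in>UNIV. \<Sum>j\<in>UNIV. C i j) \<ge> 0" by (intro sum_nonneg C)
    fix x y w assume xy: "x \<in> S" "y \<in> S"
    have "norm (hessian V x *v w - hessian V y *v w) \<le> (\<Sum>i\<in>UNIV. \<bar>(hessian V x *v w - hessian V y *v w) $ i\<bar>)"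
      by (rule norm_le_l1_cart)
    also have "\<dots> \<le> (\<Sum>i\<in>UNIV. \<Sum>j\<in>UNIV. C i j * norm (x - y) * norm w)"
    proof (rule sum_mono)
      fix i
      have "(hessian V x *v w - hessian V y *v w) $ i = (\<Sum>j\<in>UNIV. w $ j * (h i j x - h i j y))"
        by (simp add: hessian_component h_def sum_subtractf right_diff_distrib)
      also have "\<bar>\<dots>\<bar> \<le> (\<Sum>j\<in>UNIV. \<bar>w $ j\<bar> * \<bar>h i j x - h i j y\<bar>)"
        by (rule order_trans[OF sum_abs]) (simp add: abs_mult)
      also have "\<dots> \<le> (\<Sum>j\<in>UNIV. norm w * (C i j * norm (x - y)))"
        using C xy by (intro sum_mono mult_mono component_le_norm_cart) auto
      finally show "\<bar>(hessian V x *v w - hessian V y *v w) $ i\<bar> \<le> (\<Sum>j\<in>UNIV. C i j * norm (x - y) * norm w)"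
        by (simp add: mult_ac)
    qed
    finally show "norm (hessian V x *v w - hessian V y *v w) \<le> (\<Sum>i\<in>UNIV. \<Sum>j\<in>UNIV. C i j) * norm (x - y) * norm w"
      by (simp add: sum_distrib_right)
  qed
qed

text \<open>Mean value inequality for \<open>grad V\<close> minus its linearisation at
  \<open>x\<close>, whose derivative has operator norm at most \<open>C * norm (y - x)\<close> on
  the segment.\<close>

lemma grad_taylor:
  assumes S: "convex S" and C: "C \<ge> 0" "\<And>x y w. x \<in> S \<Longrightarrow> y \<in> S \<Longrightarrow> norm (hessian V x *v w - hessian V y *v w) \<le> C * norm (x - y) * norm w"
    and xy: "x \<in> S" "y \<in> S"
  shows "norm (grad V y - grad V x - hessian V x *v (y - x)) \<le> C * (norm (y - x))\<^sup>2"
proof -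
  have der: "((\<lambda>z. grad V z - hessian V x *v z) has_derivative (\<lambda>w. hessian V z *v w - hessian V x *v w)) (at z within closed_segment x y)" for z
    by (intro has_derivative_diff has_derivative_at_withinI[OF grad_has_derivative] bounded_linear_imp_has_derivative matrix_vector_mul_bounded_linear)
  have "norm ((grad V y - hessian V x *v y) - (grad V x - hessian V x *v x)) \<le> (C * norm (y - x)) * norm (y - x)"
  proof (rule differentiable_bound[OF convex_closed_segment der])
    fix z assume z: "z \<in> closed_segment x y"
    then have "z \<in> S" using S xy by (meson convex_contains_segment subsetD)
    show "onorm (\<lambda>w. hessian V z *v w - hessian V x *v w) \<le> C * norm (y - x)"
    proof (rule onorm_le)
      fix w
      have "norm (hessian V z *v w - hessian V x *v w) \<le> C * norm (z - x) * norm w"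
        using C(2) \<open>z \<in> S\<close> xy(1) by blast
      also have "\<dots> \<le> C * norm (y - x) * norm w"
        using segment_bound(1)[OF z] C(1) by (intro mult_right_mono mult_left_mono) auto
      finally show "norm (hessian V z *v w - hessian V x *v w) \<le> C * norm (y - x) * norm w" .
    qed
  qed auto
  then show ?thesis by (simp add: matrix_vector_mult_diff_distrib power2_eq_square algebra_simps)
qed

text \<open>The quotient is symmetric in \<open>u\<close> and \<open>v\<close>, so its limit forces
  the Hessian to be symmetric. The mean value theorem is applied in the direction \<open>u\<close>
  only; the remaining difference of gradients is read off from differentiability of
  \<open>grad V\<close> at \<open>x\<close>.\<close>

lemma second_difference:
  "((\<lambda>t. (V (x + t *\<^sub>R u + t *\<^sub>R v) - V (x + t *\<^sub>R u) - V (x + t *\<^sub>R v) + V x) / t\<^sup>2) \<longlongrightarrow> (hessian V x *v v) \<bullet> u) (at_right 0)"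
proof (rule tendstoI)
  fix e :: real assume "e > 0"
  \<comment> \<open>Chosen so that \<open>norm u * (2 * norm u + norm v) = a - 1 < a\<close>, which
    makes the final bound strict.\<close>
  define a where "a = norm u * (2 * norm u + norm v) + 1"
  have "a > 0" by (simp add: a_def add_nonneg_pos)
  have dV: "(V has_derivative (\<lambda>w. grad V y \<bullet> w)) (at y)" for y
  proof -
    have "V differentiable (at y)" using V by (simp add: numeral_3_eq_3)
    then have "(V has_derivative frechet_derivative V (at y)) (at y)" "frechet_derivative V (at y) = (\<lambda>w. grad V y \<bullet> w)"
      using frechet_derivative_works grad_inner by blast+
    then show ?thesis by simp
  qed
  have "e / a > 0" using \<open>e > 0\<close> \<open>a > 0\<close> by simp
  then obtain d where "d > 0" and d: "\<And>y. norm (y - x) < d \<Longrightarrow> norm (grad V y - grad V x - hessian V x *v (y - x)) \<le> e / a * norm (y - x)"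
    using grad_has_derivative[of x] unfolding has_derivative_at_alt by blast
  define d' where "d' = d / (norm u + norm v + 1)"
  have np: "norm u + norm v + 1 > 0" by (simp add: add_nonneg_pos)
  have "d' > 0" using \<open>d > 0\<close> np by (simp add: d'_def)
  have "dist ((V (x + t *\<^sub>R u + t *\<^sub>R v) - V (x + t *\<^sub>R u) - V (x + t *\<^sub>R v) + V x) / t\<^sup>2) ((hessian V x *v v) \<bullet> u) < e" if t: "t \<in> {0<..<d'}" for t
  proof -
    define \<psi> where "\<psi> s = V (x + s *\<^sub>R u + t *\<^sub>R v) - V (x + s *\<^sub>R u)" for s
    have der: "(\<psi> has_derivative (\<lambda>s. s * (grad V (x + s0 *\<^sub>R u + t *\<^sub>R v) \<bullet> u - grad V (x + s0 *\<^sub>R u) \<bullet> u))) (at s0)" for s0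
      unfolding \<psi>_def
      by (rule has_derivative_eq_rhs[OF has_derivative_diff[OF has_derivative_compose[OF _ dV] has_derivative_compose[OF _ dV]]])
         (auto intro!: derivative_eq_intros simp: algebra_simps fun_eq_iff)
    obtain \<xi> where \<xi>: "0 < \<xi>" "\<xi> < t" "\<psi> t - \<psi> 0 = t * (grad V (x + \<xi> *\<^sub>R u + t *\<^sub>R v) \<bullet> u - grad V (x + \<xi> *\<^sub>R u) \<bullet> u)"
      using mvt_simple[of 0 t \<psi> "\<lambda>s0 s. s * (grad V (x + s0 *\<^sub>R u + t *\<^sub>R v) \<bullet> u - grad V (x + s0 *\<^sub>R u) \<bullet> u)"]
        t has_derivative_at_withinI[OF der] by auto
    have b1: "norm (\<xi> *\<^sub>R u) \<le> t * norm u" using \<xi> by (simp add: mult_right_mono)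
    have b2: "norm (\<xi> *\<^sub>R u + t *\<^sub>R v) \<le> t * (norm u + norm v)"
      using norm_triangle_ineq[of "\<xi> *\<^sub>R u" "t *\<^sub>R v"] b1 t by (simp add: algebra_simps)
    have "t * (norm u + norm v + 1) < d" using t np by (simp add: d'_def pos_less_divide_eq)
    then have "t * (norm u + norm v) < d" "t * norm u < d" using t by (auto simp: algebra_simps intro: order.strict_trans1[rotated])
    then have n: "norm (\<xi> *\<^sub>R u) < d" "norm (\<xi> *\<^sub>R u + t *\<^sub>R v) < d" using b1 b2 by linarith+
    have "norm (grad V (x + \<xi> *\<^sub>R u + t *\<^sub>R v) - grad V x - hessian V x *v (\<xi> *\<^sub>R u + t *\<^sub>R v)) \<le> e / a * norm (\<xi> *\<^sub>R u + t *\<^sub>R v)"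
      using d[of "x + \<xi> *\<^sub>R u + t *\<^sub>R v"] n by (simp add: add.assoc)
    moreover have "norm (grad V (x + \<xi> *\<^sub>R u) - grad V x - hessian V x *v (\<xi> *\<^sub>R u)) \<le> e / a * norm (\<xi> *\<^sub>R u)"
      using d[of "x + \<xi> *\<^sub>R u"] n by simp
    moreover define z where "z = grad V (x + \<xi> *\<^sub>R u + t *\<^sub>R v) - grad V (x + \<xi> *\<^sub>R u) - t *\<^sub>R (hessian V x *v v)"
    have "z = (grad V (x + \<xi> *\<^sub>R u + t *\<^sub>R v) - grad V x - hessian V x *v (\<xi> *\<^sub>R u + t *\<^sub>R v)) - (grad V (x + \<xi> *\<^sub>R u) - grad V x - hessian V x *v (\<xi> *\<^sub>R u))"
      by (simp add: z_def matrix_vector_right_distrib matrix_vector_mult_scaleR)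
    ultimately have "norm z \<le> e / a * norm (\<xi> *\<^sub>R u + t *\<^sub>R v) + e / a * norm (\<xi> *\<^sub>R u)"
      using norm_triangle_ineq4 by (smt (verit))
    also have "\<dots> \<le> e / a * (t * (norm u + norm v)) + e / a * (t * norm u)"
      using b1 b2 \<open>e / a > 0\<close> by (intro add_mono mult_left_mono) auto
    finally have "norm z \<le> e / a * t * (2 * norm u + norm v)" by (simp add: algebra_simps)
    then have "\<bar>z \<bullet> u\<bar> \<le> e / a * t * (2 * norm u + norm v) * norm u"
      using Cauchy_Schwarz_ineq2[of z u] by (meson mult_right_mono norm_ge_zero order_trans)
    also have "\<dots> = (e / a * t) * (a - 1)" by (simp add: a_def algebra_simps)
    also have "\<dots> < (e / a * t) * a" using mult_pos_pos[OF \<open>e / a > 0\<close>, of t] t by (intro mult_strict_left_mono) auto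
    finally have zu: "\<bar>z \<bullet> u\<bar> < e * t" using \<open>a > 0\<close> by simp
    have "(V (x + t *\<^sub>R u + t *\<^sub>R v) - V (x + t *\<^sub>R u) - V (x + t *\<^sub>R v) + V x) = t * (z \<bullet> u + t * ((hessian V x *v v) \<bullet> u))"
      using \<xi>(3) by (simp add: \<psi>_def z_def inner_diff_left algebra_simps)
    then have eq: "(V (x + t *\<^sub>R u + t *\<^sub>R v) - V (x + t *\<^sub>R u) - V (x + t *\<^sub>R v) + V x) / t\<^sup>2 - (hessian V x *v v) \<bullet> u = z \<bullet> u / t"
      using t by (simp add: field_simps power2_eq_square)
    have "\<bar>z \<bullet> u / t\<bar> < e" using zu t by (simp add: abs_div_pos[symmetric] pos_divide_less_eq)
    then show ?thesis unfolding dist_real_def eq .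
  qed
  then show "\<forall>\<^sub>F t in at_right 0. dist ((V (x + t *\<^sub>R u + t *\<^sub>R v) - V (x + t *\<^sub>R u) - V (x + t *\<^sub>R v) + V x) / t\<^sup>2) ((hessian V x *v v) \<bullet> u) < e"
    using eventually_at_right_real[OF \<open>d' > 0\<close>] by (rule eventually_mono[rotated]) auto
qed

lemma hessian_symmetric: "(hessian V x *v v) \<bullet> u = (hessian V x *v u) \<bullet> v"
proof (rule tendsto_unique[OF _ second_difference])
  show "((\<lambda>t. (V (x + t *\<^sub>R u + t *\<^sub>R v) - V (x + t *\<^sub>R u) - V (x + t *\<^sub>R v) + V x) / t\<^sup>2) \<longlongrightarrow> (hessian V x *v u) \<bullet> v) (at_right 0)"
    using second_difference[of x v u] by (simp add: algebra_simps)
qed simp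

end

lemma C_class_velocity:
  assumes "C_class (Suc k) \<gamma>"
  shows "(\<gamma> has_vector_derivative velocity \<gamma> \<theta>) (at \<theta>)" "C_class k (velocity \<gamma>)"
proof -
  have d: "\<gamma> differentiable (at \<theta>)" for \<theta> using assms by simp
  then show 1: "(\<gamma> has_vector_derivative velocity \<gamma> \<theta>) (at \<theta>)" for \<theta>
    using vector_derivative_works by blast
  have "velocity \<gamma> = (\<lambda>\<theta>. frechet_derivative \<gamma> (at \<theta>) 1)"
  proof
    fix \<theta>
    have "(\<lambda>x. x *\<^sub>R velocity \<gamma> \<theta>) = frechet_derivative \<gamma> (at \<theta>)"
      using 1[of \<theta>] unfolding has_vector_derivative_def by (rule frechet_derivative_at)
    from fun_cong[OF this, of 1] show "velocity \<gamma> \<theta> = frechet_derivative \<gamma> (at \<theta>) 1" by simp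
  qed
  then show "C_class k (velocity \<gamma>)" using assms by simp
qed

section \<open>Closed curves and invariance\<close>

lemma antiderivative_exists:
  fixes f :: "real \<Rightarrow> real"
  assumes f: "continuous_on UNIV f"
  obtains F where "F a = c" "\<And>x. (F has_real_derivative f x) (at x)"
proof -
  \<comment> \<open>Integrals over empty intervals vanish, so this is the oriented integral from
    \<open>a\<close> to \<open>x\<close> on both sides of \<open>a\<close>.\<close>
  define H where "H x = integral {a..x} f - integral {x..a} f" for x
  have int: "f integrable_on {u..v}" for u v
    using f by (intro integrable_continuous_real) (auto intro: continuous_on_subset)
  have "(H has_real_derivative f x) (at x)" for x
  proof -
    define l where "l = min a x - 1"
    have eq: "integral {l..y} f = integral {l..a} f + H y" if "y > l" for y
    proof (cases "a \<le> y")
      case True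
      have "integral {l..a} f + integral {a..y} f = integral {l..y} f"
        using True by (intro Henstock_Kurzweil_Integration.integral_combine int) (auto simp: l_def)
      moreover have "integral {y..a} f = 0" using True by (cases "a = y") auto
      ultimately show ?thesis by (simp add: H_def)
    next
      case False
      have "integral {l..y} f + integral {y..a} f = integral {l..a} f"
        using False that by (intro Henstock_Kurzweil_Integration.integral_combine int) auto
      then show ?thesis using False by (simp add: H_def)
    qed
    have "((\<lambda>y. integral {l..y} f) has_real_derivative f x) (at x within {l..x+1})"
      using f by (intro integral_has_real_derivative) (auto intro: continuous_on_subset simp: l_def)
    moreover have "x \<in> interior {l..x+1}" by (simp add: interior_atLeastAtMost_real l_def)
    ultimately have "((\<lambda>y. integral {l..y} f) has_real_derivative f x) (at x)"
      using at_within_interior by metis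
    then have "((\<lambda>y. integral {l..y} f - integral {l..a} f) has_real_derivative f x) (at x)"
      by (auto intro!: derivative_eq_intros)
    then show ?thesis
    proof (rule has_field_derivative_transform_within_open[where S = "{l<..}"])
      show "x \<in> {l<..}" by (simp add: l_def)
    qed (use eq in auto)
  qed
  then have "((\<lambda>x. H x + (c - H a)) has_real_derivative f x) (at x)" for x
    by (auto intro!: derivative_eq_intros)
  then show thesis by (intro that[of "\<lambda>x. H x + (c - H a)"]) auto
qed

section \<open>Lifting paths through a periodic unit speed parametrization\<close>

context
  fixes k :: nat and \<Lambda> :: real and M :: "'a::euclidean_space set" and \<gamma> :: "real \<Rightarrow> 'a"
  assumes param: "unit_speed_param (Suc k) \<Lambda> M \<gamma>"
begin

lemma period_pos: "\<Lambda> > 0"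
  using param by (simp add: unit_speed_param_def)

lemma param_eq_iff: "\<gamma> s = \<gamma> t \<longleftrightarrow> (\<exists>m::int. s = t + of_int m * \<Lambda>)"
  using param by (simp add: unit_speed_param_def)

lemma param_range: "range \<gamma> = M"
  using param by (simp add: unit_speed_param_def)

lemma param_shift: "\<gamma> (s + of_int m * \<Lambda>) = \<gamma> s"
  using param_eq_iff by blast

lemma norm_velocity: "norm (velocity \<gamma> s) = 1"
  using param by (simp add: unit_speed_param_def)

lemma param_derivative: "(\<gamma> has_vector_derivative velocity \<gamma> s) (at s)"
  using param C_class_velocity(1) unfolding unit_speed_param_def by blast

lemma param_continuous: "continuous_on S \<gamma>"
  by (intro continuous_at_imp_continuous_on ballI has_vector_derivative_continuous[OF param_derivative])

lemma nearest_shift: "\<exists>m::int. \<bar>x + of_int m * \<Lambda>\<bar> \<le> \<Lambda> / 2"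
proof -
  have "\<bar>of_int (round (x / \<Lambda>)) - x / \<Lambda>\<bar> * \<Lambda> \<le> 1/2 * \<Lambda>"
    using period_pos by (intro mult_right_mono of_int_round_abs_le) auto
  moreover have "\<bar>of_int (round (x / \<Lambda>)) - x / \<Lambda>\<bar> * \<Lambda> = \<bar>x + of_int (- round (x / \<Lambda>)) * \<Lambda>\<bar>"
  proof -
    have "\<bar>of_int (round (x / \<Lambda>)) - x / \<Lambda>\<bar> * \<Lambda> = \<bar>(of_int (round (x / \<Lambda>)) - x / \<Lambda>) * \<Lambda>\<bar>"
      using period_pos by (simp add: abs_mult)
    also have "(of_int (round (x / \<Lambda>)) - x / \<Lambda>) * \<Lambda> = - (x + of_int (- round (x / \<Lambda>)) * \<Lambda>)"
      using period_pos by (simp add: left_diff_distrib)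
    finally show ?thesis by (simp only: abs_minus_cancel)
  qed
  ultimately show ?thesis by (intro exI[of _ "- round (x / \<Lambda>)"]) auto
qed

lemma unit_shift: "\<exists>m::int. 0 \<le> x + of_int m * \<Lambda> \<and> x + of_int m * \<Lambda> < \<Lambda>"
proof -
  have "of_int \<lfloor>x / \<Lambda>\<rfloor> * \<Lambda> \<le> x" "x < (of_int \<lfloor>x / \<Lambda>\<rfloor> + 1) * \<Lambda>"
    using period_pos floor_divide_lower floor_divide_upper by blast+
  then show ?thesis by (intro exI[of _ "- \<lfloor>x / \<Lambda>\<rfloor>"]) (auto simp: algebra_simps)
qed

lemma small_shift_zero: "\<bar>of_int (m::int) * \<Lambda>\<bar> < \<Lambda> \<Longrightarrow> m = 0"
proof (rule ccontr)
  assume "\<bar>of_int m * \<Lambda>\<bar> < \<Lambda>" "m \<noteq> 0"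
  then have "1 * \<Lambda> \<le> \<bar>of_int m\<bar> * \<Lambda>" using period_pos by (intro mult_right_mono) auto
  then show False using \<open>\<bar>of_int m * \<Lambda>\<bar> < \<Lambda>\<close> period_pos by (simp add: abs_mult)
qed

text \<open>Uniform injectivity modulo the period: over the compact set of pairs whose distance lies
  between \<open>e\<close> and half a period, the chord length is continuous and positive, hence
  bounded below.\<close>

lemma param_near:
  assumes "e > 0"
  shows "\<exists>r>0. \<forall>s s'. norm (\<gamma> s - \<gamma> s') < r \<longrightarrow> (\<exists>m::int. \<bar>s + of_int m * \<Lambda> - s'\<bar> < e)"
proof -
  \<comment> \<open>The ranges come from normalising the second parameter by
    \<open>unit_shift\<close> and the difference by \<open>nearest_shift\<close>.\<close>
  define K where "K = ({-\<Lambda>..2*\<Lambda>} \<times> {0..\<Lambda>}) \<inter> {p. e \<le> \<bar>fst p - snd p\<bar>} \<inter> {p. \<bar>fst p - snd p\<bar> \<le> \<Lambda> / 2}"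
  have K: "compact K"
    unfolding K_def by (intro compact_Int_closed compact_Times compact_Icc closed_Collect_le continuous_intros)
  have pos: "norm (\<gamma> (fst p) - \<gamma> (snd p)) > 0" if p: "p \<in> K" for p
  proof (rule ccontr)
    assume "\<not> ?thesis"
    then have "\<gamma> (fst p) = \<gamma> (snd p)" by simp
    then obtain m :: int where m: "fst p = snd p + of_int m * \<Lambda>" using param_eq_iff by blast
    then have "\<bar>of_int m * \<Lambda>\<bar> < \<Lambda>" using p period_pos by (auto simp: K_def)
    then have "m = 0" by (rule small_shift_zero)
    then show False using m p \<open>e > 0\<close> by (auto simp: K_def)
  qed
  have cont: "continuous_on K (\<lambda>p. norm (\<gamma> (fst p) - \<gamma> (snd p)))"
    by (intro continuous_intros continuous_on_compose2[OF param_continuous[of UNIV]]) auto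
  have "\<exists>r>0. \<forall>p\<in>K. r \<le> norm (\<gamma> (fst p) - \<gamma> (snd p))"
  proof (cases "K = {}")
    case False
    then obtain p where "p \<in> K" "\<forall>p'\<in>K. norm (\<gamma> (fst p) - \<gamma> (snd p)) \<le> norm (\<gamma> (fst p') - \<gamma> (snd p'))"
      using continuous_attains_inf[OF K _ cont] by blast
    then show ?thesis using pos by blast
  qed (auto intro: exI[of _ 1])
  then obtain r where "r > 0" and r: "\<And>p. p \<in> K \<Longrightarrow> r \<le> norm (\<gamma> (fst p) - \<gamma> (snd p))" by blast
  show ?thesis
  proof (intro exI[of _ r] conjI allI impI)
    fix s s' assume n: "norm (\<gamma> s - \<gamma> s') < r"
    obtain j :: int where j: "0 \<le> s' + of_int j * \<Lambda>" "s' + of_int j * \<Lambda> < \<Lambda>" using unit_shift by blast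
    obtain i :: int where i: "\<bar>s - (s' + of_int j * \<Lambda>) + of_int i * \<Lambda>\<bar> \<le> \<Lambda> / 2" using nearest_shift by blast
    have "\<not> (s + of_int i * \<Lambda>, s' + of_int j * \<Lambda>) \<in> K"
      using r[of "(s + of_int i * \<Lambda>, s' + of_int j * \<Lambda>)"] n by (auto simp: param_shift)
    then have "\<bar>s + of_int i * \<Lambda> - (s' + of_int j * \<Lambda>)\<bar> < e"
      using i j by (auto simp: K_def algebra_simps abs_le_iff)
    then show "\<exists>m::int. \<bar>s + of_int m * \<Lambda> - s'\<bar> < e"
      by (intro exI[of _ "i - j"]) (simp add: algebra_simps)
  qed fact
qed

text \<open>Parameters are chosen within a quarter period of \<open>s0\<close>. Two such choices
  cannot differ by a nonzero multiple of the period, so \<open>param_near\<close> makes the choice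
  continuous.\<close>

lemma local_lift:
  fixes x :: "real \<Rightarrow> 'a"
  assumes x: "continuous_on UNIV x" "range x \<subseteq> M" and t0: "x t0 = \<gamma> s0"
  obtains \<rho> \<sigma> where "\<rho> > 0" "\<sigma> t0 = s0" "\<And>t. \<bar>t - t0\<bar> < \<rho> \<Longrightarrow> \<gamma> (\<sigma> t) = x t \<and> isCont \<sigma> t"
proof -
  have "\<Lambda> / 4 > 0" using period_pos by simp
  then obtain r where "r > 0" and r: "\<And>s s'. norm (\<gamma> s - \<gamma> s') < r \<Longrightarrow> \<exists>m::int. \<bar>s + of_int m * \<Lambda> - s'\<bar> < \<Lambda> / 4"
    using param_near by metis
  have ct: "isCont x t" for t using x(1) by (simp add: continuous_on_eq_continuous_at)
  obtain \<rho> where "\<rho> > 0" and \<rho>: "\<And>t. \<bar>t - t0\<bar> < \<rho> \<Longrightarrow> norm (x t - x t0) < r"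
    using ct[of t0] \<open>r > 0\<close> unfolding continuous_at_eps_delta dist_norm real_norm_def by blast
  have "\<exists>s. \<gamma> s = x t \<and> \<bar>s - s0\<bar> < \<Lambda> / 4" if t: "\<bar>t - t0\<bar> < \<rho>" for t
  proof -
    obtain s where s: "x t = \<gamma> s" using x(2) param_range by blast
    then obtain m :: int where "\<bar>s + of_int m * \<Lambda> - s0\<bar> < \<Lambda> / 4" using r[of s s0] \<rho>[OF t] t0 by auto
    then show ?thesis using s by (intro exI[of _ "s + of_int m * \<Lambda>"]) (simp add: param_shift)
  qed
  then obtain \<sigma> where \<sigma>: "\<And>t. \<bar>t - t0\<bar> < \<rho> \<Longrightarrow> \<gamma> (\<sigma> t) = x t" "\<And>t. \<bar>t - t0\<bar> < \<rho> \<Longrightarrow> \<bar>\<sigma> t - s0\<bar> < \<Lambda> / 4"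
    by metis
  have s0: "\<sigma> t0 = s0"
  proof -
    obtain m :: int where m: "\<sigma> t0 = s0 + of_int m * \<Lambda>" using \<sigma>(1)[of t0] \<open>\<rho> > 0\<close> t0 param_eq_iff by auto
    then have "\<bar>of_int m * \<Lambda>\<bar> < \<Lambda>" using \<sigma>(2)[of t0] \<open>\<rho> > 0\<close> period_pos by auto
    then show ?thesis using m small_shift_zero by fastforce
  qed
  have "isCont \<sigma> t1" if t1: "\<bar>t1 - t0\<bar> < \<rho>" for t1
    unfolding continuous_at_eps_delta
  proof (intro allI impI)
    fix e :: real assume "e > 0"
    define e' where "e' = min e (\<Lambda> / 4)"
    have "e' > 0" "e' \<le> e" "e' \<le> \<Lambda> / 4" using \<open>e > 0\<close> period_pos by (auto simp: e'_def)
    obtain r' where "r' > 0" and r': "\<And>s s'. norm (\<gamma> s - \<gamma> s') < r' \<Longrightarrow> \<exists>m::int. \<bar>s + of_int m * \<Lambda> - s'\<bar> < e'"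
      using param_near[OF \<open>e' > 0\<close>] by metis
    obtain d where "d > 0" and d: "\<And>t. \<bar>t - t1\<bar> < d \<Longrightarrow> norm (x t - x t1) < r'"
      using ct[of t1] \<open>r' > 0\<close> unfolding continuous_at_eps_delta dist_norm real_norm_def by blast
    show "\<exists>d>0. \<forall>t. dist t t1 < d \<longrightarrow> dist (\<sigma> t) (\<sigma> t1) < e"
    proof (intro exI[of _ "min d (\<rho> - \<bar>t1 - t0\<bar>)"] conjI allI impI)
      fix t assume "dist t t1 < min d (\<rho> - \<bar>t1 - t0\<bar>)"
      then have t: "\<bar>t - t1\<bar> < d" "\<bar>t - t0\<bar> < \<rho>" by (auto simp: dist_real_def)
      obtain m :: int where m: "\<bar>\<sigma> t + of_int m * \<Lambda> - \<sigma> t1\<bar> < e'"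
        using r'[of "\<sigma> t" "\<sigma> t1"] d[OF t(1)] \<sigma>(1)[OF t(2)] \<sigma>(1)[OF t1] by auto
      then have "\<bar>of_int m * \<Lambda>\<bar> < \<Lambda>" using \<sigma>(2)[OF t(2)] \<sigma>(2)[OF t1] \<open>e' \<le> \<Lambda> / 4\<close> by linarith
      then have "m = 0" by (rule small_shift_zero)
      then show "dist (\<sigma> t) (\<sigma> t1) < e" using m \<open>e' \<le> e\<close> by (simp add: dist_real_def)
    qed (use \<open>d > 0\<close> t1 in auto)
  qed
  then show thesis using that[of \<rho> \<sigma>] \<open>\<rho> > 0\<close> s0 \<sigma>(1) by blast
qed

text \<open>The lift is only continuous. The Caratheodory factor \<open>g\<close> of the tangential
  coordinate of \<open>\<gamma>\<close> tends to 1 along the lift, and dividing by it transfers the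
  derivative of the path to the lift; the chain rule then shows that the velocity is
  tangent.\<close>

lemma lift_derivative:
  fixes x :: "real \<Rightarrow> 'a"
  assumes x: "(x has_vector_derivative v) (at t0)" and "\<rho> > 0"
    and \<sigma>: "isCont \<sigma> t0" "\<And>t. \<bar>t - t0\<bar> < \<rho> \<Longrightarrow> \<gamma> (\<sigma> t) = x t"
  shows "(\<sigma> has_real_derivative (v \<bullet> velocity \<gamma> (\<sigma> t0))) (at t0)"
    and "v = (v \<bullet> velocity \<gamma> (\<sigma> t0)) *\<^sub>R velocity \<gamma> (\<sigma> t0)"
proof -
  define \<tau> where "\<tau> = velocity \<gamma> (\<sigma> t0)"
  define c where "c = v \<bullet> \<tau>"
  have \<tau>\<tau>: "\<tau> \<bullet> \<tau> = 1" using norm_velocity by (simp add: \<tau>_def dot_square_norm)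
  have "((\<lambda>s. (\<gamma> s - \<gamma> (\<sigma> t0)) \<bullet> \<tau>) has_vector_derivative \<tau> \<bullet> \<tau>) (at (\<sigma> t0))"
    using param_derivative[of "\<sigma> t0"]
    by (intro bounded_linear.has_vector_derivative[OF bounded_linear_inner_left]) (auto intro!: derivative_eq_intros simp: \<tau>_def)
  then have "((\<lambda>s. (\<gamma> s - \<gamma> (\<sigma> t0)) \<bullet> \<tau>) has_real_derivative 1) (at (\<sigma> t0))"
    by (simp add: has_real_derivative_iff_has_vector_derivative \<tau>\<tau>)
  then obtain g where g: "\<And>z. (\<gamma> z - \<gamma> (\<sigma> t0)) \<bullet> \<tau> = g z * (z - \<sigma> t0)" "isCont g (\<sigma> t0)" "g (\<sigma> t0) = 1"
    using CARAT_DERIV[of "\<lambda>s. (\<gamma> s - \<gamma> (\<sigma> t0)) \<bullet> \<tau>" 1 "\<sigma> t0"] by auto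
  have gs: "((\<lambda>t. g (\<sigma> t)) \<longlongrightarrow> 1) (at t0)"
    using isCont_o2[OF \<sigma>(1) g(2)] g(3) by (simp add: isCont_def)
  have "((\<lambda>t. x t \<bullet> \<tau>) has_vector_derivative c) (at t0)"
    unfolding c_def by (intro bounded_linear.has_vector_derivative[OF bounded_linear_inner_left] x)
  then have "((\<lambda>t. (x t \<bullet> \<tau> - x t0 \<bullet> \<tau>) / (t - t0)) \<longlongrightarrow> c) (at t0)"
    by (simp add: has_real_derivative_iff_has_vector_derivative[symmetric] has_field_derivative_iff)
  from tendsto_divide[OF this gs] have lim: "((\<lambda>t. (x t \<bullet> \<tau> - x t0 \<bullet> \<tau>) / (t - t0) / g (\<sigma> t)) \<longlongrightarrow> c) (at t0)" by simp
  have ev1: "\<forall>\<^sub>F t in at t0. g (\<sigma> t) \<noteq> 0"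
    using gs by (rule tendsto_imp_eventually_ne) simp
  have ev2: "\<forall>\<^sub>F t in at t0. \<bar>t - t0\<bar> < \<rho>"
    using eventually_at_ball[OF \<open>\<rho> > 0\<close>, of t0 UNIV] by (auto simp: dist_real_def abs_minus_commute elim: eventually_mono)
  have "\<forall>\<^sub>F t in at t0. (x t \<bullet> \<tau> - x t0 \<bullet> \<tau>) / (t - t0) / g (\<sigma> t) = (\<sigma> t - \<sigma> t0) / (t - t0)"
    using ev1 ev2
  proof eventually_elim
    case (elim t)
    have "x t \<bullet> \<tau> - x t0 \<bullet> \<tau> = (\<gamma> (\<sigma> t) - \<gamma> (\<sigma> t0)) \<bullet> \<tau>"
      using \<sigma>(2)[OF elim(2)] \<sigma>(2)[of t0] \<open>\<rho> > 0\<close> by (simp add: inner_diff_left)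
    then show ?case using elim(1) g(1)[of "\<sigma> t"] by simp
  qed
  with lim have "((\<lambda>t. (\<sigma> t - \<sigma> t0) / (t - t0)) \<longlongrightarrow> c) (at t0)"
    by (rule Lim_transform_eventually)
  then have D: "(\<sigma> has_real_derivative c) (at t0)" by (simp add: has_field_derivative_iff)
  then show "(\<sigma> has_real_derivative (v \<bullet> velocity \<gamma> (\<sigma> t0))) (at t0)" by (simp add: c_def \<tau>_def)
  have "((\<gamma> \<circ> \<sigma>) has_vector_derivative c *\<^sub>R \<tau>) (at t0)"
    using D param_derivative unfolding \<tau>_def has_real_derivative_iff_has_vector_derivative
    by (intro vector_diff_chain_at) auto
  then have "(x has_vector_derivative c *\<^sub>R \<tau>) (at t0)"
    by (rule has_vector_derivative_transform_within[OF _ \<open>\<rho> > 0\<close>]) (use \<sigma>(2) in \<open>auto simp: dist_real_def\<close>)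
  then show "v = (v \<bullet> velocity \<gamma> (\<sigma> t0)) *\<^sub>R velocity \<gamma> (\<sigma> t0)"
    using x vector_derivative_unique_at by (auto simp: c_def \<tau>_def)
qed

text \<open>The flow line through the point stays on the curve, so its velocity at time 0 is tangent
  by \<open>lift_derivative\<close>.\<close>

lemma invariant_tangent:
  assumes "invariant_under_flow F M"
  shows "F (\<gamma> s) = b_pert F \<gamma> s *\<^sub>R velocity \<gamma> s"
proof -
  have "\<gamma> s \<in> M" using param_range by blast
  then obtain x where x: "is_solution F UNIV x" "x 0 = \<gamma> s" "range x \<subseteq> M"
    using assms by (auto simp: invariant_under_flow_def)
  have der: "(x has_vector_derivative F (x t)) (at t)" for t using x(1) by (simp add: is_solution_def)
  have "continuous_on UNIV x"
    by (intro continuous_at_imp_continuous_on ballI has_vector_derivative_continuous[OF der])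
  then obtain \<rho> \<sigma> where \<rho>: "\<rho> > 0" "\<sigma> 0 = s" "\<And>t. \<bar>t - 0\<bar> < \<rho> \<Longrightarrow> \<gamma> (\<sigma> t) = x t \<and> isCont \<sigma> t"
    using local_lift[OF _ x(3,2)] by blast
  show ?thesis
    using lift_derivative(2)[OF der[of 0] \<rho>(1), of \<sigma>] \<rho> x(2) by (simp add: b_pert_def)
qed

text \<open>With \<open>S\<close> the arc length of \<open>\<zeta>\<close>, the set where
  \<open>\<gamma>\<close> composed with \<open>S\<close> equals \<open>\<zeta>\<close> is closed and
  nonempty. It is open because a local lift has the same derivative as \<open>S\<close>; the
  orientation hypothesis fixes the sign of that derivative.\<close>

lemma reparametrization:
  fixes \<zeta> :: "real \<Rightarrow> 'a"
  assumes \<zeta>: "C_class (Suc 0) \<zeta>" "range \<zeta> \<subseteq> M" 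
    and orient: "\<And>\<theta> s. \<zeta> \<theta> = \<gamma> s \<Longrightarrow> velocity \<zeta> \<theta> \<bullet> velocity \<gamma> s > 0"
    and init: "\<zeta> \<theta>0 = \<gamma> s0"
  obtains S where "S \<theta>0 = s0" "\<And>\<theta>. (S has_real_derivative norm (velocity \<zeta> \<theta>)) (at \<theta>)"
    "\<And>\<theta>. \<gamma> (S \<theta>) = \<zeta> \<theta>" "\<And>\<theta>. velocity \<zeta> \<theta> = norm (velocity \<zeta> \<theta>) *\<^sub>R velocity \<gamma> (S \<theta>)"
proof -
  have der: "(\<zeta> has_vector_derivative velocity \<zeta> \<theta>) (at \<theta>)" for \<theta> using C_class_velocity(1)[OF \<zeta>(1)] .
  have c\<zeta>: "continuous_on UNIV \<zeta>"
    by (intro continuous_at_imp_continuous_on ballI has_vector_derivative_continuous[OF der])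
  have "continuous_on UNIV (\<lambda>\<theta>. norm (velocity \<zeta> \<theta>))"
    using C_class_velocity(2)[OF \<zeta>(1)] by (intro continuous_intros) simp
  then obtain S where S: "S \<theta>0 = s0" "\<And>\<theta>. (S has_real_derivative norm (velocity \<zeta> \<theta>)) (at \<theta>)"
    by (rule antiderivative_exists[where a = \<theta>0 and c = s0]) blast
  have cS: "continuous_on UNIV S" using S(2) by (meson DERIV_isCont continuous_at_imp_continuous_on)
  have dirs: "(\<sigma> has_real_derivative norm (velocity \<zeta> t)) (at t) \<and> velocity \<zeta> t = norm (velocity \<zeta> t) *\<^sub>R velocity \<gamma> (\<sigma> t)"
    if "\<rho> > 0" "isCont \<sigma> t" "\<And>t'. \<bar>t' - t\<bar> < \<rho> \<Longrightarrow> \<gamma> (\<sigma> t') = \<zeta> t'" for \<rho> \<sigma> t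
  proof -
    define c where "c = velocity \<zeta> t \<bullet> velocity \<gamma> (\<sigma> t)"
    have D: "(\<sigma> has_real_derivative c) (at t)" and v: "velocity \<zeta> t = c *\<^sub>R velocity \<gamma> (\<sigma> t)"
      using lift_derivative[OF der that] by (simp_all add: c_def)
    have "c > 0" unfolding c_def using that using that(1) that(3)[of t] by (intro orient) simp
    then have "norm (velocity \<zeta> t) = c" using norm_velocity by (subst v) simp
    then show ?thesis using D v by simp
  qed
  define Z where "Z = {\<theta>. \<gamma> (S \<theta>) = \<zeta> \<theta>}"
  have "closed Z"
    unfolding Z_def by (intro closed_Collect_eq c\<zeta> continuous_on_compose2[OF param_continuous[of UNIV] cS]) auto
  moreover have "open Z"
    unfolding open_dist
  proof
    fix \<theta>1 assume "\<theta>1 \<in> Z"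
    then have "\<zeta> \<theta>1 = \<gamma> (S \<theta>1)" by (simp add: Z_def)
    then obtain \<rho> \<sigma> where \<rho>: "\<rho> > 0" "\<sigma> \<theta>1 = S \<theta>1" "\<And>t. \<bar>t - \<theta>1\<bar> < \<rho> \<Longrightarrow> \<gamma> (\<sigma> t) = \<zeta> t \<and> isCont \<sigma> t"
      using local_lift[OF c\<zeta> \<zeta>(2)] by blast
    have d0: "((\<lambda>t. \<sigma> t - S t) has_real_derivative 0) (at t)" if t: "\<bar>t - \<theta>1\<bar> < \<rho>" for t
    proof -
      have "(\<sigma> has_real_derivative norm (velocity \<zeta> t)) (at t)"
      proof (rule dirs[THEN conjunct1, of "\<rho> - \<bar>t - \<theta>1\<bar>"])
        show "isCont \<sigma> t" using \<rho>(3) t by blast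
        show "\<gamma> (\<sigma> t') = \<zeta> t'" if "\<bar>t' - t\<bar> < \<rho> - \<bar>t - \<theta>1\<bar>" for t'
          using \<rho>(3)[of t'] that by linarith
      qed (use t in simp)
      then show ?thesis using DERIV_diff[OF _ S(2)] by fastforce
    qed
    have "\<exists>c. \<forall>t\<in>ball \<theta>1 \<rho>. \<sigma> t - S t = c"
    proof (rule has_field_derivative_zero_constant)
      show "((\<lambda>t. \<sigma> t - S t) has_real_derivative 0) (at t within ball \<theta>1 \<rho>)" if "t \<in> ball \<theta>1 \<rho>" for t
        using d0[of t] that by (auto simp: dist_real_def abs_minus_commute intro: has_field_derivative_at_within)
    qed simp
    then obtain c where c: "\<sigma> t - S t = c" if "\<bar>t - \<theta>1\<bar> < \<rho>" for t
      by (auto simp: dist_real_def abs_minus_commute)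
    have "c = 0" using c[of \<theta>1] \<rho>(1,2) by simp
    then have "\<sigma> t = S t" if "\<bar>t - \<theta>1\<bar> < \<rho>" for t using c[OF that] by simp
    then have "t \<in> Z" if "\<bar>t - \<theta>1\<bar> < \<rho>" for t
      using that \<rho>(3)[of t] unfolding Z_def by simp
    then show "\<exists>e>0. \<forall>t. dist t \<theta>1 < e \<longrightarrow> t \<in> Z" using \<rho>(1) by (auto simp: dist_real_def)
  qed
  moreover have "\<theta>0 \<in> Z" using S(1) init by (simp add: Z_def)
  ultimately have "Z = UNIV" using clopen[of Z] by blast
  then have Z: "\<gamma> (S \<theta>) = \<zeta> \<theta>" for \<theta> by (auto simp: Z_def)
  have "velocity \<zeta> \<theta> = norm (velocity \<zeta> \<theta>) *\<^sub>R velocity \<gamma> (S \<theta>)" for \<theta>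
    by (rule dirs[of 1 \<theta> S, THEN conjunct2]) (rule zero_less_one DERIV_isCont[OF S(2)] Z)+
  then show thesis using that S Z by blast
qed

end

section \<open>One-dimensional drifts\<close>

text \<open>
  Of the two zeros \<open>0\<close> and \<open>-2b\<close> of the Hamiltonian \<open>p b + p\<^sup>2/2\<close>, the one whose primitive grows away
  from \<open>a\<close>.
\<close>

definition cut_drift :: "(real \<Rightarrow> real) \<Rightarrow> real \<Rightarrow> real \<Rightarrow> real" where
  "cut_drift b a x = (if a \<le> x then 2 * max (- b x) 0 else - 2 * max (b x) 0)"

lemma cut_drift_mult: "cut_drift b a x * b x = - (cut_drift b a x)\<^sup>2 / 2"
  by (auto simp: cut_drift_def max_def power2_eq_square)

lemma abs_cut_drift_le: "\<bar>cut_drift b a x\<bar> \<le> 2 * \<bar>b x\<bar>"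
  by (auto simp: cut_drift_def)

text \<open>Fenchel inequality between the Lagrangian and its Hamiltonian, which vanishes at
  \<open>cut_drift\<close> by \<open>cut_drift_mult\<close>.\<close>

lemma cut_drift_young: "cut_drift b a x * y \<le> (y - b x)\<^sup>2 / 2"
proof -
  have "0 \<le> (y - b x - cut_drift b a x)\<^sup>2" by simp
  then show ?thesis using cut_drift_mult[of b a x] by (simp add: power2_eq_square algebra_simps)
qed

text \<open>The two branches meet at \<open>a\<close> because \<open>b a = 0\<close>.\<close>

lemma continuous_cut_drift:
  assumes b: "continuous_on UNIV b" and "b a = 0"
  shows "continuous_on UNIV (cut_drift b a)"
proof -
  have "continuous_on ({a..} \<union> {..a}) (\<lambda>x. if a \<le> x then 2 * max (- b x) 0 else - 2 * max (b x) 0)"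
    using assms by (intro continuous_on_If continuous_intros) (auto intro: continuous_on_subset[OF b] simp: not_le)
  moreover have "{a..} \<union> {..a} = (UNIV :: real set)" by auto
  ultimately show ?thesis by (simp add: cut_drift_def[abs_def])
qed

section \<open>Primitive of the cut drift and nearly optimal sweeps\<close>

locale drift =
  fixes b :: "real \<Rightarrow> real" and a \<beta> :: real and B :: "real \<Rightarrow> real"
  assumes b_cont: "continuous_on UNIV b" and b_zero: "b a = 0" and b_bound: "\<And>x. \<bar>b x\<bar> \<le> \<beta>"
    and B_zero: "B a = 0" and B_deriv: "\<And>x. (B has_real_derivative cut_drift b a x) (at x)"
begin

lemma B_lipschitz: "\<bar>B x - B y\<bar> \<le> 2 * \<beta> * \<bar>x - y\<bar>"
proof -
  have "norm (B x - B y) \<le> (2 * \<beta>) * norm (x - y)"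
  proof (rule field_differentiable_bound[where S = UNIV])
    show "norm (cut_drift b a z) \<le> 2 * \<beta>" for z
      using abs_cut_drift_le[of b a z] b_bound[of z] by simp
  qed (use B_deriv in auto)
  then show ?thesis by simp
qed

lemma B_nonneg: "B x \<ge> 0"
proof (cases "a \<le> x")
  case True
  have "B a \<le> B x"
    by (rule DERIV_nonneg_imp_nondecreasing[OF True]) (use B_deriv in \<open>force simp: cut_drift_def\<close>)
  then show ?thesis by (simp add: B_zero)
next
  case False
  have "B a \<le> B x"
  proof (rule DERIV_nonpos_imp_nonincreasing[of x a])
    fix y assume "x \<le> y" "y \<le> a"
    have "cut_drift b a y \<le> 0" using b_zero \<open>y \<le> a\<close> by (cases "y = a") (auto simp: cut_drift_def)
    then show "\<exists>z. (B has_real_derivative z) (at y) \<and> z \<le> 0" using B_deriv by blast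
  qed (use False in simp)
  then show ?thesis by (simp add: B_zero)
qed

text \<open>Solves the autonomous equation by separation of variables: \<open>\<tau>\<close> is a
  primitive of the reciprocal speed and \<open>\<psi>\<close> its inverse. The summand
  \<open>e\<close> prevents stalling at zeros of \<open>b\<close>, and the bound
  \<open>\<beta>\<close> on the drift makes \<open>\<tau>\<close> onto.\<close>

lemma clock:
  assumes "e > 0"
  obtains \<psi> :: "real \<Rightarrow> real" and \<tau> where "\<And>t. (\<psi> has_real_derivative \<bar>b (\<psi> t)\<bar> + e) (at t)"
    "\<And>x. \<psi> (\<tau> x) = x" "\<tau> z = 0" "strict_mono \<tau>" "strict_mono \<psi>"
proof -
  have \<beta>: "\<beta> \<ge> 0" using b_bound[of 0] by simp
  have be: "\<beta> + e > 0" using \<beta> \<open>e > 0\<close> by simp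
  have pos: "\<bar>b x\<bar> + e > 0" for x using \<open>e > 0\<close> by simp
  have "continuous_on UNIV (\<lambda>x. 1 / (\<bar>b x\<bar> + e))"
    using pos b_cont by (intro continuous_intros) (auto simp: less_imp_neq[symmetric])
  then obtain \<tau> where \<tau>: "\<tau> z = 0" "\<And>x. (\<tau> has_real_derivative 1 / (\<bar>b x\<bar> + e)) (at x)"
    by (rule antiderivative_exists[where a = z and c = 0]) blast
  have smono: "strict_mono \<tau>"
    unfolding strict_mono_def using DERIV_pos_imp_increasing[of _ _ \<tau>] \<tau>(2) pos by (metis divide_pos_pos zero_less_one)
  have growth: "(y - x) / (\<beta> + e) \<le> \<tau> y - \<tau> x" if xy: "x \<le> y" for x y
  proof -
    have "\<tau> x - x / (\<beta> + e) \<le> \<tau> y - y / (\<beta> + e)"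
    proof (rule DERIV_nonneg_imp_nondecreasing[OF xy])
      fix u
      have "((\<lambda>x. \<tau> x - x / (\<beta> + e)) has_real_derivative 1 / (\<bar>b u\<bar> + e) - 1 / (\<beta> + e)) (at u)"
        using be by (auto intro!: derivative_eq_intros \<tau>(2))
      moreover have "1 / (\<bar>b u\<bar> + e) \<ge> 1 / (\<beta> + e)"
        using b_bound[of u] \<open>e > 0\<close> by (intro divide_left_mono) (auto intro!: mult_pos_pos pos add_nonneg_pos \<beta>)
      ultimately show "\<exists>d. ((\<lambda>x. \<tau> x - x / (\<beta> + e)) has_real_derivative d) (at u) \<and> 0 \<le> d" by force
    qed
    then show ?thesis by (simp add: diff_divide_distrib)
  qed
  have c\<tau>: "isCont \<tau> x" for x using \<tau>(2) DERIV_isCont by blast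
  have surj: "\<exists>x. \<tau> x = t" for t
  proof -
    define m where "m = (\<beta> + e) * \<bar>t\<bar>"
    have m0: "m \<ge> 0" using be by (simp add: m_def)
    have "\<tau> (z + m) \<ge> \<bar>t\<bar>" using growth[of z "z + m"] m0 be \<tau>(1) by (simp add: m_def)
    moreover have "\<tau> (z - m) \<le> - \<bar>t\<bar>" using growth[of "z - m" z] m0 be \<tau>(1) by (simp add: m_def)
    ultimately have "\<tau> (z - m) \<le> t" "t \<le> \<tau> (z + m)" by linarith+
    then show ?thesis
      using IVT[of \<tau> "z - m" t "z + m"] c\<tau> m0 by auto
  qed
  define \<psi> where "\<psi> = inv \<tau>"
  have inj: "inj \<tau>" using smono strict_mono_imp_inj_on by blast
  have \<psi>\<tau>: "\<psi> (\<tau> x) = x" for x unfolding \<psi>_def using inj by simp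
  have \<tau>\<psi>: "\<tau> (\<psi> t) = t" for t unfolding \<psi>_def using surj by (metis f_inv_into_f rangeI)
  have "(\<psi> has_real_derivative \<bar>b (\<psi> t)\<bar> + e) (at t)" for t
  proof -
    have "isCont \<psi> (\<tau> (\<psi> t))"
      by (rule isCont_inverse_function[where d = 1]) (auto simp: \<psi>\<tau> c\<tau>)
    then have "isCont \<psi> t" by (simp add: \<tau>\<psi>)
    then have "(\<psi> has_real_derivative inverse (1 / (\<bar>b (\<psi> t)\<bar> + e))) (at t)"
      using pos[of "\<psi> t"] by (intro DERIV_inverse_function[where f = \<tau> and a = "t - 1" and b = "t + 1"] \<tau>(2)) (auto simp: \<tau>\<psi>)
    then show ?thesis by simp
  qed
  moreover have "strict_mono \<psi>"
    unfolding strict_mono_def using smono \<tau>\<psi> by (metis strict_mono_less)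
  ultimately show thesis using that \<psi>\<tau> \<tau>(1) smono by blast
qed

text \<open>With \<open>x\<close> the drift in the direction of motion, the right side is the rate
  at which \<open>B\<close> plus \<open>2 * e\<close> times the distance grows along a sweep away
  from \<open>a\<close> at speed \<open>\<bar>x\<bar> + e\<close>.\<close>

lemma sweep_cost:
  assumes "e \<ge> (0::real)"
  shows "(\<bar>x\<bar> + e - x)\<^sup>2 / 2 \<le> (2 * max (- x) 0 + 2 * e) * (\<bar>x\<bar> + e)"
proof (cases "x \<ge> 0")
  case True
  then have "x * e \<ge> 0" using assms by simp
  then show ?thesis using True assms by (simp add: power2_eq_square algebra_simps)
next
  case False
  then have "x * e \<le> 0" using assms by (simp add: mult_nonpos_nonneg)
  moreover have e1: "\<bar>x\<bar> + e - x = - 2 * x + e" and e2: "max (-x) 0 = - x" and e3: "\<bar>x\<bar> = - x" using False by auto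
  moreover have "e * e \<ge> 0" by simp
  moreover have "(- 2 * x + e)\<^sup>2 / 2 = 2 * (x * x) - 2 * (x * e) + e * e / 2"
    by (simp add: power2_eq_square field_simps)
  moreover have "(2 * - x + 2 * e) * (- x + e) = 2 * (x * x) - 4 * (x * e) + 2 * (e * e)"
    by (simp add: algebra_simps)
  ultimately show ?thesis unfolding e1 e2 unfolding e3 by linarith
qed

text \<open>The extra speed \<open>e\<close> makes the trip from \<open>a\<close> to
  \<open>y\<close> finite in time, across any zeros of \<open>b\<close>, and adds at most
  \<open>2 * e\<close> per unit of distance to the cost \<open>B y\<close>.\<close>

lemma sweep:
  assumes "y \<noteq> a" "e > 0"
  obtains T \<psi> \<psi>' where "T < 0" "\<psi> T = a" "\<psi> 0 = y" "\<And>t. (\<psi> has_real_derivative \<psi>' t) (at t)"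
    "\<And>t. \<bar>\<psi>' t\<bar> \<le> \<beta> + e"
    "(\<integral>\<^sup>+t\<in>{T..0}. ennreal ((\<psi>' t - b (\<psi> t))\<^sup>2 / 2) \<partial>lebesgue) \<le> ennreal (B y + 2 * e * \<bar>y - a\<bar>)"
proof -
  obtain \<eta> :: "real \<Rightarrow> real" and \<tau> where \<eta>: "\<And>t. (\<eta> has_real_derivative \<bar>b (\<eta> t)\<bar> + e) (at t)"
    "\<And>x. \<eta> (\<tau> x) = x" "\<tau> y = 0" "strict_mono \<tau>" "strict_mono \<eta>"
    using clock[OF \<open>e > 0\<close>, where z = y] by blast
  define s :: real where "s = (if a < y then 1 else - 1)"
  have ss: "s * s = 1" "\<bar>s\<bar> = 1" by (auto simp: s_def)
  \<comment> \<open>\<open>\<tau>\<close> vanishes at \<open>y\<close> and is increasing, so the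
    sign \<open>s\<close> makes this negative on either side of \<open>a\<close>.\<close>
  define T where "T = s * \<tau> a"
  define \<psi> where "\<psi> t = \<eta> (s * t)" for t
  define \<psi>' where "\<psi>' t = s * (\<bar>b (\<psi> t)\<bar> + e)" for t
  have T: "T < 0"
    using \<eta>(3,4) assms(1) strict_monoD[OF \<eta>(4), of a y] strict_monoD[OF \<eta>(4), of y a] by (auto simp: T_def s_def)
  have sT: "s * T = \<tau> a" using ss(1) by (simp add: T_def mult.assoc[symmetric])
  have \<psi>T: "\<psi> T = a" using sT by (simp add: \<psi>_def \<eta>(2))
  have \<psi>0: "\<psi> 0 = y" using \<eta>(2)[of y] \<eta>(3) by (simp add: \<psi>_def)
  have d\<psi>: "(\<psi> has_real_derivative \<psi>' t) (at t)" for t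
  proof -
    have "((\<lambda>t. s * t) has_real_derivative s) (at t)" by (auto intro!: derivative_eq_intros)
    from DERIV_chain2[OF \<eta>(1) this] show ?thesis
      unfolding \<psi>_def[abs_def] \<psi>'_def by (simp add: mult.commute)
  qed
  have bnd: "\<bar>\<psi>' t\<bar> \<le> \<beta> + e" for t
    using b_bound[of "\<psi> t"] \<open>e > 0\<close> ss by (simp add: \<psi>'_def abs_mult)
  define h where "h t = (cut_drift b a (\<psi> t) + 2 * s * e) * \<psi>' t" for t
  have side: "(\<psi>' t - b (\<psi> t))\<^sup>2 / 2 \<le> h t" if t: "t \<in> {T..0}" for t
  proof (cases "a < y")
    case True
    then have s: "s = 1" by (simp add: s_def)
    have "\<psi> T \<le> \<psi> t" using t \<eta>(5) by (simp add: \<psi>_def s strict_mono_less_eq)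
    then have "cut_drift b a (\<psi> t) = 2 * max (- b (\<psi> t)) 0" using \<psi>T by (simp add: cut_drift_def)
    then show ?thesis using sweep_cost[of e "b (\<psi> t)"] \<open>e > 0\<close> by (simp add: h_def \<psi>'_def s)
  next
    case False
    then have s: "s = - 1" by (simp add: s_def)
    have "\<psi> t \<le> \<psi> T" using t \<eta>(5) by (simp add: \<psi>_def s strict_mono_less_eq)
    then have "\<psi> t \<le> a" using \<psi>T by simp
    then have c: "cut_drift b a (\<psi> t) = - 2 * max (b (\<psi> t)) 0" using b_zero by (cases "\<psi> t = a") (auto simp: cut_drift_def)
    have "h t = (2 * max (b (\<psi> t)) 0 + 2 * e) * (\<bar>b (\<psi> t)\<bar> + e)"
      unfolding h_def \<psi>'_def c s by (simp add: algebra_simps)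
    moreover have "(\<psi>' t - b (\<psi> t))\<^sup>2 = (\<bar>b (\<psi> t)\<bar> + e + b (\<psi> t))\<^sup>2"
      unfolding \<psi>'_def s by (simp add: power2_eq_square algebra_simps)
    ultimately show ?thesis using sweep_cost[of e "- b (\<psi> t)"] \<open>e > 0\<close> by simp
  qed
  have "(h has_integral (B (\<psi> 0) + 2 * s * e * \<psi> 0) - (B (\<psi> T) + 2 * s * e * \<psi> T)) {T..0}"
  proof (rule fundamental_theorem_of_calculus)
    fix t
    have "((\<lambda>t. B (\<psi> t) + 2 * s * e * \<psi> t) has_real_derivative h t) (at t)"
      unfolding h_def distrib_right by (intro DERIV_add DERIV_chain2[OF B_deriv] DERIV_cmult d\<psi>)
    then show "((\<lambda>t. B (\<psi> t) + 2 * s * e * \<psi> t) has_vector_derivative h t) (at t within {T..0})"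
      by (simp add: has_real_derivative_iff_has_vector_derivative has_vector_derivative_at_within)
  qed (use T in simp)
  moreover have "s * (y - a) = \<bar>y - a\<bar>" by (auto simp: s_def)
  then have "2 * s * e * y - 2 * s * e * a = 2 * e * \<bar>y - a\<bar>" by (metis mult.assoc mult.left_commute right_diff_distrib)
  ultimately have I: "(h has_integral B y + 2 * e * \<bar>y - a\<bar>) {T..0}"
    by (simp add: \<psi>0 \<psi>T B_zero algebra_simps)
  define h1 where "h1 t = (if t \<in> {T..0} then h t else 0)" for t
  have "(h1 has_integral B y + 2 * e * \<bar>y - a\<bar>) UNIV"
    using I unfolding h1_def by (simp only: has_integral_restrict_UNIV)
  moreover have "h1 t \<ge> 0" for t
  proof (cases "t \<in> {T..0}")
    case True
    have "0 \<le> (\<psi>' t - b (\<psi> t))\<^sup>2 / 2" by simp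
    also have "\<dots> \<le> h t" by (rule side[OF True])
    finally show ?thesis using True by (simp add: h1_def)
  qed (auto simp: h1_def)
  ultimately have "integral\<^sup>N lebesgue h1 = ennreal (B y + 2 * e * \<bar>y - a\<bar>)"
    using has_integral_iff_nn_integral_lebesgue by blast
  moreover have "(\<integral>\<^sup>+t\<in>{T..0}. ennreal ((\<psi>' t - b (\<psi> t))\<^sup>2 / 2) \<partial>lebesgue) \<le> integral\<^sup>N lebesgue h1"
    using side by (intro nn_integral_mono) (auto simp: h1_def indicator_def ennreal_leI)
  ultimately have cost: "(\<integral>\<^sup>+t\<in>{T..0}. ennreal ((\<psi>' t - b (\<psi> t))\<^sup>2 / 2) \<partial>lebesgue) \<le> ennreal (B y + 2 * e * \<bar>y - a\<bar>)"
    by simp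
  show thesis by (rule that[OF T \<psi>T \<psi>0 d\<psi> bnd cost])
qed

lemma lipschitz_of_bounded_derivative:
  assumes "\<And>t. (\<psi> has_real_derivative \<psi>' t) (at t)" "\<And>t. \<bar>\<psi>' t\<bar> \<le> C"
  shows "\<bar>\<psi> x - \<psi> y\<bar> \<le> C * \<bar>x - y\<bar>"
  using field_differentiable_bound[of UNIV \<psi> \<psi>' C x y] assms by simp

text \<open>End points count modulo the period, hence the free \<open>m\<close>. The case
  \<open>y = a\<close> is separate because a sweep needs a positive distance; there the constant
  path is free.\<close>

lemma circle_quasipotential_le:
  "circle_quasipotential \<Lambda> b a (y + of_int m * \<Lambda>) \<le> ennreal (B y)"
proof (cases "y = a")
  case True
  have "circle_quasipotential \<Lambda> b a (y + of_int m * \<Lambda>) \<le> action b (-1) (\<lambda>t. a)"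
    unfolding circle_quasipotential_def
  proof (rule Inf_lower, clarify, intro exI conjI)
    show "abs_continuous (-1) 0 (\<lambda>t. a)" by (rule abs_continuous_lipschitz[where C = 0]) simp
    show "a = a + of_int 0 * \<Lambda>" by simp
    show "a = y + of_int m * \<Lambda> + of_int (- m) * \<Lambda>" using True by simp
  qed auto
  also have "action b (-1) (\<lambda>t. a) = 0"
    by (simp add: action_def b_zero)
  finally show ?thesis using B_nonneg by simp
next
  case False
  show ?thesis
  proof (rule ennreal_le_epsilon)
    fix \<epsilon> :: real assume "\<epsilon> > 0"
    \<comment> \<open>Spreads the allowance \<open>\<epsilon>\<close> over the distance, matching
      the surcharge in \<open>sweep\<close>.\<close>
    define e where "e = \<epsilon> / (2 * \<bar>y - a\<bar>)"
    have e: "e > 0" "2 * e * \<bar>y - a\<bar> = \<epsilon>" using False \<open>\<epsilon> > 0\<close> by (auto simp: e_def)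
    obtain T \<psi> \<psi>' where \<psi>: "T < 0" "\<psi> T = a" "\<psi> 0 = y" "\<And>t. (\<psi> has_real_derivative \<psi>' t) (at t)"
      "\<And>t. \<bar>\<psi>' t\<bar> \<le> \<beta> + e"
      "(\<integral>\<^sup>+t\<in>{T..0}. ennreal ((\<psi>' t - b (\<psi> t))\<^sup>2 / 2) \<partial>lebesgue) \<le> ennreal (B y + 2 * e * \<bar>y - a\<bar>)"
      using sweep[OF False e(1)] by blast
    have "circle_quasipotential \<Lambda> b a (y + of_int m * \<Lambda>) \<le> action b T \<psi>"
      unfolding circle_quasipotential_def
    proof (rule Inf_lower, clarify, intro exI conjI)
      show "abs_continuous T 0 \<psi>"
        using lipschitz_of_bounded_derivative[OF \<psi>(4,5)] by (intro abs_continuous_lipschitz[where C = "\<beta> + e"]) simp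
      show "\<psi> T = a + of_int 0 * \<Lambda>" using \<psi> by simp
      show "\<psi> 0 = y + of_int m * \<Lambda> + of_int (- m) * \<Lambda>" using \<psi> by simp
    qed (use \<psi> in auto)
    also have "action b T \<psi> = (\<integral>\<^sup>+t\<in>{T..0}. ennreal ((\<psi>' t - b (\<psi> t))\<^sup>2 / 2) \<partial>lebesgue)"
    proof -
      have "velocity \<psi> t = \<psi>' t" for t
        using \<psi>(4) by (intro vector_derivative_at) (simp add: has_real_derivative_iff_has_vector_derivative)
      then show ?thesis by (simp add: action_def)
    qed
    also have "\<dots> \<le> ennreal (B y) + ennreal \<epsilon>"
      using \<psi>(6) e B_nonneg \<open>\<epsilon> > 0\<close> by (simp add: ennreal_plus)
    finally show "circle_quasipotential \<Lambda> b a (y + of_int m * \<Lambda>) \<le> ennreal (B y) + ennreal \<epsilon>" .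
  qed
qed

text \<open>Composing a sweep with \<open>\<gamma>\<close> keeps its action: the field is tangent to
  the curve and \<open>\<gamma>\<close> has unit speed.\<close>

lemma quasipotential_le:
  fixes \<gamma> :: "real \<Rightarrow> 'a::euclidean_space"
  assumes der: "\<And>s. (\<gamma> has_vector_derivative \<gamma>' s) (at s)" and unit: "\<And>s. norm (\<gamma>' s) = 1"
    and F: "\<And>s. F (\<gamma> s) = b s *\<^sub>R \<gamma>' s"
  shows "quasipotential F (\<gamma> a) (\<gamma> y) \<le> ennreal (B y)"
proof (cases "y = a")
  case True
  have "quasipotential F (\<gamma> a) (\<gamma> y) \<le> action F (-1) (\<lambda>t. \<gamma> a)"
    unfolding quasipotential_def
  proof (rule Inf_lower, clarify, intro exI conjI)
    show "abs_continuous (-1) 0 (\<lambda>t. \<gamma> a)" by (rule abs_continuous_lipschitz[where C = 0]) simp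
    show "\<gamma> a = \<gamma> y" using True by simp
  qed auto
  also have "action F (-1) (\<lambda>t. \<gamma> a) = 0"
    by (simp add: action_def b_zero F)
  finally show ?thesis using B_nonneg by simp
next
  case False
  show ?thesis
  proof (rule ennreal_le_epsilon)
    fix \<epsilon> :: real assume "\<epsilon> > 0"
    define e where "e = \<epsilon> / (2 * \<bar>y - a\<bar>)"
    have e: "e > 0" "2 * e * \<bar>y - a\<bar> = \<epsilon>" using False \<open>\<epsilon> > 0\<close> by (auto simp: e_def)
    obtain T \<psi> \<psi>' where \<psi>: "T < 0" "\<psi> T = a" "\<psi> 0 = y" "\<And>t. (\<psi> has_real_derivative \<psi>' t) (at t)"
      "\<And>t. \<bar>\<psi>' t\<bar> \<le> \<beta> + e"
      "(\<integral>\<^sup>+t\<in>{T..0}. ennreal ((\<psi>' t - b (\<psi> t))\<^sup>2 / 2) \<partial>lebesgue) \<le> ennreal (B y + 2 * e * \<bar>y - a\<bar>)"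
      using sweep[OF False e(1)] by blast
    have \<gamma>l: "norm (\<gamma> u - \<gamma> v) \<le> \<bar>u - v\<bar>" for u v
    proof -
      have "norm (\<gamma> u - \<gamma> v) \<le> 1 * norm (u - v)"
      proof (rule differentiable_bound[where S = UNIV])
        show "(\<gamma> has_derivative (\<lambda>h. h *\<^sub>R \<gamma>' s)) (at s within UNIV)" for s
          using der by (simp add: has_vector_derivative_def)
        show "onorm (\<lambda>h. h *\<^sub>R \<gamma>' s) \<le> 1" for s
          by (rule onorm_le) (simp add: unit)
      qed auto
      then show ?thesis by simp
    qed
    have "quasipotential F (\<gamma> a) (\<gamma> y) \<le> action F T (\<gamma> \<circ> \<psi>)"
      unfolding quasipotential_def
    proof (rule Inf_lower, clarify, intro exI conjI)
      have "norm ((\<gamma> \<circ> \<psi>) u - (\<gamma> \<circ> \<psi>) v) \<le> (\<beta> + e) * \<bar>u - v\<bar>" for u v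
        using order_trans[OF \<gamma>l lipschitz_of_bounded_derivative[OF \<psi>(4,5)]] by simp
      then show "abs_continuous T 0 (\<gamma> \<circ> \<psi>)" by (rule abs_continuous_lipschitz)
    qed (use \<psi> in auto)
    also have "action F T (\<gamma> \<circ> \<psi>) = (\<integral>\<^sup>+t\<in>{T..0}. ennreal ((\<psi>' t - b (\<psi> t))\<^sup>2 / 2) \<partial>lebesgue)"
      unfolding action_def
    proof (intro nn_integral_cong arg_cong2[where f = "(*)"] refl arg_cong[where f = ennreal])
      fix t
      have "((\<gamma> \<circ> \<psi>) has_vector_derivative \<psi>' t *\<^sub>R \<gamma>' (\<psi> t)) (at t)"
        using \<psi>(4) der unfolding has_real_derivative_iff_has_vector_derivative by (rule vector_diff_chain_at)
      then have "vector_derivative (\<gamma> \<circ> \<psi>) (at t) - F ((\<gamma> \<circ> \<psi>) t) = (\<psi>' t - b (\<psi> t)) *\<^sub>R \<gamma>' (\<psi> t)"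
        by (simp add: vector_derivative_at F scaleR_left_diff_distrib)
      then show "(norm (vector_derivative (\<gamma> \<circ> \<psi>) (at t) - F ((\<gamma> \<circ> \<psi>) t)))\<^sup>2 / 2 = (\<psi>' t - b (\<psi> t))\<^sup>2 / 2"
        by (simp add: unit)
    qed
    also have "\<dots> \<le> ennreal (B y) + ennreal \<epsilon>"
      using \<psi>(6) e B_nonneg \<open>\<epsilon> > 0\<close> by (simp add: ennreal_plus)
    finally show "quasipotential F (\<gamma> a) (\<gamma> y) \<le> ennreal (B y) + ennreal \<epsilon>" .
  qed
qed

text \<open>\<open>B\<close> along the shifted path grows no faster than the Lagrangian, by
  \<open>cut_drift_young\<close>. The shift by \<open>c\<close> puts the start at \<open>a\<close>
  itself, where \<open>B\<close> is normalised, and leaves the drift unchanged by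
  periodicity.\<close>

lemma action_ge_drift:
  assumes per: "\<And>x. b (x + c) = b x" and Y: "abs_continuous T 0 Y" "T < 0" "Y T = a + c"
  shows "ennreal (B (Y 0 - c)) \<le> action b T Y"
proof (cases "action b T Y < \<infinity>")
  case True
  note fin = action_finite[OF Y(1) less_imp_le[OF Y(2)] b_cont True]
  define f where "f t = B (Y t - c)" for t
  have "abs_continuous T 0 f"
    by (rule abs_continuous_dominated[OF Y(1), where C = "2 * \<beta>"])
       (use B_lipschitz[of "Y _ - c" "Y _ - c"] in \<open>simp add: f_def\<close>)
  obtain N where N: "negligible N" "{T,0} \<subseteq> N" and der: "\<And>x. x \<in> {T..0} - N \<Longrightarrow> (Y has_vector_derivative vector_derivative Y (at x)) (at x)"
    using abs_continuous_vector_derivative_ae[OF Y(1)] by blast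
  have "f 0 - f T \<le> integral {T..0} (lagrangian b Y)"
  proof (rule abs_continuous_increment_le[OF \<open>abs_continuous T 0 f\<close> less_imp_le[OF Y(2)] fin(1) N(1)])
    fix t D assume t: "t \<in> {T<..<0} - N" and D: "(f has_real_derivative D) (at t)"
    define y where "y = vector_derivative Y (at t)"
    have "(Y has_real_derivative y) (at t)" using der[of t] t by (simp add: y_def has_real_derivative_iff_has_vector_derivative)
    then have "(f has_real_derivative cut_drift b a (Y t - c) * y) (at t)"
      unfolding f_def[abs_def] by (auto intro!: derivative_eq_intros DERIV_chain2[OF B_deriv])
    then have "D = cut_drift b a (Y t - c) * y" using D DERIV_unique by blast
    also have "\<dots> \<le> (y - b (Y t - c))\<^sup>2 / 2" by (rule cut_drift_young)
    also have "b (Y t - c) = b (Y t)" using per[of "Y t - c"] by simp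
    finally show "D \<le> lagrangian b Y t" by (simp add: lagrangian_def y_def)
  qed
  moreover have "f T = 0" using Y(3) B_zero by (simp add: f_def)
  ultimately show ?thesis using fin(2) by (simp add: f_def ennreal_leI)
qed (simp add: not_less top_unique)

end

section \<open>Calibration in a tube around a curve\<close>

locale tube =
  fixes q q1 q2 :: "real \<Rightarrow> 'a::euclidean_space" and \<kappa> :: real
  assumes q_deriv: "\<And>\<theta>. (q has_vector_derivative q1 \<theta>) (at \<theta>)"
    and q1_deriv: "\<And>\<theta>. (q1 has_vector_derivative q2 \<theta>) (at \<theta>)"
    and q1_unit: "\<And>\<theta>. norm (q1 \<theta>) = 1"
    and q2_bound: "\<And>\<theta>. norm (q2 \<theta>) \<le> \<kappa>" and \<kappa>_pos: "\<kappa> > 0"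
begin

text \<open>A zero in \<open>\<theta>\<close> says that \<open>x - q \<theta>\<close> is normal to
  the curve, that is, \<open>\<theta>\<close> is critical for the distance from \<open>x\<close>.
  This scalar equation takes the place of a nearest point projection.\<close>

definition foot :: "'a \<Rightarrow> real \<Rightarrow> real" where
  "foot x \<theta> = (x - q \<theta>) \<bullet> q1 \<theta>"

lemma lipschitz_of_derivative:
  fixes f :: "real \<Rightarrow> 'b::real_normed_vector"
  assumes "\<And>t. (f has_vector_derivative f' t) (at t)" "\<And>t. norm (f' t) \<le> C"
  shows "norm (f x - f y) \<le> C * \<bar>x - y\<bar>"
proof -
  have "norm (f x - f y) \<le> C * norm (x - y)"
  proof (rule differentiable_bound[where S = UNIV])
    show "(f has_derivative (\<lambda>h. h *\<^sub>R f' s)) (at s within UNIV)" for s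
      using assms(1) by (simp add: has_vector_derivative_def)
    show "onorm (\<lambda>h. h *\<^sub>R f' s) \<le> C" for s
      by (rule onorm_le) (use assms(2)[of s] in \<open>simp add: mult.commute[of C] mult_left_mono\<close>)
  qed auto
  then show ?thesis by simp
qed

lemma q_lipschitz: "norm (q \<theta> - q \<theta>') \<le> \<bar>\<theta> - \<theta>'\<bar>"
  using lipschitz_of_derivative[OF q_deriv, of 1 \<theta> \<theta>'] q1_unit by simp

lemma foot_deriv: "((\<lambda>\<theta>. foot x \<theta>) has_real_derivative (- 1 + (x - q \<theta>) \<bullet> q2 \<theta>)) (at \<theta>)"
proof -
  have "((\<lambda>\<theta>. (x - q \<theta>) \<bullet> q1 \<theta>) has_vector_derivative ((x - q \<theta>) \<bullet> q2 \<theta> + (- q1 \<theta>) \<bullet> q1 \<theta>)) (at \<theta>)"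
    by (rule bounded_bilinear.has_vector_derivative[OF bounded_bilinear_inner])
       (auto intro!: derivative_eq_intros q_deriv q1_deriv)
  moreover have "q1 \<theta> \<bullet> q1 \<theta> = 1" using q1_unit by (simp add: dot_square_norm)
  ultimately show ?thesis by (simp add: foot_def has_real_derivative_iff_has_vector_derivative)
qed

text \<open>Within distance \<open>1 / (2 * \<kappa>)\<close> of the curve the curvature term is at
  most 1/2, which leaves slope at most \<open>- 1/2\<close>.\<close>

lemma foot_decreasing:
  assumes "\<theta> \<le> \<theta>'" and near: "\<And>u. u \<in> {\<theta>..\<theta>'} \<Longrightarrow> norm (x - q u) \<le> 1 / (2 * \<kappa>)"
  shows "foot x \<theta>' \<le> foot x \<theta> - (\<theta>' - \<theta>) / 2"
proof -
  have "foot x \<theta>' + \<theta>' / 2 \<le> foot x \<theta> + \<theta> / 2"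
  proof (rule DERIV_nonpos_imp_nonincreasing[OF \<open>\<theta> \<le> \<theta>'\<close>])
    fix u assume u: "\<theta> \<le> u" "u \<le> \<theta>'"
    have "((\<lambda>\<theta>. foot x \<theta> + \<theta> / 2) has_real_derivative (- 1 + (x - q u) \<bullet> q2 u) + 1 / 2) (at u)"
      by (intro DERIV_add foot_deriv) (auto intro!: derivative_eq_intros)
    moreover have "(x - q u) \<bullet> q2 u \<le> 1 / 2"
    proof -
      have "(x - q u) \<bullet> q2 u \<le> norm (x - q u) * norm (q2 u)" by (rule norm_cauchy_schwarz)
      also have "\<dots> \<le> 1 / (2 * \<kappa>) * \<kappa>" using near[of u] u q2_bound \<kappa>_pos by (intro mult_mono) auto
      finally show ?thesis using \<kappa>_pos by simp
    qed
    ultimately show "\<exists>y. ((\<lambda>\<theta>. foot x \<theta> + \<theta> / 2) has_real_derivative y) (at u) \<and> y \<le> 0" by force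
  qed
  then show ?thesis by (simp add: field_simps)
qed

text \<open>Moving \<open>x\<close> to \<open>y\<close> changes \<open>foot\<close> by at most
  \<open>norm (x - y)\<close>, while \<open>foot\<close> falls at rate at least 1/2 in the
  parameter. With \<open>x = y\<close> this is uniqueness.\<close>

lemma foot_unique:
  assumes "foot x \<theta> = 0" "foot y \<theta>' = 0"
    and near: "\<And>u. u \<in> closed_segment \<theta> \<theta>' \<Longrightarrow> norm (y - q u) \<le> 1 / (2 * \<kappa>)"
  shows "\<bar>\<theta> - \<theta>'\<bar> \<le> 2 * norm (x - y)"
proof -
  have "\<bar>foot y \<theta> - foot x \<theta>\<bar> = \<bar>(y - x) \<bullet> q1 \<theta>\<bar>" by (simp add: foot_def inner_diff_left)
  also have "\<dots> \<le> norm (x - y)"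
    using Cauchy_Schwarz_ineq2[of "y - x" "q1 \<theta>"] q1_unit by (simp add: norm_minus_commute)
  finally have *: "\<bar>foot y \<theta>\<bar> \<le> norm (x - y)" using assms(1) by simp
  show ?thesis
  proof (cases "\<theta> \<le> \<theta>'")
    case True
    then have "foot y \<theta>' \<le> foot y \<theta> - (\<theta>' - \<theta>) / 2"
      using near by (intro foot_decreasing) (auto simp: closed_segment_eq_real_ivl)
    then show ?thesis using * assms(2) True by simp
  next
    case False
    then have "foot y \<theta> \<le> foot y \<theta>' - (\<theta> - \<theta>') / 2"
      using near by (intro foot_decreasing) (auto simp: closed_segment_eq_real_ivl)
    moreover have "\<bar>\<theta> - \<theta>'\<bar> = \<theta> - \<theta>'" using False by simp
    ultimately show ?thesis using abs_le_D2[OF *] assms(2) by (simp add: field_simps)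
  qed
qed

text \<open>The three distances add up to \<open>9 / (32 * \<kappa>)\<close>, inside the range where
  \<open>foot\<close> is decreasing.\<close>

lemma near_curve:
  assumes "norm (x0 - q \<theta>0) \<le> 1 / (8 * \<kappa>)" "norm (x - x0) \<le> 1 / (32 * \<kappa>)" "\<bar>u - \<theta>0\<bar> \<le> 1 / (8 * \<kappa>)"
  shows "norm (x - q u) \<le> 1 / (2 * \<kappa>)"
proof -
  have "norm (x - q u) \<le> norm (x - x0) + norm (x0 - q \<theta>0) + norm (q \<theta>0 - q u)"
    using norm_triangle_ineq[of "x - x0" "x0 - q u"] norm_triangle_ineq[of "x0 - q \<theta>0" "q \<theta>0 - q u"] by simp
  also have "\<dots> \<le> 1 / (32 * \<kappa>) + 1 / (8 * \<kappa>) + 1 / (8 * \<kappa>)"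
    using assms q_lipschitz[of \<theta>0 u] by (intro add_mono) (auto simp: abs_minus_commute)
  also have "\<dots> \<le> 1 / (2 * \<kappa>)" using \<kappa>_pos by (simp add: field_simps)
  finally show ?thesis .
qed

text \<open>At \<open>\<theta>0\<close> the value is at most \<open>1 / (32 * \<kappa>)\<close> in
  size, and moving by \<open>1 / (8 * \<kappa>)\<close> to either side changes it by at least
  \<open>1 / (16 * \<kappa>)\<close>, so it changes sign.\<close>

lemma foot_exists:
  assumes "norm (x0 - q \<theta>0) \<le> 1 / (8 * \<kappa>)" "norm (x - x0) \<le> 1 / (32 * \<kappa>)" "foot x0 \<theta>0 = 0"
  shows "\<exists>\<theta>. \<bar>\<theta> - \<theta>0\<bar> \<le> 1 / (8 * \<kappa>) \<and> foot x \<theta> = 0"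
proof -
  define d where "d = 1 / (8 * \<kappa>)"
  have d: "d > 0" using \<kappa>_pos by (simp add: d_def)
  have near: "norm (x - q u) \<le> 1 / (2 * \<kappa>)" if "\<bar>u - \<theta>0\<bar> \<le> d" for u
    using near_curve[OF assms(1,2)] that by (simp add: d_def)
  have "\<bar>foot x \<theta>0 - foot x0 \<theta>0\<bar> = \<bar>(x - x0) \<bullet> q1 \<theta>0\<bar>" by (simp add: foot_def inner_diff_left)
  also have "\<dots> \<le> norm (x - x0)"
    using Cauchy_Schwarz_ineq2[of "x - x0" "q1 \<theta>0"] q1_unit by simp
  also have "\<dots> \<le> d / 2" using assms(2) \<kappa>_pos by (simp add: d_def field_simps)
  finally have *: "\<bar>foot x \<theta>0\<bar> \<le> d / 2" using assms(3) by simp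
  have "foot x (\<theta>0 + d) \<le> foot x \<theta>0 - (\<theta>0 + d - \<theta>0) / 2"
    using d near by (intro foot_decreasing) auto
  then have 1: "foot x (\<theta>0 + d) \<le> 0" using * by simp
  have "foot x \<theta>0 \<le> foot x (\<theta>0 - d) - (\<theta>0 - (\<theta>0 - d)) / 2"
    using d near by (intro foot_decreasing) auto
  then have 2: "0 \<le> foot x (\<theta>0 - d)" using * by simp
  have "\<exists>\<theta>\<ge>\<theta>0 - d. \<theta> \<le> \<theta>0 + d \<and> foot x \<theta> = 0"
    using d DERIV_isCont[OF foot_deriv] by (intro IVT2 1 2) auto
  then obtain \<theta> where "\<theta>0 - d \<le> \<theta>" "\<theta> \<le> \<theta>0 + d" "foot x \<theta> = 0" by blast
  then show ?thesis unfolding d_def[symmetric] by (intro exI[of _ \<theta>]) (simp add: abs_le_iff)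
qed

text \<open>The selected feet depend on \<open>Y t\<close> with Lipschitz constant 2, so along an
  absolutely continuous path the foot parameter is absolutely continuous as well.\<close>

lemma foot_track:
  fixes Y :: "real \<Rightarrow> 'a"
  assumes "foot (Y t0) \<theta>0 = 0" "norm (Y t0 - q \<theta>0) \<le> 1 / (8 * \<kappa>)" "t0 \<in> I"
    and Y: "\<And>t. t \<in> I \<Longrightarrow> norm (Y t - Y t0) \<le> 1 / (32 * \<kappa>)"
  obtains \<eta> where "\<eta> t0 = \<theta>0" "\<And>t. t \<in> I \<Longrightarrow> foot (Y t) (\<eta> t) = 0"
    "\<And>t t'. t \<in> I \<Longrightarrow> t' \<in> I \<Longrightarrow> \<bar>\<eta> t - \<eta> t'\<bar> \<le> 2 * norm (Y t - Y t')"
proof -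
  have "\<exists>\<theta>. \<bar>\<theta> - \<theta>0\<bar> \<le> 1 / (8 * \<kappa>) \<and> foot (Y t) \<theta> = 0" if "t \<in> I" for t
    using foot_exists[OF assms(2) Y[OF that] assms(1)] .
  then obtain \<eta> where \<eta>: "\<And>t. t \<in> I \<Longrightarrow> \<bar>\<eta> t - \<theta>0\<bar> \<le> 1 / (8 * \<kappa>)" "\<And>t. t \<in> I \<Longrightarrow> foot (Y t) (\<eta> t) = 0"
    by metis
  have lip: "\<bar>\<theta> - \<theta>'\<bar> \<le> 2 * norm (Y t - Y t')" if "t \<in> I" "t' \<in> I" "\<bar>\<theta> - \<theta>0\<bar> \<le> 1 / (8 * \<kappa>)" "\<bar>\<theta>' - \<theta>0\<bar> \<le> 1 / (8 * \<kappa>)"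
    "foot (Y t) \<theta> = 0" "foot (Y t') \<theta>' = 0" for t t' \<theta> \<theta>'
  proof (rule foot_unique[OF that(5,6)])
    fix u assume "u \<in> closed_segment \<theta> \<theta>'"
    then have "\<bar>u - \<theta>0\<bar> \<le> 1 / (8 * \<kappa>)" using that(3,4) by (auto simp: closed_segment_eq_real_ivl split: if_splits)
    then show "norm (Y t' - q u) \<le> 1 / (2 * \<kappa>)" by (rule near_curve[OF assms(2) Y[OF that(2)]])
  qed
  show thesis
  proof (rule that)
    show "\<eta> t0 = \<theta>0"
      using lip[OF \<open>t0 \<in> I\<close> \<open>t0 \<in> I\<close> \<eta>(1)[OF \<open>t0 \<in> I\<close>] _ \<eta>(2)[OF \<open>t0 \<in> I\<close>] assms(1)] \<kappa>_pos by simp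
  qed (use \<eta> lip in auto)
qed

end

text \<open>\<open>s\<close> converts the parameter of the unperturbed curve into arc length on the
  perturbed one, with speed \<open>N0\<close>; \<open>r\<close> is the tube radius, and
  \<open>\<alpha>\<close> and \<open>K\<close> weight the tangential and normal parts of the
  potential.\<close>

locale calibrated_tube = tube q q1 q2 \<kappa> + drift b a \<beta> B
  for q q1 q2 :: "real \<Rightarrow> 'a::euclidean_space" and \<kappa> b a \<beta> B +
  fixes \<phi> \<phi>1 :: "real \<Rightarrow> 'a" and s N0 :: "real \<Rightarrow> real" and F :: "'a \<Rightarrow> 'a" and \<alpha> K r :: real
  \<comment> \<open>The vector on the left of \<open>calibration\<close> is the gradient of the function \<open>U\<close> below; its denominator
    comes from differentiating the equation \<open>foot x \<theta> = 0\<close>.\<close>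
  assumes \<phi>_deriv: "\<And>\<theta>. (\<phi> has_vector_derivative \<phi>1 \<theta>) (at \<theta>)"
    and \<phi>_normal: "\<And>\<theta>. \<phi> \<theta> \<bullet> q1 \<theta> = 0"
    and \<phi>_small: "\<And>\<theta>. norm (\<phi> \<theta>) \<le> 1 / (16 * \<kappa>)"
    and \<phi>1_small: "\<And>\<theta>. norm (\<phi>1 \<theta>) \<le> 1"
    and s_deriv: "\<And>\<theta>. (s has_real_derivative N0 \<theta>) (at \<theta>)" and N0_bound: "\<And>\<theta>. \<bar>N0 \<theta>\<bar> \<le> 2"
    and F_cont: "continuous_on UNIV F"
    and \<alpha>: "0 \<le> \<alpha>" "\<alpha> \<le> 1" and K: "K > 0" and r: "r > 0" "r \<le> 1 / (16 * \<kappa>)"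
    and calibration: "\<And>\<theta> w y. w \<bullet> q1 \<theta> = 0 \<Longrightarrow> norm w \<le> r \<Longrightarrow>
      (((\<alpha> * cut_drift b a (s \<theta>) * N0 \<theta> - 2 * K * (w \<bullet> \<phi>1 \<theta>)) / (1 - (\<phi> \<theta> + w) \<bullet> q2 \<theta>)) *\<^sub>R q1 \<theta> + (2 * K) *\<^sub>R w) \<bullet> y
      \<le> (norm (y - F (q \<theta> + \<phi> \<theta> + w)))\<^sup>2 / 2"
begin

abbreviation qt :: "real \<Rightarrow> 'a" where "qt \<theta> \<equiv> q \<theta> + \<phi> \<theta>"

definition U :: "'a \<Rightarrow> real \<Rightarrow> real" where
  "U x \<theta> = \<alpha> * B (s \<theta>) + K * (norm (x - qt \<theta>))\<^sup>2"

lemma qt_deriv: "(qt has_vector_derivative (q1 \<theta> + \<phi>1 \<theta>)) (at \<theta>)"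
  by (intro has_vector_derivative_add q_deriv \<phi>_deriv)

lemma qt_lipschitz: "norm (qt \<theta> - qt \<theta>') \<le> 2 * \<bar>\<theta> - \<theta>'\<bar>"
proof (rule lipschitz_of_derivative[OF qt_deriv])
  show "norm (q1 t + \<phi>1 t) \<le> 2" for t using norm_triangle_ineq[of "q1 t" "\<phi>1 t"] q1_unit[of t] \<phi>1_small[of t] by simp
qed

lemma s_lipschitz: "\<bar>s \<theta> - s \<theta>'\<bar> \<le> 2 * \<bar>\<theta> - \<theta>'\<bar>"
  using field_differentiable_bound[of UNIV s N0 2 \<theta> \<theta>'] s_deriv N0_bound by simp

lemma w_normal: "foot x \<theta> = 0 \<longleftrightarrow> (x - qt \<theta>) \<bullet> q1 \<theta> = 0"
  using \<phi>_normal[of \<theta>] by (simp add: foot_def inner_diff_left inner_add_left)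

text \<open>\<open>8 * \<beta>\<close> is the product of the Lipschitz constants
  \<open>2 * \<beta>\<close> of \<open>B\<close>, 2 of \<open>s\<close> and 2 of the foot. The
  displacement \<open>x - qt \<theta>\<close> has constant \<open>1 + 2 * 2 = 5\<close>, and
  squaring it inside the tube contributes the factor \<open>2 * r\<close>.\<close>

lemma U_lipschitz:
  assumes "\<bar>\<theta> - \<theta>'\<bar> \<le> 2 * norm (x - x')" "norm (x - qt \<theta>) \<le> r" "norm (x' - qt \<theta>') \<le> r"
  shows "\<bar>U x \<theta> - U x' \<theta>'\<bar> \<le> (8 * \<beta> + 10 * K * r) * norm (x - x')"
proof -
  define w w' where "w = x - qt \<theta>" and "w' = x' - qt \<theta>'"
  have \<beta>: "\<beta> \<ge> 0" using b_bound[of 0] by simp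
  have "\<bar>B (s \<theta>) - B (s \<theta>')\<bar> \<le> 2 * \<beta> * (2 * (2 * norm (x - x')))"
    using \<beta> assms(1) s_lipschitz[of \<theta> \<theta>'] by (intro order_trans[OF B_lipschitz] mult_left_mono) auto
  then have 1: "\<bar>\<alpha> * B (s \<theta>) - \<alpha> * B (s \<theta>')\<bar> \<le> 8 * \<beta> * norm (x - x')"
    using \<alpha> mult_left_le_one_le[of "\<bar>B (s \<theta>) - B (s \<theta>')\<bar>" \<alpha>]
    by (simp add: right_diff_distrib[symmetric] abs_mult)
  have "norm (w - w') \<le> norm (x - x') + norm (qt \<theta>' - qt \<theta>)"
    using norm_triangle_ineq[of "x - x'" "qt \<theta>' - qt \<theta>"] by (simp add: w_def w'_def algebra_simps)
  also have "norm (qt \<theta>' - qt \<theta>) \<le> 2 * (2 * norm (x - x'))"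
    using qt_lipschitz[of \<theta>' \<theta>] assms(1) by (simp add: abs_minus_commute)
  finally have ww: "norm (w - w') \<le> 5 * norm (x - x')" by simp
  have "\<bar>(norm w)\<^sup>2 - (norm w')\<^sup>2\<bar> = \<bar>norm w - norm w'\<bar> * (norm w + norm w')"
  proof -
    have "(norm w)\<^sup>2 - (norm w')\<^sup>2 = (norm w - norm w') * (norm w + norm w')"
      by (simp add: power2_eq_square algebra_simps)
    then show ?thesis by (simp add: abs_mult)
  qed
  also have "\<dots> \<le> (5 * norm (x - x')) * (r + r)"
    using ww norm_triangle_ineq3[of w w'] assms(2,3) by (intro mult_mono) (auto simp: w_def w'_def)
  finally have "K * \<bar>(norm w)\<^sup>2 - (norm w')\<^sup>2\<bar> \<le> K * ((5 * norm (x - x')) * (r + r))"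
    using K by (intro mult_left_mono) auto
  then have 2: "\<bar>K * (norm w)\<^sup>2 - K * (norm w')\<^sup>2\<bar> \<le> 10 * K * r * norm (x - x')"
  proof -
    have "K * (norm w)\<^sup>2 - K * (norm w')\<^sup>2 = K * ((norm w)\<^sup>2 - (norm w')\<^sup>2)" by (rule right_diff_distrib[symmetric])
    then have "\<bar>K * (norm w)\<^sup>2 - K * (norm w')\<^sup>2\<bar> = K * \<bar>(norm w)\<^sup>2 - (norm w')\<^sup>2\<bar>" using K by (simp add: abs_mult)
    also have "\<dots> \<le> K * ((5 * norm (x - x')) * (r + r))" by fact
    also have "\<dots> = 10 * K * r * norm (x - x')" by simp
    finally show ?thesis .
  qed
  show ?thesis
    using 1 2 unfolding U_def w_def w'_def by (simp add: distrib_right)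
qed

text \<open>Differentiating the identity \<open>foot (Y u) (\<eta> u) = 0\<close> yields
  \<open>z * J = y \<bullet> q1 \<theta>\<close> for the foot velocity \<open>z\<close>, so that the
  derivative of \<open>U\<close> along the path is the left side of
  \<open>calibration\<close>.\<close>

lemma U_derivative:
  assumes Y: "(Y has_vector_derivative y) (at t)" and \<eta>: "(\<eta> has_real_derivative z) (at t)"
    and foot0: "\<forall>\<^sub>F u in nhds t. foot (Y u) (\<eta> u) = 0" and near: "norm (Y t - qt (\<eta> t)) \<le> r"
  shows "\<exists>D. ((\<lambda>u. U (Y u) (\<eta> u)) has_real_derivative D) (at t) \<and> D \<le> (norm (y - F (Y t)))\<^sup>2 / 2"
proof -
  define \<theta> where "\<theta> = \<eta> t"
  define w where "w = Y t - qt \<theta>"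
  define J where "J = 1 - (\<phi> \<theta> + w) \<bullet> q2 \<theta>"
  have wv: "\<phi> \<theta> + w = Y t - q \<theta>" by (simp add: w_def)
  have f0: "foot (Y t) \<theta> = 0" using eventually_nhds_x_imp_x[OF foot0] by (simp add: \<theta>_def)
  then have wq: "w \<bullet> q1 \<theta> = 0" using w_normal by (simp add: w_def)
  have wr: "norm w \<le> r" using near by (simp add: w_def \<theta>_def)
  \<comment> \<open>Both displacements are at most \<open>1 / (16 * \<kappa>)\<close>, so the
    curvature term is at most 1/8.\<close>
  have J: "J > 0"
  proof -
    have "(\<phi> \<theta> + w) \<bullet> q2 \<theta> \<le> norm (\<phi> \<theta> + w) * norm (q2 \<theta>)" by (rule norm_cauchy_schwarz)
    also have "\<dots> \<le> (1 / (16 * \<kappa>) + 1 / (16 * \<kappa>)) * \<kappa>"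
      using norm_triangle_ineq[of "\<phi> \<theta>" w] \<phi>_small[of \<theta>] wr r(2) q2_bound \<kappa>_pos by (intro mult_mono) auto
    finally show ?thesis using \<kappa>_pos by (simp add: J_def field_simps)
  qed
  have \<eta>v: "(\<eta> has_vector_derivative z) (at t)" using \<eta> by (simp add: has_real_derivative_iff_has_vector_derivative)
  have comp: "((\<lambda>u. f (\<eta> u)) has_vector_derivative z *\<^sub>R f' \<theta>) (at t)"
    if "\<And>\<theta>. (f has_vector_derivative f' \<theta>) (at \<theta>)" for f f' :: "real \<Rightarrow> 'a"
    using vector_diff_chain_at[OF \<eta>v that] by (simp add: o_def \<theta>_def)
  have "((\<lambda>u. foot (Y u) (\<eta> u)) has_vector_derivative ((Y t - q \<theta>) \<bullet> (z *\<^sub>R q2 \<theta>) + (y - z *\<^sub>R q1 \<theta>) \<bullet> q1 \<theta>)) (at t)"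
    unfolding foot_def \<theta>_def
    by (rule bounded_bilinear.has_vector_derivative[OF bounded_bilinear_inner])
       (use comp[OF q_deriv] comp[OF q1_deriv] in \<open>auto intro!: has_vector_derivative_diff Y simp: \<theta>_def\<close>)
  moreover have "((\<lambda>u. foot (Y u) (\<eta> u)) has_vector_derivative 0) (at t)"
  proof -
    obtain S where S: "open S" "t \<in> S" "\<forall>u\<in>S. foot (Y u) (\<eta> u) = 0"
      using foot0 unfolding eventually_nhds by blast
    have "((\<lambda>u. 0) has_vector_derivative (0::real)) (at t)" by simp
    then show ?thesis
      by (rule has_vector_derivative_transform_within_open[OF _ S(1,2)]) (use S(3) in simp)
  qed
  ultimately have "(Y t - q \<theta>) \<bullet> (z *\<^sub>R q2 \<theta>) + (y - z *\<^sub>R q1 \<theta>) \<bullet> q1 \<theta> = 0"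
    using vector_derivative_unique_at by blast
  moreover have "q1 \<theta> \<bullet> q1 \<theta> = 1" using q1_unit by (simp add: dot_square_norm)
  moreover have J': "J = 1 - (Y t - q \<theta>) \<bullet> q2 \<theta>" by (simp only: J_def wv)
  ultimately have zJ: "z * J = y \<bullet> q1 \<theta>" unfolding J' by (simp add: inner_diff_left algebra_simps)
  have d1: "((\<lambda>u. B (s (\<eta> u))) has_real_derivative cut_drift b a (s \<theta>) * (N0 \<theta> * z)) (at t)"
    unfolding \<theta>_def by (intro DERIV_chain2[OF B_deriv] DERIV_chain2[OF s_deriv] \<eta>)
  have dw: "((\<lambda>u. Y u - qt (\<eta> u)) has_vector_derivative (y - z *\<^sub>R (q1 \<theta> + \<phi>1 \<theta>))) (at t)"
    by (intro has_vector_derivative_diff Y comp qt_deriv)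
  have "((\<lambda>u. (Y u - qt (\<eta> u)) \<bullet> (Y u - qt (\<eta> u))) has_vector_derivative
      (w \<bullet> (y - z *\<^sub>R (q1 \<theta> + \<phi>1 \<theta>)) + (y - z *\<^sub>R (q1 \<theta> + \<phi>1 \<theta>)) \<bullet> w)) (at t)"
    using bounded_bilinear.has_vector_derivative[OF bounded_bilinear_inner dw dw] by (simp add: w_def \<theta>_def)
  then have d2: "((\<lambda>u. (norm (Y u - qt (\<eta> u)))\<^sup>2) has_real_derivative 2 * (w \<bullet> y - z * (w \<bullet> \<phi>1 \<theta>))) (at t)"
    using wq by (simp add: has_real_derivative_iff_has_vector_derivative power2_norm_eq_inner inner_diff_right inner_diff_left inner_add_right inner_add_left inner_commute algebra_simps)
  define D where "D = \<alpha> * (cut_drift b a (s \<theta>) * (N0 \<theta> * z)) + K * (2 * (w \<bullet> y - z * (w \<bullet> \<phi>1 \<theta>)))"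
  have "((\<lambda>u. U (Y u) (\<eta> u)) has_real_derivative D) (at t)"
    unfolding U_def D_def by (intro DERIV_add DERIV_cmult d1 d2)
  moreover have "D \<le> (norm (y - F (Y t)))\<^sup>2 / 2"
  proof -
    define m where "m = \<alpha> * cut_drift b a (s \<theta>) * N0 \<theta> - 2 * K * (w \<bullet> \<phi>1 \<theta>)"
    have z: "z = (q1 \<theta> \<bullet> y) / J" using zJ J by (simp add: field_simps inner_commute)
    have "D = m * z + 2 * K * (w \<bullet> y)" by (simp add: D_def m_def algebra_simps)
    also have "\<dots> = ((m / J) *\<^sub>R q1 \<theta> + (2 * K) *\<^sub>R w) \<bullet> y"
      by (simp add: z inner_add_left)
    also have "\<dots> \<le> (norm (y - F (q \<theta> + \<phi> \<theta> + w)))\<^sup>2 / 2"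
      unfolding m_def J_def by (rule calibration[OF wq wr])
    also have "q \<theta> + \<phi> \<theta> + w = Y t" by (simp add: w_def)
    finally show ?thesis .
  qed
  ultimately show ?thesis by blast
qed

text \<open>Until the displacement first reaches \<open>r\<close>, the derivative bound integrates.
  At that time \<open>U\<close> is at least \<open>K * r\<^sup>2\<close>, because \<open>B\<close>
  is nonnegative, and this cost is never recovered because the Lagrangian is nonnegative.\<close>

lemma step:
  assumes Y: "abs_continuous T 0 Y" and t: "T \<le> t0" "t0 \<le> t1" "t1 \<le> 0"
    and int: "lagrangian F Y integrable_on {T..0}"
    and small: "\<And>t. t \<in> {t0..t1} \<Longrightarrow> norm (Y t - Y t0) \<le> 1 / (32 * \<kappa>)"
    and start: "foot (Y t0) \<theta>0 = 0" "norm (Y t0 - qt \<theta>0) \<le> r" "U (Y t0) \<theta>0 \<le> integral {T..t0} (lagrangian F Y)"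
  shows "(\<exists>\<theta>. foot (Y t1) \<theta> = 0 \<and> norm (Y t1 - qt \<theta>) \<le> r \<and> U (Y t1) \<theta> \<le> integral {T..t1} (lagrangian F Y))
     \<or> K * r\<^sup>2 \<le> integral {T..t1} (lagrangian F Y)"
proof -
  have int': "lagrangian F Y integrable_on {u..v}" if "T \<le> u" "v \<le> 0" for u v
    using integrable_on_subinterval[OF int] that by auto
  have mono: "integral {T..u} (lagrangian F Y) \<le> integral {T..v} (lagrangian F Y)" if "u \<le> v" "v \<le> 0" for u v
    using that by (intro integral_subset_le int') (auto simp: lagrangian_nonneg)
  have nq: "norm (Y t0 - q \<theta>0) \<le> 1 / (8 * \<kappa>)"
  proof -
    have "norm (Y t0 - q \<theta>0) \<le> norm (Y t0 - qt \<theta>0) + norm (\<phi> \<theta>0)"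
      using norm_triangle_ineq[of "Y t0 - qt \<theta>0" "\<phi> \<theta>0"] by simp
    also have "\<dots> \<le> 1 / (16 * \<kappa>) + 1 / (16 * \<kappa>)" using start(2) r(2) \<phi>_small[of \<theta>0] by simp
    finally show ?thesis by simp
  qed
  obtain \<eta> where \<eta>: "\<eta> t0 = \<theta>0" "\<And>t. t \<in> {t0..t1} \<Longrightarrow> foot (Y t) (\<eta> t) = 0"
    "\<And>t t'. t \<in> {t0..t1} \<Longrightarrow> t' \<in> {t0..t1} \<Longrightarrow> \<bar>\<eta> t - \<eta> t'\<bar> \<le> 2 * norm (Y t - Y t')"
    using foot_track[of Y t0 \<theta>0 "{t0..t1}", OF start(1) nq _ small] t(2) by auto
  have Y': "abs_continuous t0 t1 Y" using abs_continuous_subset[OF Y] t by auto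
  have \<eta>ac: "abs_continuous t0 t1 \<eta>"
    by (rule abs_continuous_dominated[OF Y', where C = 2]) (use \<eta>(3) in simp)
  define \<omega> where "\<omega> u = norm (Y u - qt (\<eta> u))" for u
  have \<omega>c: "continuous_on {t0..t1} \<omega>"
    unfolding \<omega>_def
    by (intro continuous_on_norm continuous_on_diff abs_continuous_imp_continuous_on[OF Y']
        continuous_on_compose2[OF _ abs_continuous_imp_continuous_on[OF \<eta>ac], of UNIV qt])
       (auto intro: continuous_at_imp_continuous_on has_vector_derivative_continuous[OF qt_deriv])
  have reach: "U (Y t2) (\<eta> t2) \<le> integral {T..t2} (lagrangian F Y)"
    if t2: "t2 \<in> {t0..t1}" and in_tube: "\<And>u. u \<in> {t0..t2} \<Longrightarrow> \<omega> u \<le> r" for t2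
  proof -
    define f where "f u = U (Y u) (\<eta> u)" for u
    have Y2: "abs_continuous t0 t2 Y" using abs_continuous_subset[OF Y'] t2 by auto
    have "abs_continuous t0 t2 f"
      by (rule abs_continuous_dominated[OF Y2, where C = "8 * \<beta> + 10 * K * r"])
         (use t2 in \<open>auto simp: f_def \<omega>_def intro!: U_lipschitz \<eta>(3) in_tube[unfolded \<omega>_def]\<close>)
    obtain N where N: "negligible N" "{t0,t1} \<subseteq> N" "\<And>x. x \<in> {t0..t1} - N \<Longrightarrow> (Y has_vector_derivative vector_derivative Y (at x)) (at x)"
      using abs_continuous_vector_derivative_ae[OF Y'] by blast
    obtain N' where N': "negligible N'" "{t0,t1} \<subseteq> N'" "\<And>x. x \<in> {t0..t1} - N' \<Longrightarrow> (\<eta> has_vector_derivative vector_derivative \<eta> (at x)) (at x)"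
      using abs_continuous_vector_derivative_ae[OF \<eta>ac] by blast
    have "f t2 - f t0 \<le> integral {t0..t2} (lagrangian F Y)"
    proof (rule abs_continuous_increment_le[OF \<open>abs_continuous t0 t2 f\<close> _ _ negligible_Un[OF N(1) N'(1)]])
      show "t0 \<le> t2" "lagrangian F Y integrable_on {t0..t2}" using t2 t by (auto intro!: int')
      fix u D assume u: "u \<in> {t0<..<t2} - (N \<union> N')" and D: "(f has_real_derivative D) (at u)"
      have ev: "\<forall>\<^sub>F v in nhds u. foot (Y v) (\<eta> v) = 0"
      proof (rule eventually_nhds_in_open[THEN eventually_mono])
        show "open {t0<..<t2}" "u \<in> {t0<..<t2}" using u by auto
        show "foot (Y v) (\<eta> v) = 0" if "v \<in> {t0<..<t2}" for v using \<eta>(2)[of v] that t2 by auto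
      qed
      have "\<exists>D. (f has_real_derivative D) (at u) \<and> D \<le> (norm (vector_derivative Y (at u) - F (Y u)))\<^sup>2 / 2"
        unfolding f_def
      proof (rule U_derivative[OF _ _ ev])
        show "(Y has_vector_derivative vector_derivative Y (at u)) (at u)" using N(3)[of u] u t2 by auto
        show "(\<eta> has_real_derivative vector_derivative \<eta> (at u)) (at u)"
          using N'(3)[of u] u t2 by (auto simp: has_real_derivative_iff_has_vector_derivative)
        show "norm (Y u - qt (\<eta> u)) \<le> r" using in_tube[of u] u by (auto simp: \<omega>_def)
      qed
      then show "D \<le> lagrangian F Y u" using D DERIV_unique unfolding lagrangian_def by blast
    qed
    moreover have "integral {T..t0} (lagrangian F Y) + integral {t0..t2} (lagrangian F Y) = integral {T..t2} (lagrangian F Y)"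
      using t t2 by (intro Henstock_Kurzweil_Integration.integral_combine int') auto
    ultimately show ?thesis using start(3) \<eta>(1) by (simp add: f_def)
  qed
  show ?thesis
  proof (cases "\<forall>u\<in>{t0..t1}. \<omega> u \<le> r")
    case True
    then show ?thesis using reach[of t1] \<eta>(2)[of t1] t(2) by (auto simp: \<omega>_def)
  next
    case False
    \<comment> \<open>The infimum of this closed set is the exit time; strictly before it the path
      is inside the tube.\<close>
    define E where "E = {t0..t1} \<inter> \<omega> -` {r..}"
    have "closed E" unfolding E_def by (intro continuous_closed_preimage \<omega>c) auto
    moreover have "E \<noteq> {}" using False by (force simp: E_def)
    moreover have bdd: "bdd_below E" by (auto simp: E_def bdd_below_def)
    ultimately have inE: "Inf E \<in> E" by (intro closed_contains_Inf)
    define t2 where "t2 = Inf E"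
    have t2: "t2 \<in> {t0..t1}" "\<omega> t2 \<ge> r" using inE by (auto simp: E_def t2_def)
    have before: "\<omega> u < r" if "u \<in> {t0..<t2}" for u
    proof (rule ccontr)
      assume "\<not> \<omega> u < r"
      then have "u \<in> E" using that t2 by (auto simp: E_def)
      then show False using cInf_lower[OF _ bdd] that by (force simp: t2_def)
    qed
    have "\<omega> t2 \<le> r"
    proof (cases "t2 = t0")
      case True
      then show ?thesis using start(2) \<eta>(1) by (simp add: \<omega>_def)
    next
      case False
      have "t2 \<in> closure {t0..<t2}" using False t2 by simp
      moreover have "continuous_on (closure {t0..<t2}) \<omega>"
        using False t2 by (auto intro: continuous_on_subset[OF \<omega>c])
      ultimately show ?thesis
        using continuous_le_on_closure[of "{t0..<t2}" \<omega> t2 r] before by force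
    qed
    then have "U (Y t2) (\<eta> t2) \<le> integral {T..t2} (lagrangian F Y)"
      using t2(1) before by (intro reach) (auto simp: less_eq_real_def)
    moreover have "K * r\<^sup>2 \<le> U (Y t2) (\<eta> t2)"
    proof -
      have "K * r\<^sup>2 \<le> K * (\<omega> t2)\<^sup>2" using t2(2) r K by (intro mult_left_mono power_mono) auto
      then show ?thesis using B_nonneg \<alpha> by (simp add: U_def \<omega>_def add_increasing)
    qed
    ultimately show ?thesis using mono[of t2 t1] t2(1) t(3) by simp
  qed
qed

text \<open>Uniform continuity of \<open>Y\<close> splits the time interval into equal steps on
  which \<open>Y\<close> moves by at most \<open>1 / (32 * \<kappa>)\<close>, as
  \<open>foot_track\<close> requires. The number of steps depends on the path, but
  \<open>step\<close> loses nothing, so the induction carries the exact bound.\<close>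

theorem action_lower_bound:
  assumes Y: "abs_continuous T 0 Y" "T < 0" "Y T = qt \<theta>A" "s \<theta>A = a" and fin: "action F T Y < \<infinity>"
  shows "ennreal (K * r\<^sup>2) \<le> action F T Y \<or>
    (\<exists>\<theta>. foot (Y 0) \<theta> = 0 \<and> norm (Y 0 - qt \<theta>) \<le> r \<and> ennreal (\<alpha> * B (s \<theta>)) \<le> action F T Y)"
proof -
  note fin' = action_finite[OF Y(1) less_imp_le[OF Y(2)] F_cont fin]
  let ?L = "lagrangian F Y"
  have "uniformly_continuous_on {T..0} Y"
    by (intro compact_uniformly_continuous abs_continuous_imp_continuous_on Y(1)) auto
  moreover have "1 / (32 * \<kappa>) > 0" using \<kappa>_pos by simp
  ultimately obtain d where "d > 0" and d: "\<And>u v. u \<in> {T..0} \<Longrightarrow> v \<in> {T..0} \<Longrightarrow> dist v u < d \<Longrightarrow> dist (Y v) (Y u) < 1 / (32 * \<kappa>)"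
    unfolding uniformly_continuous_on_def by metis
  obtain n :: nat where n: "- T / d < n" using reals_Archimedean2 by blast
  have npos: "real n > 0" using n Y(2) \<open>d > 0\<close> by (smt (verit) divide_pos_pos)
  define h where "h = - T / n"
  have h: "0 < h" "h < d" using n npos Y(2) \<open>d > 0\<close> by (auto simp: h_def field_simps)
  define P where "P t \<longleftrightarrow> (\<exists>\<theta>. foot (Y t) \<theta> = 0 \<and> norm (Y t - qt \<theta>) \<le> r \<and> U (Y t) \<theta> \<le> integral {T..t} ?L)
     \<or> K * r\<^sup>2 \<le> integral {T..t} ?L" for t
  have "P (T + k * h)" if "k \<le> n" for k :: nat
    using that
  proof (induction k)
    case 0
    have "foot (Y T) \<theta>A = 0" using w_normal[of "Y T" \<theta>A] Y(3) by simp
    moreover have "U (Y T) \<theta>A = 0" using Y(3,4) B_zero by (simp add: U_def)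
    ultimately show ?case using Y(3) r(1) unfolding P_def by (intro disjI1 exI[of _ \<theta>A]) simp
  next
    case (Suc k)
    define t0 t1 where "t0 = T + k * h" and "t1 = T + Suc k * h"
    have t: "T \<le> t0" "t0 \<le> t1" "t1 \<le> 0" "t1 - t0 = h"
    proof -
      show "T \<le> t0" "t0 \<le> t1" "t1 - t0 = h" using h by (auto simp: t0_def t1_def algebra_simps)
      have "real (Suc k) * h \<le> n * h" using Suc(2) h by (intro mult_right_mono) auto
      then show "t1 \<le> 0" using npos by (simp add: t1_def h_def)
    qed
    have "P t0" using Suc by (simp add: t0_def)
    then consider \<theta> where "foot (Y t0) \<theta> = 0" "norm (Y t0 - qt \<theta>) \<le> r" "U (Y t0) \<theta> \<le> integral {T..t0} ?L"
      | "K * r\<^sup>2 \<le> integral {T..t0} ?L" unfolding P_def by blast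
    then have "P t1"
    proof cases
      case 1
      have "norm (Y u - Y t0) \<le> 1 / (32 * \<kappa>)" if "u \<in> {t0..t1}" for u
        using d[of t0 u] that t h by (auto simp: dist_norm)
      from step[OF Y(1) t(1,2,3) fin'(1) this 1] show ?thesis unfolding P_def .
    next
      case 2
      have "integral {T..t0} ?L \<le> integral {T..t1} ?L"
        using t by (intro integral_subset_le integrable_on_subinterval[OF fin'(1)]) (auto simp: lagrangian_nonneg)
      then show ?thesis using 2 unfolding P_def by simp
    qed
    then show ?case by (simp add: t1_def)
  qed
  from this[of n] have "P 0" using npos by (simp add: h_def)
  then show ?thesis
  proof (unfold P_def, elim disjE exE conjE)
    fix \<theta> assume *: "foot (Y 0) \<theta> = 0" "norm (Y 0 - qt \<theta>) \<le> r" "U (Y 0) \<theta> \<le> integral {T..0} ?L"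
    have "\<alpha> * B (s \<theta>) \<le> U (Y 0) \<theta>" using K by (simp add: U_def)
    then show ?thesis using * fin'(2) by (intro disjI2 exI[of _ \<theta>]) (auto intro: ennreal_leI)
  next
    assume "K * r\<^sup>2 \<le> integral {T..0} ?L"
    then show ?thesis using fin'(2) by (auto intro: ennreal_leI)
  qed
qed

end

section \<open>The calibration inequality\<close>

text \<open>\<open>p\<close> is the tangential momentum, \<open>g\<close> the tangential component
  of the gradient, \<open>J\<close> and \<open>J0\<close> the denominators at displacement
  \<open>w\<close> and on the invariant curve, \<open>k\<close> the effect of its tilt,
  \<open>D\<close> and \<open>wR\<close> the tangential change of the field (with a curvature
  correction) and the normal one. All errors reduce to \<open>X\<close> and \<open>Z\<close>:
  \<open>Z\<close> is absorbed by the normal decay, \<open>X\<close> by Young's inequality against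
  the \<open>p\<^sup>2\<close> gained from \<open>\<alpha> < 1\<close>. In \<open>C\<close>, the
  summand \<open>c\<close> compensates the factor \<open>1 + c * \<delta>\<^sup>2\<close>; the rest
  pays for Young's inequality.\<close>

lemma calibration_scalar:
  fixes \<alpha> \<delta> c lam p b J J0 N0 k D w wR C g :: real
  assumes c: "c \<ge> 1" and \<delta>: "0 < \<delta>" "\<delta> \<le> 1" and w: "0 \<le> w" "w \<le> 1" and lam: "lam > 0"
    and pb: "p * b = - p\<^sup>2 / 2" and p: "\<bar>p\<bar> \<le> c * \<delta>"
    and J: "1/2 \<le> J" "J \<le> 2" "1/2 \<le> J0" "J0 \<le> 2" "\<bar>J - J0\<bar> \<le> c * w"
    and N0: "0 \<le> N0" "N0 \<le> 2" "N0\<^sup>2 \<le> J0\<^sup>2 * (1 + c * \<delta>\<^sup>2)"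
    and k: "\<bar>k\<bar> \<le> c * \<delta> * w" and D: "\<bar>D\<bar> \<le> c * (\<delta> + w) * w"
    and wR: "wR \<le> - lam * w\<^sup>2 + c * (\<delta> + w) * w\<^sup>2"
    and C: "C = c + 4 * (12 * c + 128 * c\<^sup>2)\<^sup>2 / lam\<^sup>2" and \<alpha>: "\<alpha> = 1 - C * \<delta>\<^sup>2" "1/2 \<le> \<alpha>"
    and small: "lam * c * (\<delta> + w) + 10 * c\<^sup>2 * \<delta> \<le> lam\<^sup>2 / 4"
    and g: "g = (\<alpha> * p * N0 - k) / J"
  shows "\<alpha> * p * b + g\<^sup>2 / 2 + g * D + lam * wR + lam\<^sup>2 / 2 * w\<^sup>2 \<le> 0"
proof -
  define X where "X = \<bar>p\<bar> * \<delta> * w"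
  define Z where "Z = \<delta> * w\<^sup>2"
  have X0: "X \<ge> 0" and Z0: "Z \<ge> 0" using \<delta> w by (auto simp: X_def Z_def)
  have C0: "C \<ge> c" using C by simp
  have \<alpha>1: "\<alpha> \<le> 1" using \<alpha>(1) C0 c by simp
  define A where "A = \<alpha> * p * N0"
  have A: "\<bar>A\<bar> \<le> 2 * \<bar>p\<bar>"
  proof -
    have "\<bar>A\<bar> = (\<alpha> * N0) * \<bar>p\<bar>" using \<alpha>(2) N0(1) by (simp add: A_def abs_mult)
    also have "\<dots> \<le> (1 * 2) * \<bar>p\<bar>" using \<alpha>(2) \<alpha>1 N0 by (intro mult_right_mono mult_mono) auto
    finally show ?thesis by simp
  qed
  have J2: "1 / J\<^sup>2 \<le> 4" "J\<^sup>2 > 0" "J0\<^sup>2 > 0" "1 / J0\<^sup>2 \<le> 4"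
  proof -
    have "(1/2)\<^sup>2 \<le> J\<^sup>2" "(1/2)\<^sup>2 \<le> J0\<^sup>2" using J by (intro power_mono; simp)+
    then show "1 / J\<^sup>2 \<le> 4" "J\<^sup>2 > 0" "J0\<^sup>2 > 0" "1 / J0\<^sup>2 \<le> 4" by (auto simp: field_simps power2_eq_square)
  qed
  have inv: "1 / J\<^sup>2 \<le> 1 / J0\<^sup>2 + 64 * c * w"
  proof -
    have "1 / J\<^sup>2 - 1 / J0\<^sup>2 = (J0 - J) * (J0 + J) * (1 / J\<^sup>2 * (1 / J0\<^sup>2))"
      using J by (simp add: field_simps power2_eq_square)
    also have "\<dots> \<le> (c * w) * 4 * (4 * 4)"
      using J J2 c w by (intro mult_mono) (auto simp: abs_le_iff)
    finally show ?thesis by simp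
  qed
  \<comment> \<open>Replacing \<open>J\<close> by \<open>J0\<close> costs a multiple of
    \<open>A\<^sup>2 * w\<close>, which is of type \<open>X\<close> because one of the two factors
    \<open>\<bar>p\<bar>\<close> is at most \<open>c * \<delta>\<close>.\<close>
  have g2: "g\<^sup>2 / 2 \<le> \<alpha>\<^sup>2 * p\<^sup>2 * (1 + c * \<delta>\<^sup>2) / 2 + (8 * c + 128 * c\<^sup>2) * X + 2 * c\<^sup>2 * Z"
  proof -
    have "g\<^sup>2 / 2 = A\<^sup>2 * (1 / J\<^sup>2) / 2 + (- A * k) * (1 / J\<^sup>2) + k\<^sup>2 * (1 / J\<^sup>2) / 2"
      unfolding g A_def[symmetric] using J by (simp add: power2_eq_square field_simps)
    moreover have "A\<^sup>2 * (1 / J\<^sup>2) \<le> \<alpha>\<^sup>2 * p\<^sup>2 * (1 + c * \<delta>\<^sup>2) + 256 * c\<^sup>2 * X"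
    proof -
      have "A\<^sup>2 * (1 / J\<^sup>2) \<le> A\<^sup>2 * (1 / J0\<^sup>2 + 64 * c * w)" using inv by (intro mult_left_mono) auto
      also have "\<dots> = \<alpha>\<^sup>2 * p\<^sup>2 * (N0\<^sup>2 / J0\<^sup>2) + A\<^sup>2 * (64 * c * w)"
        by (simp add: A_def power_mult_distrib distrib_left)
      also have "\<dots> \<le> \<alpha>\<^sup>2 * p\<^sup>2 * (1 + c * \<delta>\<^sup>2) + (4 * \<bar>p\<bar> * (c * \<delta>)) * (64 * c * w)"
      proof (intro add_mono mult_left_mono mult_right_mono)
        show "N0\<^sup>2 / J0\<^sup>2 \<le> 1 + c * \<delta>\<^sup>2" using N0(3) J2(3) by (simp add: divide_le_eq mult.commute)
        have "A\<^sup>2 = \<bar>A\<bar> * \<bar>A\<bar>" by (simp add: power2_eq_square)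
        also have "\<dots> \<le> (2 * \<bar>p\<bar>) * (2 * (c * \<delta>))" using A p by (intro mult_mono) auto
        finally show "A\<^sup>2 \<le> 4 * \<bar>p\<bar> * (c * \<delta>)" by simp
      qed (use c w in auto)
      finally show ?thesis by (simp add: X_def power2_eq_square algebra_simps)
    qed
    moreover have "(- A * k) * (1 / J\<^sup>2) \<le> 8 * c * X"
    proof -
      have "(- A * k) * (1 / J\<^sup>2) \<le> \<bar>A\<bar> * \<bar>k\<bar> * (1 / J\<^sup>2)"
        using J2 by (intro mult_right_mono) (auto simp: abs_mult[symmetric])
      also have "\<dots> \<le> (2 * \<bar>p\<bar>) * (c * \<delta> * w) * 4"
        using A k J2 c \<delta> w by (intro mult_mono) auto
      finally show ?thesis by (simp add: X_def algebra_simps)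
    qed
    moreover have "k\<^sup>2 * (1 / J\<^sup>2) \<le> 4 * c\<^sup>2 * Z"
    proof -
      have "k\<^sup>2 = \<bar>k\<bar> * \<bar>k\<bar>" by (simp add: power2_eq_square)
      also have "\<dots> \<le> (c * \<delta> * w) * (c * \<delta> * w)" using k c \<delta> w by (intro mult_mono) auto
      also have "\<dots> = (c\<^sup>2 * Z) * \<delta>" by (simp add: Z_def power2_eq_square)
      also have "\<dots> \<le> (c\<^sup>2 * Z) * 1" using \<delta> Z0 by (intro mult_left_mono) auto
      finally have "k\<^sup>2 \<le> c\<^sup>2 * Z" by simp
      then have "k\<^sup>2 * (1 / J\<^sup>2) \<le> (c\<^sup>2 * Z) * 4" using J2 Z0 by (intro mult_mono) auto
      then show ?thesis by simp
    qed
    ultimately have "g\<^sup>2 / 2 \<le> (\<alpha>\<^sup>2 * p\<^sup>2 * (1 + c * \<delta>\<^sup>2) + 256 * c\<^sup>2 * X) / 2 + 8 * c * X + (4 * c\<^sup>2 * Z) / 2"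
      by (simp only:) (intro add_mono divide_right_mono; simp)
    then show ?thesis by (simp add: add_divide_distrib algebra_simps)
  qed
  have gD: "g * D \<le> 4 * c * X + 8 * c\<^sup>2 * Z"
  proof -
    have "\<bar>g\<bar> = \<bar>A - k\<bar> * (1 / J)" using J by (simp add: g A_def abs_divide)
    also have "\<dots> \<le> (2 * \<bar>p\<bar> + c * \<delta> * w) * 2"
      using A k J by (intro mult_mono) (auto simp: field_simps)
    finally have g1: "\<bar>g\<bar> \<le> 4 * \<bar>p\<bar> + 2 * c * \<delta> * w" by simp
    have "g * D \<le> \<bar>g\<bar> * \<bar>D\<bar>" by (simp add: abs_mult[symmetric])
    also have "\<dots> \<le> (4 * \<bar>p\<bar> + 2 * c * \<delta> * w) * (c * (\<delta> + w) * w)"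
      using g1 D c \<delta> w by (intro mult_mono) auto
    also have "\<dots> = 4 * c * X + 4 * c * (\<bar>p\<bar> * w\<^sup>2) + 2 * c\<^sup>2 * Z * (\<delta> + w)"
      by (simp add: X_def Z_def power2_eq_square algebra_simps)
    also have "\<dots> \<le> 4 * c * X + 4 * c * (c * Z) + 2 * c\<^sup>2 * Z * 2"
    proof (intro add_mono mult_left_mono order_refl)
      have "\<bar>p\<bar> * w\<^sup>2 \<le> (c * \<delta>) * w\<^sup>2" using p by (intro mult_right_mono) auto
      then show "\<bar>p\<bar> * w\<^sup>2 \<le> c * Z" by (simp add: Z_def)
      show "\<delta> + w \<le> 2" using \<delta> w by simp
    qed (use c Z0 in auto)
    finally show ?thesis by (simp add: power2_eq_square algebra_simps)
  qed
  define e where "e = C - c"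
  define c2 where "c2 = 12 * c + 128 * c\<^sup>2"
  have e: "e = 4 * c2\<^sup>2 / lam\<^sup>2" using C by (simp add: e_def c2_def)
  \<comment> \<open>The choice of \<open>\<alpha>\<close> makes
    \<open>\<alpha> * (1 + c * \<delta>\<^sup>2)\<close> at most
    \<open>1 - e * \<delta>\<^sup>2\<close>; at least half of the resulting gain survives the
    prefactor \<open>\<alpha> \<ge> 1/2\<close>.\<close>
  have tang: "\<alpha> * p * b + \<alpha>\<^sup>2 * p\<^sup>2 * (1 + c * \<delta>\<^sup>2) / 2 \<le> - (e * \<delta>\<^sup>2 * p\<^sup>2 / 4)"
  proof -
    have "\<alpha> * (1 + c * \<delta>\<^sup>2) \<le> 1 - e * \<delta>\<^sup>2"
    proof -
      have "\<alpha> * (1 + c * \<delta>\<^sup>2) = 1 - e * \<delta>\<^sup>2 - C * \<delta>\<^sup>2 * (c * \<delta>\<^sup>2)"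
        unfolding \<alpha>(1) e_def by (simp add: algebra_simps)
      then show ?thesis using C0 c by simp
    qed
    then have "\<alpha> * p\<^sup>2 / 2 * (\<alpha> * (1 + c * \<delta>\<^sup>2)) \<le> \<alpha> * p\<^sup>2 / 2 * (1 - e * \<delta>\<^sup>2)"
      using \<alpha>(2) by (intro mult_left_mono) auto
    then have "\<alpha>\<^sup>2 * p\<^sup>2 * (1 + c * \<delta>\<^sup>2) / 2 \<le> \<alpha> * p\<^sup>2 / 2 - \<alpha> * (e * \<delta>\<^sup>2 * p\<^sup>2 / 2)"
      by (simp add: power2_eq_square algebra_simps)
    moreover have "1 / 2 * (e * \<delta>\<^sup>2 * p\<^sup>2 / 2) \<le> \<alpha> * (e * \<delta>\<^sup>2 * p\<^sup>2 / 2)"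
      using \<alpha>(2) e by (intro mult_right_mono) auto
    moreover have "\<alpha> * p * b = - (\<alpha> * p\<^sup>2 / 2)" using pb by (simp add: mult.assoc)
    ultimately show ?thesis by simp
  qed
  \<comment> \<open>Of the decay \<open>lam\<^sup>2 * w\<^sup>2\<close>, one half cancels the square
    of the normal gradient, a quarter absorbs the errors, and a quarter remains for
    \<open>young\<close>.\<close>
  have norm_part: "lam * wR + lam\<^sup>2 / 2 * w\<^sup>2 + 10 * c\<^sup>2 * Z \<le> - (lam\<^sup>2 / 4 * w\<^sup>2)"
  proof -
    have "lam * wR \<le> lam * (- lam * w\<^sup>2 + c * (\<delta> + w) * w\<^sup>2)" using wR lam by (intro mult_left_mono) auto
    then have "lam * wR + 10 * c\<^sup>2 * Z \<le> - (lam\<^sup>2 * w\<^sup>2) + (lam * c * (\<delta> + w) + 10 * c\<^sup>2 * \<delta>) * w\<^sup>2"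
      by (simp add: Z_def power2_eq_square algebra_simps)
    moreover have "(lam * c * (\<delta> + w) + 10 * c\<^sup>2 * \<delta>) * w\<^sup>2 \<le> lam\<^sup>2 / 4 * w\<^sup>2"
      using small by (intro mult_right_mono) auto
    ultimately show ?thesis by simp
  qed
  have young: "c2 * X \<le> e * \<delta>\<^sup>2 * p\<^sup>2 / 4 + lam\<^sup>2 / 4 * w\<^sup>2"
  proof -
    have "0 \<le> (c2 * (\<delta> * \<bar>p\<bar>) / lam - lam * w / 2)\<^sup>2" by simp
    also have "\<dots> = c2\<^sup>2 / lam\<^sup>2 * (\<delta>\<^sup>2 * p\<^sup>2) + lam\<^sup>2 / 4 * w\<^sup>2 - c2 * X"
      using lam by (simp add: X_def power2_eq_square field_simps)
    finally show ?thesis using e by simp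
  qed
  have "c2 * X = (8 * c + 128 * c\<^sup>2) * X + 4 * c * X" "10 * c\<^sup>2 * Z = 2 * c\<^sup>2 * Z + 8 * c\<^sup>2 * Z"
    unfolding c2_def by (simp_all add: algebra_simps)
  then show ?thesis
    using g2 gD tang norm_part young by linarith
qed

text \<open>Completing the square reduces the bound to nonpositivity of the Hamiltonian
  \<open>P \<bullet> Fx + (norm P)\<^sup>2 / 2\<close>. The field on the invariant curve is a
  multiple of \<open>q1 + \<phi>1\<close>, and pairing it with \<open>P\<close> gives exactly
  \<open>\<alpha> * p * b\<close> up to the change of the denominator between the curve and
  \<open>w\<close>.\<close>

lemma calibration_vector:
  fixes q1 q2 \<phi> \<phi>1 w y Fq Fx :: "'a::real_inner"
  assumes c: "c \<ge> 1" and \<delta>: "0 < \<delta>" "\<delta> \<le> 1" and w: "norm w \<le> 1" "w \<bullet> q1 = 0" and lam: "lam > 0"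
    and q1: "norm q1 = 1" and pb: "p * b = - p\<^sup>2 / 2" and p: "\<bar>p\<bar> \<le> c * \<delta>"
    and N0: "N0 = norm (q1 + \<phi>1)" "0 < N0" "N0 \<le> 2" and Fq: "Fq = (b / N0) *\<^sub>R (q1 + \<phi>1)"
    and J0: "q1 \<bullet> \<phi>1 = - (\<phi> \<bullet> q2)" "1/2 \<le> 1 - \<phi> \<bullet> q2" "1 - \<phi> \<bullet> q2 \<le> 2"
    and J: "1/2 \<le> 1 - (\<phi> + w) \<bullet> q2" "1 - (\<phi> + w) \<bullet> q2 \<le> 2"
    and wq2: "\<bar>w \<bullet> q2\<bar> \<le> c * norm w" and \<phi>1: "4 * (norm \<phi>1)\<^sup>2 \<le> c * \<delta>\<^sup>2" "lam * norm \<phi>1 \<le> c * \<delta>"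
    and D: "\<bar>b / N0 * (w \<bullet> q2) + q1 \<bullet> (Fx - Fq)\<bar> \<le> c * (\<delta> + norm w) * norm w"
    and wR: "w \<bullet> (Fx - Fq) \<le> - lam * (norm w)\<^sup>2 + c * (\<delta> + norm w) * (norm w)\<^sup>2"
    and C: "C = c + 4 * (12 * c + 128 * c\<^sup>2)\<^sup>2 / lam\<^sup>2" and \<alpha>: "\<alpha> = 1 - C * \<delta>\<^sup>2" "1/2 \<le> \<alpha>"
    and small: "lam * c * (\<delta> + norm w) + 10 * c\<^sup>2 * \<delta> \<le> lam\<^sup>2 / 4"
  shows "(((\<alpha> * p * N0 - lam * (w \<bullet> \<phi>1)) / (1 - (\<phi> + w) \<bullet> q2)) *\<^sub>R q1 + lam *\<^sub>R w) \<bullet> y \<le> (norm (y - Fx))\<^sup>2 / 2"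
proof -
  define J' J0' k D' g where "J' = 1 - (\<phi> + w) \<bullet> q2" and "J0' = 1 - \<phi> \<bullet> q2" and "k = lam * (w \<bullet> \<phi>1)"
    and "D' = b / N0 * (w \<bullet> q2) + q1 \<bullet> (Fx - Fq)" and "g = (\<alpha> * p * N0 - k) / J'"
  define P where "P = g *\<^sub>R q1 + lam *\<^sub>R w"
  have qq: "q1 \<bullet> q1 = 1" using q1 by (simp add: dot_square_norm)
  have "\<alpha> * p * b + g\<^sup>2 / 2 + g * D' + lam * (w \<bullet> (Fx - Fq)) + lam\<^sup>2 / 2 * (norm w)\<^sup>2 \<le> 0"
  proof (rule calibration_scalar[OF c \<delta> _ w(1) lam pb p _ _ _ _ _ _ N0(3) _ _ _ wR C \<alpha> small, where J = J' and J0 = J0' and k = k])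
    show "\<bar>J' - J0'\<bar> \<le> c * norm w" using wq2 by (simp add: J'_def J0'_def inner_add_left)
    \<comment> \<open>By \<open>J0\<close>, \<open>J0' = 1 + q1 \<bullet> \<phi>1\<close>, so
      \<open>N0\<^sup>2\<close> exceeds \<open>J0'\<^sup>2\<close> by at most
      \<open>(norm \<phi>1)\<^sup>2\<close>. This second order agreement is what allows
      \<open>1 - \<alpha>\<close> to be of order \<open>\<delta>\<^sup>2\<close>.\<close>
    have "N0\<^sup>2 = 1 + 2 * (q1 \<bullet> \<phi>1) + (norm \<phi>1)\<^sup>2"
      unfolding N0(1) power2_norm_eq_inner by (simp add: inner_add_left inner_add_right qq inner_commute)
    also have "\<dots> \<le> J0'\<^sup>2 + (norm \<phi>1)\<^sup>2" by (simp add: J0 J0'_def power2_eq_square algebra_simps)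
    also have "\<dots> \<le> J0'\<^sup>2 + J0'\<^sup>2 * (c * \<delta>\<^sup>2)"
    proof -
      have "(1/2)\<^sup>2 \<le> J0'\<^sup>2" using J0(2) unfolding J0'_def by (intro power_mono) auto
      then have "1/4 * (c * \<delta>\<^sup>2) \<le> J0'\<^sup>2 * (c * \<delta>\<^sup>2)" using c by (intro mult_right_mono) (auto simp: power2_eq_square)
      then show ?thesis using \<phi>1(1) by simp
    qed
    finally show "N0\<^sup>2 \<le> J0'\<^sup>2 * (1 + c * \<delta>\<^sup>2)" by (simp add: distrib_left)
    have "\<bar>k\<bar> = lam * \<bar>w \<bullet> \<phi>1\<bar>" using lam by (simp add: k_def abs_mult)
    also have "\<dots> \<le> lam * (norm w * norm \<phi>1)" using lam Cauchy_Schwarz_ineq2[of w \<phi>1] by (intro mult_left_mono) auto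
    also have "\<dots> = (lam * norm \<phi>1) * norm w" by simp
    also have "\<dots> \<le> (c * \<delta>) * norm w" using \<phi>1(2) by (intro mult_right_mono) auto
    finally show "\<bar>k\<bar> \<le> c * \<delta> * norm w" .
    show "\<bar>D'\<bar> \<le> c * (\<delta> + norm w) * norm w" using D by (simp add: D'_def)
    show "g = (\<alpha> * p * N0 - k) / J'" by (simp add: g_def)
  qed (use J J0 N0 in \<open>auto simp: J'_def J0'_def\<close>)
  moreover have "P \<bullet> Fx + (norm P)\<^sup>2 / 2 = \<alpha> * p * b + g\<^sup>2 / 2 + g * D' + lam * (w \<bullet> (Fx - Fq)) + lam\<^sup>2 / 2 * (norm w)\<^sup>2"
  proof -
    have gJ: "g * J' = \<alpha> * p * N0 - k" using J(1) by (simp add: g_def J'_def)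
    have "(norm P)\<^sup>2 = g\<^sup>2 + lam\<^sup>2 * (norm w)\<^sup>2"
      unfolding power2_norm_eq_inner P_def using w(2) qq
      by (simp add: inner_add_left inner_add_right inner_commute power2_eq_square)
    moreover have "P \<bullet> Fx = P \<bullet> Fq + g * (q1 \<bullet> (Fx - Fq)) + lam * (w \<bullet> (Fx - Fq))"
      by (simp add: P_def inner_add_left inner_diff_right algebra_simps)
    moreover have "P \<bullet> Fq = b / N0 * (g * J0' + k)"
      using w(2) qq J0(1) by (simp add: P_def Fq J0'_def k_def inner_add_left inner_add_right algebra_simps)
    moreover have J'_eq: "J' = J0' - w \<bullet> q2" by (simp add: J'_def J0'_def inner_add_left)
    \<comment> \<open>The definition of \<open>g\<close> clears the denominator \<open>J'\<close>;
      the curvature term split off here is the first summand of \<open>D'\<close>.\<close>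
    have "g * J0' + k = g * J' + k + g * (w \<bullet> q2)" unfolding J'_eq by (simp add: algebra_simps)
    then have "b / N0 * (g * J0' + k) = \<alpha> * p * b + g * (b / N0 * (w \<bullet> q2))"
      using gJ N0(2) by (simp add: distrib_left)
    ultimately show ?thesis by (simp add: D'_def distrib_left add_divide_distrib)
  qed
  ultimately have "P \<bullet> Fx + (norm P)\<^sup>2 / 2 \<le> 0" by simp
  moreover have "(norm (y - Fx - P))\<^sup>2 = (norm (y - Fx))\<^sup>2 - 2 * (P \<bullet> y) + 2 * (P \<bullet> Fx) + (norm P)\<^sup>2"
    unfolding power2_norm_eq_inner by (simp add: inner_diff_left inner_diff_right inner_commute algebra_simps)
  moreover have "(norm (y - Fx - P))\<^sup>2 \<ge> 0" by simp
  ultimately have "P \<bullet> y \<le> (norm (y - Fx))\<^sup>2 / 2" by linarith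
  then show ?thesis by (simp add: P_def g_def k_def J'_def)
qed

section \<open>The unperturbed problem and the comparison of quasipotentials\<close>

lemma velocity_shift:
  assumes "\<And>s. \<gamma> (s + c) = \<gamma> s" and der: "\<And>s. (\<gamma> has_vector_derivative velocity \<gamma> s) (at s)"
  shows "velocity \<gamma> (s + c) = velocity \<gamma> s"
proof -
  have "((\<lambda>x. x + c) has_vector_derivative 1) (at s)" by (auto intro!: derivative_eq_intros)
  from vector_diff_chain_at[OF this der] have "((\<gamma> \<circ> (\<lambda>x. x + c)) has_vector_derivative velocity \<gamma> (s + c)) (at s)" by simp
  moreover have "\<gamma> \<circ> (\<lambda>x. x + c) = \<gamma>" using assms(1) by auto
  ultimately show ?thesis by (simp add: vector_derivative_at)
qed

text \<open>The ball of radius \<open>R\<close> around the origin contains the 2-neighbourhood of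
  the curve; the constants after it are Lipschitz constants and a bound on that ball. None involves
  \<open>\<delta>\<close>, which makes the final constant uniform.\<close>

locale setting =
  fixes V :: "real ^ 'n \<Rightarrow> real" and G :: "real ^ 'n \<Rightarrow> real ^ 'n" and M :: "(real ^ 'n) set"
    and q :: "real \<Rightarrow> real ^ 'n" and L lam \<kappa> R CV CH CG BG :: real
  assumes V: "C_class 4 V" and G: "C_class 2 G" and q: "unit_speed_param 3 L M q" and lam: "lam > 0"
    and grad_q: "\<And>\<theta>. grad V (q \<theta>) = 0"
    and H_tangent: "\<And>\<theta>. hessian V (q \<theta>) *v velocity q \<theta> = 0"
    and H_normal: "\<And>\<theta> w. w \<bullet> velocity q \<theta> = 0 \<Longrightarrow> (hessian V (q \<theta>) *v w) \<bullet> w \<ge> lam * (norm w)\<^sup>2"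
    and \<kappa>: "\<kappa> > 0" "\<And>\<theta>. norm (velocity (velocity q) \<theta>) \<le> \<kappa>"
    and R: "\<And>\<theta>. norm (q \<theta>) + 2 \<le> R"
    and CV: "CV \<ge> 0" "\<And>x y. norm x \<le> R \<Longrightarrow> norm y \<le> R \<Longrightarrow> norm (grad V x - grad V y) \<le> CV * norm (x - y)"
    and CH: "CH \<ge> 0" "\<And>x y w. norm x \<le> R \<Longrightarrow> norm y \<le> R \<Longrightarrow>
       norm (hessian V x *v w - hessian V y *v w) \<le> CH * norm (x - y) * norm w"
    and CG: "CG \<ge> 0" "\<And>x y. norm x \<le> R \<Longrightarrow> norm y \<le> R \<Longrightarrow> norm (G x - G y) \<le> CG * norm (x - y)"
    and BG: "BG \<ge> 0" "\<And>x. norm x \<le> R \<Longrightarrow> norm (G x) \<le> BG"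
begin

lemma V3: "C_class 3 V" using C_class_mono[OF V] by simp

lemma q_C3: "C_class (Suc (Suc (Suc 0))) q"
  using q by (simp only: unit_speed_param_def numeral_3_eq_3)

lemma q_param: "unit_speed_param (Suc 2) L M q"
  using q by (simp add: numeral_3_eq_3 numeral_2_eq_2)

sublocale tube q "velocity q" "velocity (velocity q)" \<kappa>
proof
  show "(q has_vector_derivative velocity q \<theta>) (at \<theta>)" for \<theta> using C_class_velocity(1)[OF q_C3] .
  show "(velocity q has_vector_derivative velocity (velocity q) \<theta>) (at \<theta>)" for \<theta>
    using C_class_velocity(1)[OF C_class_velocity(2)[OF q_C3]] .
  show "norm (velocity q \<theta>) = 1" for \<theta> using norm_velocity[OF q_param] .
qed (rule \<kappa>)+

text \<open>The Hessian is frozen at a point of the unperturbed curve, where its kernel and lower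
  bound are known, rather than at the base point \<open>x\<close>.\<close>

lemma grad_expansion:
  assumes x: "norm x \<le> R" "norm (x + w) \<le> R"
  shows "norm (grad V (x + w) - grad V x - hessian V (q \<theta>) *v w) \<le> CH * (norm w + norm (x - q \<theta>)) * norm w"
proof -
  have Rq: "norm (q \<theta>) \<le> R" using R[of \<theta>] by simp
  have CH': "\<And>u v w. u \<in> cball 0 R \<Longrightarrow> v \<in> cball 0 R \<Longrightarrow> norm (hessian V u *v w - hessian V v *v w) \<le> CH * norm (u - v) * norm w"
    using CH(2) by (simp add: mem_cball_0)
  have "norm (grad V (x + w) - grad V x - hessian V x *v (x + w - x)) \<le> CH * (norm (x + w - x))\<^sup>2"
    by (rule grad_taylor[OF V3 convex_cball[of 0 R] CH(1) CH']) (use x in \<open>auto simp: mem_cball_0\<close>)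
  then have "norm (grad V (x + w) - grad V x - hessian V x *v w) \<le> CH * (norm w)\<^sup>2" by simp
  moreover have "norm (hessian V x *v w - hessian V (q \<theta>) *v w) \<le> CH * norm (x - q \<theta>) * norm w"
    using CH(2)[OF x(1) Rq] .
  ultimately have "norm ((grad V (x + w) - grad V x - hessian V x *v w) + (hessian V x *v w - hessian V (q \<theta>) *v w))
      \<le> CH * (norm w)\<^sup>2 + CH * norm (x - q \<theta>) * norm w"
    by (rule norm_triangle_mono)
  then show ?thesis by (simp add: power2_eq_square algebra_simps)
qed

text \<open>By symmetry of the Hessian and its kernel, the term linear in \<open>w\<close> has no
  component along the curve, so the tangential change of the field is of order
  \<open>(\<delta> + norm w) * norm w\<close>. The normal change inherits the decay rate
  \<open>lam\<close>.\<close>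

lemma field_estimates:
  fixes w p :: "real ^ 'n"
  assumes \<delta>: "0 \<le> \<delta>" and p: "norm p \<le> P * \<delta>" "norm p \<le> 1/2" and w: "norm w \<le> 1" "w \<bullet> velocity q \<theta> = 0"
  defines "Q \<equiv> perturbed_field V G \<delta> (q \<theta> + p + w) - perturbed_field V G \<delta> (q \<theta> + p)"
  shows "\<bar>velocity q \<theta> \<bullet> Q\<bar> \<le> (CH * norm w + (CH * P + CG) * \<delta>) * norm w"
    and "w \<bullet> Q \<le> - lam * (norm w)\<^sup>2 + (CH * norm w + (CH * P + CG) * \<delta>) * (norm w)\<^sup>2"
proof -
  define x where "x = q \<theta> + p"
  have x: "norm x \<le> R" "norm (x + w) \<le> R"
    using norm_triangle_ineq[of "q \<theta>" p] norm_triangle_ineq[of x w] R[of \<theta>] p(2) w(1) by (auto simp: x_def)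
  define E where "E = grad V (x + w) - grad V x - hessian V (q \<theta>) *v w"
  have Q: "Q = - (hessian V (q \<theta>) *v w) - E + \<delta> *\<^sub>R (G (x + w) - G x)"
    by (simp add: Q_def perturbed_field_def x_def E_def algebra_simps)
  have "norm E \<le> CH * (norm w + norm p) * norm w"
    using grad_expansion[OF x, of \<theta>] by (simp add: E_def x_def)
  also have "\<dots> \<le> CH * (norm w + P * \<delta>) * norm w"
    using p(1) CH(1) by (intro mult_right_mono mult_left_mono) auto
  finally have E: "norm E \<le> CH * (norm w + P * \<delta>) * norm w" .
  have Gn: "norm (\<delta> *\<^sub>R (G (x + w) - G x)) \<le> \<delta> * (CG * norm w)"
    using CG(2)[OF x(2,1)] \<delta> by (simp add: mult_left_mono)
  have rest: "\<bar>u \<bullet> (- E + \<delta> *\<^sub>R (G (x + w) - G x))\<bar> \<le> norm u * ((CH * norm w + (CH * P + CG) * \<delta>) * norm w)" for u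
  proof -
    have "\<bar>u \<bullet> (- E + \<delta> *\<^sub>R (G (x + w) - G x))\<bar> \<le> norm u * norm (- E + \<delta> *\<^sub>R (G (x + w) - G x))"
      by (rule Cauchy_Schwarz_ineq2)
    also have "norm (- E + \<delta> *\<^sub>R (G (x + w) - G x)) \<le> CH * (norm w + P * \<delta>) * norm w + \<delta> * (CG * norm w)"
      by (rule norm_triangle_mono) (use E Gn in auto)
    also have "\<dots> = (CH * norm w + (CH * P + CG) * \<delta>) * norm w" by (simp add: algebra_simps)
    finally show ?thesis by (simp add: mult_left_mono)
  qed
  have "velocity q \<theta> \<bullet> (hessian V (q \<theta>) *v w) = 0"
    using hessian_symmetric[OF V3, of "q \<theta>" w "velocity q \<theta>"] H_tangent[of \<theta>] by (simp add: inner_commute)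
  then have "velocity q \<theta> \<bullet> Q = velocity q \<theta> \<bullet> (- E + \<delta> *\<^sub>R (G (x + w) - G x))"
    by (simp add: Q inner_diff_right inner_add_right)
  then show "\<bar>velocity q \<theta> \<bullet> Q\<bar> \<le> (CH * norm w + (CH * P + CG) * \<delta>) * norm w"
    using rest[of "velocity q \<theta>"] q1_unit by simp
  have "w \<bullet> Q = - ((hessian V (q \<theta>) *v w) \<bullet> w) + w \<bullet> (- E + \<delta> *\<^sub>R (G (x + w) - G x))"
    by (simp add: Q inner_diff_right inner_add_right inner_commute)
  also have "\<dots> \<le> - (lam * (norm w)\<^sup>2) + norm w * ((CH * norm w + (CH * P + CG) * \<delta>) * norm w)"
    using H_normal[OF w(2)] abs_le_D1[OF rest[of w]] by (intro add_mono) auto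
  finally show "w \<bullet> Q \<le> - lam * (norm w)\<^sup>2 + (CH * norm w + (CH * P + CG) * \<delta>) * (norm w)\<^sup>2"
    by (simp add: power2_eq_square mult_ac)
qed

lemma perturbed_field_continuous: "continuous_on UNIV (perturbed_field V G \<delta>)"
proof -
  have "continuous_on UNIV (grad V)"
    by (intro continuous_at_imp_continuous_on ballI has_derivative_continuous[OF grad_has_derivative[OF V3]])
  moreover have "continuous_on UNIV G" using G by (rule C_class_continuous)
  ultimately show ?thesis unfolding perturbed_field_def[abs_def] by (intro continuous_intros)
qed

text \<open>\<open>grad V\<close> vanishes on the curve, so at distance of order
  \<open>\<delta>\<close> from it the whole field is of order \<open>\<delta>\<close>.\<close>

lemma field_bound:
  assumes "0 \<le> \<delta>" "norm p \<le> P * \<delta>" "norm p \<le> 1/2"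
  shows "norm (perturbed_field V G \<delta> (q \<theta> + p)) \<le> (CV * P + BG) * \<delta>"
proof -
  have x: "norm (q \<theta>) \<le> R" "norm (q \<theta> + p) \<le> R"
    using norm_triangle_ineq[of "q \<theta>" p] R[of \<theta>] assms(3) by auto
  have "norm (- grad V (q \<theta> + p)) \<le> CV * norm p" using CV(2)[OF x(2,1)] grad_q by simp
  also have "\<dots> \<le> CV * (P * \<delta>)" using assms(2) CV(1) by (intro mult_left_mono)
  finally have "norm (- grad V (q \<theta> + p)) \<le> CV * (P * \<delta>)" .
  moreover have "norm (\<delta> *\<^sub>R G (q \<theta> + p)) \<le> \<delta> * BG" using BG(2)[OF x(2)] assms(1) by (simp add: mult_left_mono)
  ultimately have "norm (perturbed_field V G \<delta> (q \<theta> + p)) \<le> CV * (P * \<delta>) + \<delta> * BG"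
    unfolding perturbed_field_def by (rule norm_triangle_mono)
  then show ?thesis by (simp add: algebra_simps)
qed

text \<open>A circle path costs at least \<open>B\<close> at the lift of the target that it reaches,
  and a sweep in space to that same lift costs no more. Conversely, a path in space pays
  \<open>\<alpha>\<close> times \<open>B\<close> at some lift, or the exit cost, which by
  \<open>gap\<close> is no smaller than the bound on the reduced quasipotential.\<close>

theorem comparison:
  fixes \<phi> \<gamma> :: "real \<Rightarrow> real ^ 'n" and P \<Lambda> a \<theta>A \<delta> r rq c C \<alpha> y :: real
  defines "F \<equiv> perturbed_field V G \<delta>" and "qt \<equiv> \<lambda>\<theta>. q \<theta> + \<phi> \<theta>"
  defines "b \<equiv> b_pert F \<gamma>"
  assumes \<delta>: "0 < \<delta>" "\<delta> \<le> 1" and P: "P \<ge> 0" "P * \<delta> \<le> 1 / (16 * \<kappa>)" "P * \<delta> \<le> 1/2"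
    and \<phi>: "C_class 2 \<phi>" "\<And>\<theta>. \<phi> (\<theta> + L) = \<phi> \<theta>" "\<And>\<theta>. \<phi> \<theta> \<bullet> velocity q \<theta> = 0"
      "\<And>\<theta>. norm (\<phi> \<theta>) \<le> P * \<delta>" "\<And>\<theta>. norm (velocity \<phi> \<theta>) \<le> P * \<delta>"
    and inv: "invariant_under_flow F (range qt)"
    and \<gamma>: "unit_speed_param 2 \<Lambda> (range qt) \<gamma>" and \<Lambda>: "\<Lambda> = curve_length L qt"
    and orient: "\<And>\<theta> s. qt \<theta> = \<gamma> s \<Longrightarrow> velocity qt \<theta> \<bullet> velocity \<gamma> s > 0"
    and A: "\<gamma> a = qt \<theta>A" and ba: "b a = 0"
    and r: "0 < r" "r \<le> 1 / (16 * \<kappa>)" "r \<le> 1" "r + 2 * P * \<delta> < rq"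
    and rq: "\<And>\<theta> \<theta>'. norm (q \<theta> - q \<theta>') < rq \<Longrightarrow> \<exists>m::int. \<bar>\<theta> + of_int m * L - \<theta>'\<bar> < 1 / (8 * \<kappa>)"
    and c: "c \<ge> 1" "2 * (CV * P + BG) \<le> c" "\<kappa> \<le> c" "4 * P\<^sup>2 \<le> c" "lam * P \<le> c" "CH \<le> c"
      "CH * P + CG + 2 * (CV * P + BG) * \<kappa> \<le> c"
    and small: "lam * c * (\<delta> + r) + 10 * c\<^sup>2 * \<delta> \<le> lam\<^sup>2 / 4"
    and C: "C = c + 4 * (12 * c + 128 * c\<^sup>2)\<^sup>2 / lam\<^sup>2" and \<alpha>: "\<alpha> = 1 - C * \<delta>\<^sup>2" "1/2 \<le> \<alpha>"
    and gap: "4 * c * L * \<delta> \<le> lam / 2 * r\<^sup>2"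
  shows "quasipotential F (\<gamma> a) (\<gamma> y) \<le> circle_quasipotential \<Lambda> b a y"
    and "circle_quasipotential \<Lambda> b a y \<le> ennreal (4 * c * L * \<delta>)"
    and "ennreal \<alpha> * circle_quasipotential \<Lambda> b a y \<le> quasipotential F (\<gamma> a) (\<gamma> y)"
proof -
  let ?q1 = "velocity q" and ?q2 = "velocity (velocity q)" and ?\<phi>1 = "velocity \<phi>"
  define \<beta> where "\<beta> = (CV * P + BG) * \<delta>"
  have L: "L > 0" using period_pos[OF q_param] .
  have \<gamma>': "unit_speed_param (Suc 1) \<Lambda> (range qt) \<gamma>" using \<gamma> by (simp add: numeral_2_eq_2)
  have F_cont: "continuous_on UNIV F" unfolding F_def by (rule perturbed_field_continuous)
  have \<phi>d: "(\<phi> has_vector_derivative ?\<phi>1 \<theta>) (at \<theta>)" for \<theta>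
    using C_class_velocity(1)[of 1 \<phi>] \<phi>(1) by (simp add: numeral_2_eq_2)
  have qtd: "(qt has_vector_derivative (?q1 \<theta> + ?\<phi>1 \<theta>)) (at \<theta>)" for \<theta>
    unfolding qt_def by (intro has_vector_derivative_add q_deriv \<phi>d)
  then have qtv: "velocity qt \<theta> = ?q1 \<theta> + ?\<phi>1 \<theta>" for \<theta> by (rule vector_derivative_at)
  have q1c: "continuous_on UNIV (velocity q)" "continuous_on UNIV (velocity \<phi>)"
    using C_class_velocity(2)[OF q_C3] C_class_velocity(2)[of 1 \<phi>] \<phi>(1)
    by (auto intro: C_class_continuous simp: numeral_2_eq_2 simp del: C_class.simps)
  have qt_C: "C_class (Suc 0) qt"
  proof -
    have "frechet_derivative qt (at \<theta>) v = v *\<^sub>R (?q1 \<theta> + ?\<phi>1 \<theta>)" for \<theta> v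
      using qtd[of \<theta>] frechet_derivative_at unfolding has_vector_derivative_def by metis
    moreover have "qt differentiable (at \<theta>)" for \<theta> using qtd by (rule differentiableI_vector)
    ultimately show ?thesis using q1c by (auto intro!: continuous_intros)
  qed
  have tangent: "F (\<gamma> x) = b x *\<^sub>R velocity \<gamma> x" for x
    unfolding b_def by (rule invariant_tangent[OF \<gamma>' inv])
  have nP: "norm (\<phi> \<theta>) \<le> 1/2" "norm (?\<phi>1 \<theta>) \<le> 1/2" for \<theta> using \<phi>(4,5)[of \<theta>] P(3) by auto
  have b_bound: "\<bar>b x\<bar> \<le> \<beta>" for x
  proof -
    have "\<gamma> x \<in> range qt" using param_range[OF \<gamma>'] by blast
    then obtain \<theta> where "\<gamma> x = q \<theta> + \<phi> \<theta>" by (auto simp: qt_def)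
    then have "norm (F (\<gamma> x)) \<le> \<beta>"
      using field_bound[of \<delta> "\<phi> \<theta>" P \<theta>] \<delta> \<phi>(4) nP by (simp add: F_def \<beta>_def)
    then show ?thesis using tangent[of x] norm_velocity[OF \<gamma>'] by simp
  qed
  have \<beta>0: "0 \<le> \<beta>" using CV(1) BG(1) P(1) \<delta> by (simp add: \<beta>_def)
  have b_cont: "continuous_on UNIV b"
    unfolding b_def b_pert_def[abs_def]
    using C_class_velocity(2)[of 1 \<gamma>] \<gamma>
    by (intro continuous_on_inner continuous_on_compose2[OF F_cont param_continuous[OF \<gamma>']])
       (auto simp: unit_speed_param_def numeral_2_eq_2 intro: C_class_continuous simp del: C_class.simps)
  have b_per: "b (x + of_int m * \<Lambda>) = b x" for x m
    unfolding b_def b_pert_def param_shift[OF \<gamma>'] 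
    by (simp add: velocity_shift[OF param_shift[OF \<gamma>'] param_derivative[OF \<gamma>']])
  have "continuous_on UNIV (cut_drift b a)" by (rule continuous_cut_drift[OF b_cont ba])
  then obtain B where B: "B a = 0" "\<And>x. (B has_real_derivative cut_drift b a x) (at x)"
    by (rule antiderivative_exists[where a = a and c = 0]) blast
  interpret D: drift b a \<beta> B
    by unfold_locales (use b_cont ba b_bound B in auto)
  obtain s where s: "s \<theta>A = a" "\<And>\<theta>. (s has_real_derivative norm (velocity qt \<theta>)) (at \<theta>)"
    "\<And>\<theta>. \<gamma> (s \<theta>) = qt \<theta>" "\<And>\<theta>. velocity qt \<theta> = norm (velocity qt \<theta>) *\<^sub>R velocity \<gamma> (s \<theta>)"
    using reparametrization[OF \<gamma>' qt_C order_refl orient A[symmetric]] by blast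
  define N0 where "N0 \<theta> = norm (?q1 \<theta> + ?\<phi>1 \<theta>)" for \<theta>
  have N0: "1/2 \<le> N0 \<theta>" "N0 \<theta> \<le> 2" for \<theta>
    using norm_triangle_ineq[of "?q1 \<theta>" "?\<phi>1 \<theta>"] norm_diff_ineq[of "?q1 \<theta>" "?\<phi>1 \<theta>"] q1_unit[of \<theta>] nP[of \<theta>]
    by (auto simp: N0_def)
  have Fq: "F (qt \<theta>) = (b (s \<theta>) / N0 \<theta>) *\<^sub>R (?q1 \<theta> + ?\<phi>1 \<theta>)" for \<theta>
  proof -
    have "F (qt \<theta>) = b (s \<theta>) *\<^sub>R velocity \<gamma> (s \<theta>)" using tangent[of "s \<theta>"] s(3) by simp
    also have "velocity \<gamma> (s \<theta>) = (1 / N0 \<theta>) *\<^sub>R (?q1 \<theta> + ?\<phi>1 \<theta>)"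
    proof -
      have eq: "?q1 \<theta> + ?\<phi>1 \<theta> = N0 \<theta> *\<^sub>R velocity \<gamma> (s \<theta>)"
        using s(4)[of \<theta>] unfolding qtv N0_def .
      show ?thesis unfolding eq using N0(1)[of \<theta>] by simp
    qed
    finally show ?thesis by simp
  qed
  \<comment> \<open>Derivative of the orthogonality relation \<open>\<phi>(3)\<close>; it identifies
    the two expressions for the Jacobian on the perturbed curve.\<close>
  have q1\<phi>1: "?q1 \<theta> \<bullet> ?\<phi>1 \<theta> = - (\<phi> \<theta> \<bullet> ?q2 \<theta>)" for \<theta>
  proof -
    have "((\<lambda>\<theta>. \<phi> \<theta> \<bullet> ?q1 \<theta>) has_vector_derivative (\<phi> \<theta> \<bullet> ?q2 \<theta> + ?\<phi>1 \<theta> \<bullet> ?q1 \<theta>)) (at \<theta>)"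
      by (rule bounded_bilinear.has_vector_derivative[OF bounded_bilinear_inner \<phi>d q1_deriv])
    moreover have "((\<lambda>\<theta>. \<phi> \<theta> \<bullet> ?q1 \<theta>) has_vector_derivative 0) (at \<theta>)" using \<phi>(3) by simp
    ultimately show ?thesis using vector_derivative_unique_at by (fastforce simp: inner_commute)
  qed
  have lim: "\<bar>v \<bullet> ?q2 \<theta>\<bar> \<le> \<kappa> * norm v" for v \<theta>
  proof -
    have "\<bar>v \<bullet> ?q2 \<theta>\<bar> \<le> norm v * norm (?q2 \<theta>)" by (rule Cauchy_Schwarz_ineq2)
    also have "\<dots> \<le> norm v * \<kappa>" by (intro mult_left_mono \<kappa>) auto
    finally show ?thesis by (simp add: mult.commute)
  qed
  interpret T: calibrated_tube q ?q1 ?q2 \<kappa> b a \<beta> B \<phi> ?\<phi>1 s N0 F \<alpha> "lam / 2" r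
  proof unfold_locales
    show "norm (\<phi> \<theta>) \<le> 1 / (16 * \<kappa>)" for \<theta> using \<phi>(4)[of \<theta>] P(2) by simp
    show "norm (?\<phi>1 \<theta>) \<le> 1" for \<theta> using nP[of \<theta>] by simp
    show "(s has_real_derivative N0 \<theta>) (at \<theta>)" for \<theta> using s(2)[of \<theta>] unfolding qtv N0_def .
    show "\<bar>N0 \<theta>\<bar> \<le> 2" for \<theta> using N0[of \<theta>] by simp
    show "\<alpha> \<le> 1" using \<alpha>(1) C c(1) by (simp add: add_nonneg_nonneg)
    fix \<theta> and w y :: "real ^ 'n" assume w: "w \<bullet> ?q1 \<theta> = 0" "norm w \<le> r"
    define p where "p = cut_drift b a (s \<theta>)"
    have \<beta>c: "\<bar>p\<bar> \<le> c * \<delta>" "\<bar>b (s \<theta>)\<bar> \<le> \<beta>"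
    proof -
      have "\<bar>p\<bar> \<le> 2 * \<beta>" using abs_cut_drift_le[of b a "s \<theta>"] b_bound[of "s \<theta>"] by (simp add: p_def)
      also have "\<dots> = 2 * (CV * P + BG) * \<delta>" by (simp add: \<beta>_def)
      also have "\<dots> \<le> c * \<delta>" using c(2) \<delta> by (intro mult_right_mono) auto
      finally show "\<bar>p\<bar> \<le> c * \<delta>" .
      show "\<bar>b (s \<theta>)\<bar> \<le> \<beta>" by (rule b_bound)
    qed
    have w1: "norm w \<le> 1" using w(2) r(3) by simp
    note est = field_estimates[OF less_imp_le[OF \<delta>(1)] \<phi>(4) nP(1) w1 w(1), of \<theta>, folded F_def]
    have \<phi>q2: "\<bar>\<phi> \<theta> \<bullet> ?q2 \<theta>\<bar> \<le> 1/16" "\<bar>(\<phi> \<theta> + w) \<bullet> ?q2 \<theta>\<bar> \<le> 1/8"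
    proof -
      have "\<kappa> * norm (\<phi> \<theta>) \<le> \<kappa> * (1 / (16 * \<kappa>))" using \<phi>(4)[of \<theta>] P(2) \<kappa>(1) by (intro mult_left_mono) auto
      then show 1: "\<bar>\<phi> \<theta> \<bullet> ?q2 \<theta>\<bar> \<le> 1/16" using lim[of "\<phi> \<theta>" \<theta>] \<kappa>(1) by simp
      have "\<kappa> * norm w \<le> \<kappa> * (1 / (16 * \<kappa>))" using w(2) r(2) \<kappa>(1) by (intro mult_left_mono) auto
      then have "\<bar>w \<bullet> ?q2 \<theta>\<bar> \<le> 1/16" using lim[of w \<theta>] \<kappa>(1) by simp
      then show "\<bar>(\<phi> \<theta> + w) \<bullet> ?q2 \<theta>\<bar> \<le> 1/8" using 1 unfolding inner_add_left by linarith
    qed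
    have "(((\<alpha> * p * N0 \<theta> - lam * (w \<bullet> ?\<phi>1 \<theta>)) / (1 - (\<phi> \<theta> + w) \<bullet> ?q2 \<theta>)) *\<^sub>R ?q1 \<theta> + lam *\<^sub>R w) \<bullet> y
      \<le> (norm (y - F (q \<theta> + \<phi> \<theta> + w)))\<^sup>2 / 2"
    proof (rule calibration_vector[OF c(1) \<delta> w1 w(1) lam q1_unit _ \<beta>c(1) _ _ N0(2) Fq[unfolded qt_def] q1\<phi>1 _ _ _ _ _ _ _ _ _ C \<alpha>])
      show "p * b (s \<theta>) = - p\<^sup>2 / 2" unfolding p_def by (rule cut_drift_mult)
      show "N0 \<theta> = norm (?q1 \<theta> + ?\<phi>1 \<theta>)" "0 < N0 \<theta>" using N0[of \<theta>] by (auto simp: N0_def)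
      show "1/2 \<le> 1 - \<phi> \<theta> \<bullet> ?q2 \<theta>" "1 - \<phi> \<theta> \<bullet> ?q2 \<theta> \<le> 2" "1/2 \<le> 1 - (\<phi> \<theta> + w) \<bullet> ?q2 \<theta>" "1 - (\<phi> \<theta> + w) \<bullet> ?q2 \<theta> \<le> 2"
        using \<phi>q2 by (auto simp: abs_le_iff)
      show "\<bar>w \<bullet> ?q2 \<theta>\<bar> \<le> c * norm w"
        using lim[of w \<theta>] c(3) by (rule order_trans[OF _ mult_right_mono]) simp
      have "4 * (norm (?\<phi>1 \<theta>))\<^sup>2 \<le> 4 * (P * \<delta>)\<^sup>2" using \<phi>(5)[of \<theta>] by (intro mult_left_mono power_mono) auto
      also have "\<dots> = 4 * P\<^sup>2 * \<delta>\<^sup>2" by (simp add: power_mult_distrib)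
      also have "\<dots> \<le> c * \<delta>\<^sup>2" using c(4) by (intro mult_right_mono) auto
      finally show "4 * (norm (?\<phi>1 \<theta>))\<^sup>2 \<le> c * \<delta>\<^sup>2" .
      have "lam * norm (?\<phi>1 \<theta>) \<le> lam * (P * \<delta>)" using \<phi>(5)[of \<theta>] lam by (intro mult_left_mono) auto
      also have "\<dots> = lam * P * \<delta>" by simp
      also have "\<dots> \<le> c * \<delta>" using c(5) \<delta> by (intro mult_right_mono) auto
      finally show "lam * norm (?\<phi>1 \<theta>) \<le> c * \<delta>" .
      have "\<bar>b (s \<theta>) / N0 \<theta> * (w \<bullet> ?q2 \<theta>)\<bar> \<le> (2 * \<beta>) * (\<kappa> * norm w)"
      proof -
        have "\<bar>b (s \<theta>) / N0 \<theta>\<bar> = \<bar>b (s \<theta>)\<bar> * (1 / N0 \<theta>)" using N0[of \<theta>] by (simp add: abs_divide)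
        also have "\<dots> \<le> \<beta> * 2" using \<beta>c(2) N0[of \<theta>] by (intro mult_mono) (auto simp: divide_le_eq)
        finally show ?thesis unfolding abs_mult using lim[of w \<theta>] \<kappa>(1) \<beta>0 by (intro mult_mono) auto
      qed
      moreover have "(2 * \<beta>) * (\<kappa> * norm w) = 2 * (CV * P + BG) * \<kappa> * \<delta> * norm w" by (simp add: \<beta>_def)
      ultimately have "\<bar>b (s \<theta>) / N0 \<theta> * (w \<bullet> ?q2 \<theta>) + ?q1 \<theta> \<bullet> (F (q \<theta> + \<phi> \<theta> + w) - F (q \<theta> + \<phi> \<theta>))\<bar>
        \<le> 2 * (CV * P + BG) * \<kappa> * \<delta> * norm w + (CH * norm w + (CH * P + CG) * \<delta>) * norm w"
        using est(1) by linarith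
      also have "\<dots> = (CH * norm w + (CH * P + CG + 2 * (CV * P + BG) * \<kappa>) * \<delta>) * norm w" by (simp add: algebra_simps)
      also have "\<dots> \<le> (c * norm w + c * \<delta>) * norm w"
        using c(6,7) \<delta> by (intro mult_right_mono add_mono) auto
      finally show "\<bar>b (s \<theta>) / N0 \<theta> * (w \<bullet> ?q2 \<theta>) + ?q1 \<theta> \<bullet> (F (q \<theta> + \<phi> \<theta> + w) - F (q \<theta> + \<phi> \<theta>))\<bar>
        \<le> c * (\<delta> + norm w) * norm w" by (simp add: algebra_simps)
      have "(CH * norm w + (CH * P + CG) * \<delta>) * (norm w)\<^sup>2 \<le> (c * norm w + c * \<delta>) * (norm w)\<^sup>2"
      proof (intro mult_right_mono add_mono)
        have "0 \<le> 2 * (CV * P + BG) * \<kappa>" using CV(1) BG(1) P(1) \<kappa>(1) by simp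
        then show "CH * P + CG \<le> c" using c(7) by linarith
      qed (use c(6) \<delta> in auto)
      then show "w \<bullet> (F (q \<theta> + \<phi> \<theta> + w) - F (q \<theta> + \<phi> \<theta>)) \<le> - lam * (norm w)\<^sup>2 + c * (\<delta> + norm w) * (norm w)\<^sup>2"
        using est(2) by (simp add: algebra_simps)
      have "lam * c * (\<delta> + norm w) \<le> lam * c * (\<delta> + r)" using w(2) lam c(1) by (intro mult_left_mono) auto
      then show "lam * c * (\<delta> + norm w) + 10 * c\<^sup>2 * \<delta> \<le> lam\<^sup>2 / 4" using small by linarith
    qed
    then show "(((\<alpha> * cut_drift b a (s \<theta>) * N0 \<theta> - 2 * (lam / 2) * (w \<bullet> ?\<phi>1 \<theta>)) / (1 - (\<phi> \<theta> + w) \<bullet> ?q2 \<theta>)) *\<^sub>R ?q1 \<theta> + (2 * (lam / 2)) *\<^sub>R w) \<bullet> y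
      \<le> (norm (y - F (q \<theta> + \<phi> \<theta> + w)))\<^sup>2 / 2" by (simp add: p_def)
  qed (use \<phi>d \<phi>(3) F_cont \<alpha>(2) lam r in auto)
  have \<gamma>per: "\<gamma> (x + of_int m * \<Lambda>) = \<gamma> x" for x m by (rule param_shift[OF \<gamma>'])
  have \<Lambda>2: "\<Lambda> \<le> 2 * L"
  proof -
    have "integral {0..L} (\<lambda>\<theta>. norm (velocity qt \<theta>)) \<le> integral {0..L} (\<lambda>\<theta>. 2)"
      unfolding qtv using q1c N0(2)
      by (intro integral_le integrable_continuous_real continuous_intros) (auto simp: N0_def intro: continuous_on_subset)
    then show ?thesis using L by (simp add: \<Lambda> curve_length_def)
  qed
  have red_le: "circle_quasipotential \<Lambda> b a y \<le> ennreal (B (y + of_int m * \<Lambda>))" for m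
    using D.circle_quasipotential_le[of \<Lambda> "y + of_int m * \<Lambda>" "- m"] by simp
  show "quasipotential F (\<gamma> a) (\<gamma> y) \<le> circle_quasipotential \<Lambda> b a y"
    unfolding circle_quasipotential_def
  proof (rule Inf_greatest, clarify)
    fix T Y m m' assume Y: "T < (0::real)" "abs_continuous T 0 Y" "Y T = a + of_int m * \<Lambda>" "Y 0 = y + of_int m' * \<Lambda>"
    have "quasipotential F (\<gamma> a) (\<gamma> (Y 0 - of_int m * \<Lambda>)) \<le> ennreal (B (Y 0 - of_int m * \<Lambda>))"
      by (rule D.quasipotential_le[OF param_derivative[OF \<gamma>'] norm_velocity[OF \<gamma>'] tangent])
    also have "\<dots> \<le> action b T Y"
      by (rule D.action_ge_drift[OF b_per Y(2,1,3)])
    also have "\<gamma> (Y 0 - of_int m * \<Lambda>) = \<gamma> y"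
      using \<gamma>per[of y "m' - m"] Y(4) by (simp add: algebra_simps)
    finally show "quasipotential F (\<gamma> a) (\<gamma> y) \<le> action b T Y" .
  qed
  show red_bound: "circle_quasipotential \<Lambda> b a y \<le> ennreal (4 * c * L * \<delta>)"
  proof -
    \<comment> \<open>The first lift of \<open>y\<close> at or after \<open>a\<close> is less than
      one period away, so \<open>B\<close> there is of order \<open>\<delta>\<close>.\<close>
    obtain m :: int where m: "0 \<le> y - a + of_int m * \<Lambda>" "y - a + of_int m * \<Lambda> < \<Lambda>"
      using unit_shift[OF \<gamma>'] by blast
    have "B (y + of_int m * \<Lambda>) \<le> 2 * \<beta> * \<bar>y + of_int m * \<Lambda> - a\<bar>"
      using D.B_lipschitz[of "y + of_int m * \<Lambda>" a] B(1) by simp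
    also have "\<dots> \<le> 2 * \<beta> * (2 * L)" using m \<Lambda>2 \<beta>0 by (intro mult_left_mono) auto
    also have "\<dots> = (2 * (CV * P + BG)) * (2 * L * \<delta>)" by (simp add: \<beta>_def)
    also have "\<dots> \<le> c * (4 * L * \<delta>)"
      using c(1,2) L \<delta> by (intro mult_mono) auto
    finally have "ennreal (B (y + of_int m * \<Lambda>)) \<le> ennreal (4 * c * L * \<delta>)" by (intro ennreal_leI) (simp add: mult_ac)
    then show ?thesis using red_le[of m] by (rule order_trans[rotated])
  qed
  have \<alpha>1: "0 \<le> \<alpha>" "\<alpha> \<le> 1" using T.\<alpha> by auto
  show "ennreal \<alpha> * circle_quasipotential \<Lambda> b a y \<le> quasipotential F (\<gamma> a) (\<gamma> y)"
    unfolding quasipotential_def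
  proof (rule Inf_greatest, clarify)
    fix T Y assume Y: "T < (0::real)" "abs_continuous T 0 Y" "Y T = \<gamma> a" "Y 0 = \<gamma> y"
    show "ennreal \<alpha> * circle_quasipotential \<Lambda> b a y \<le> action F T Y"
    proof (cases "action F T Y < \<infinity>")
      case False
      then show ?thesis by (simp add: not_less top_unique)
    next
      case True
      have "Y T = q \<theta>A + \<phi> \<theta>A" using Y(3) A by (simp add: qt_def)
      from T.action_lower_bound[OF Y(2,1) this s(1) True] show ?thesis
      proof (elim disjE exE conjE)
        assume *: "ennreal (lam / 2 * r\<^sup>2) \<le> action F T Y"
        have "ennreal \<alpha> * circle_quasipotential \<Lambda> b a y \<le> 1 * ennreal (4 * c * L * \<delta>)"
          using \<alpha>1 red_bound by (intro mult_mono) (auto simp: ennreal_le_1)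
        also have "\<dots> \<le> ennreal (lam / 2 * r\<^sup>2)" using gap by (simp add: ennreal_leI)
        finally show ?thesis using * by (rule order_trans)
      next
        \<comment> \<open>The tracked foot \<open>\<theta>\<close> has to be matched with the
          parameter \<open>\<theta>e\<close> of the end point on the perturbed curve. Closeness
          modulo \<open>L\<close> comes from \<open>rq\<close>; then \<open>foot_unique\<close> with
          equal points forces equality, so \<open>s \<theta>\<close> is a lift of
          \<open>y\<close>.\<close>
        fix \<theta> assume \<theta>: "foot (Y 0) \<theta> = 0" "norm (Y 0 - (q \<theta> + \<phi> \<theta>)) \<le> r" "ennreal (\<alpha> * B (s \<theta>)) \<le> action F T Y"
        have "Y 0 \<in> range qt" using Y(4) param_range[OF \<gamma>'] by blast
        then obtain \<theta>e where \<theta>e: "Y 0 = q \<theta>e + \<phi> \<theta>e" by (auto simp: qt_def)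
        have "norm (q \<theta>e - q \<theta>) \<le> norm (Y 0 - (q \<theta> + \<phi> \<theta>)) + norm (\<phi> \<theta>) + norm (\<phi> \<theta>e)"
          using norm_triangle_ineq[of "Y 0 - (q \<theta> + \<phi> \<theta>)" "\<phi> \<theta> - \<phi> \<theta>e"] norm_triangle_ineq4[of "\<phi> \<theta>" "\<phi> \<theta>e"] \<theta>e
          by (simp add: algebra_simps)
        then have "norm (q \<theta>e - q \<theta>) < rq" using \<theta>(2) \<phi>(4)[of \<theta>] \<phi>(4)[of \<theta>e] r(4) by simp
        then obtain m :: int where m: "\<bar>\<theta>e + of_int m * L - \<theta>\<bar> < 1 / (8 * \<kappa>)" using rq by blast
        define \<theta>' where "\<theta>' = \<theta>e + of_int m * L"
        have qper: "q (x + of_int m * L) = q x" for x m using param_shift[OF q_param] .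
        have q1per: "velocity q (x + of_int m * L) = velocity q x" for x m
          by (rule velocity_shift[OF qper q_deriv])
        have \<phi>nat: "\<phi> (x + real k * L) = \<phi> x" for x k
        proof (induction k)
          case (Suc k)
          have "\<phi> (x + real (Suc k) * L) = \<phi> ((x + real k * L) + L)" by (simp add: algebra_simps)
          then show ?case using Suc \<phi>(2) by simp
        qed simp
        have \<phi>per: "\<phi> (x + of_int m * L) = \<phi> x" for x m
        proof (cases m)
          case (nonneg k) then show ?thesis using \<phi>nat[of x k] by simp
        next
          case (neg k)
          then have "real_of_int m = - real (Suc k)" by simp
          then have "x + of_int m * L + real (Suc k) * L = x" by (simp only:)
          then show ?thesis using \<phi>nat[of "x + of_int m * L" "Suc k"] by metis
        qed
        have Y0: "Y 0 = qt \<theta>'" by (simp add: \<theta>e \<theta>'_def qt_def qper \<phi>per)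
        have "foot (Y 0) \<theta>' = 0"
          using \<phi>(3)[of \<theta>'] by (simp add: Y0 qt_def foot_def inner_add_left)
        have nq: "norm (Y 0 - q \<theta>) \<le> 1 / (8 * \<kappa>)"
        proof -
          have "norm (Y 0 - q \<theta>) \<le> norm (Y 0 - (q \<theta> + \<phi> \<theta>)) + norm (\<phi> \<theta>)"
            using norm_triangle_ineq[of "Y 0 - (q \<theta> + \<phi> \<theta>)" "\<phi> \<theta>"] by simp
          also have "\<dots> \<le> 1 / (16 * \<kappa>) + 1 / (16 * \<kappa>)" using \<theta>(2) r(2) \<phi>(4)[of \<theta>] P(2) by simp
          finally show ?thesis by simp
        qed
        have "\<bar>\<theta>' - \<theta>\<bar> \<le> 2 * norm (Y 0 - Y 0)"
        proof (rule foot_unique[OF \<open>foot (Y 0) \<theta>' = 0\<close> \<theta>(1)])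
          fix u assume "u \<in> closed_segment \<theta>' \<theta>"
          then have "\<bar>u - \<theta>\<bar> \<le> 1 / (8 * \<kappa>)" using m unfolding \<theta>'_def[symmetric]
            by (auto simp: closed_segment_eq_real_ivl split: if_splits)
          then show "norm (Y 0 - q u) \<le> 1 / (2 * \<kappa>)"
            using \<kappa>(1) by (intro near_curve[OF nq]) auto
        qed
        then have "\<theta>' = \<theta>" by simp
        then have "\<gamma> (s \<theta>) = \<gamma> y" using s(3)[of \<theta>] Y0 Y(4) by simp
        then obtain m' :: int where m': "s \<theta> = y + of_int m' * \<Lambda>" using param_eq_iff[OF \<gamma>'] by blast
        have "ennreal \<alpha> * circle_quasipotential \<Lambda> b a y \<le> ennreal \<alpha> * ennreal (B (s \<theta>))"
          using red_le[of m'] m' by (intro mult_left_mono) auto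
        also have "\<dots> = ennreal (\<alpha> * B (s \<theta>))" using \<alpha>1 D.B_nonneg by (simp add: ennreal_mult)
        finally show ?thesis using \<theta>(3) by (rule order_trans)
      qed
    qed
  qed
qed

end

section \<open>Conclusion\<close>

lemma eventually_linear_le:
  fixes k e :: real
  assumes "k \<ge> 0" "e > 0"
  shows "\<forall>\<^sub>F \<delta> in at_right 0. k * \<delta> \<le> e"
proof -
  have "\<forall>\<^sub>F \<delta> in at_right (0::real). \<delta> \<in> {0<..<e / (k + 1)}"
    using assms by (intro eventually_at_right_real) simp
  then show ?thesis
  proof eventually_elim
    case (elim \<delta>)
    then have "(k + 1) * \<delta> \<le> e" using assms by (simp add: field_simps)
    then show ?case using elim by (simp add: algebra_simps)
  qed
qed

lemma periodic_bounded:
  fixes f :: "real \<Rightarrow> 'a::real_normed_vector"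
  assumes "L > 0" and cont: "continuous_on UNIV f" and per: "\<And>x m. f (x + of_int m * L) = f x"
  obtains B where "B > 0" "\<And>x. norm (f x) \<le> B"
proof -
  have "bounded (f ` {0..L})"
    by (intro compact_imp_bounded compact_continuous_image continuous_on_subset[OF cont]) auto
  then obtain B where B: "B > 0" "\<And>x. x \<in> {0..L} \<Longrightarrow> norm (f x) \<le> B"
    unfolding bounded_pos by auto
  have "norm (f x) \<le> B" for x
  proof -
    define m where "m = - \<lfloor>x / L\<rfloor>"
    have "of_int \<lfloor>x / L\<rfloor> * L \<le> x" "x < (of_int \<lfloor>x / L\<rfloor> + 1) * L"
      using assms(1) floor_divide_lower floor_divide_upper by blast+
    then have "x + of_int m * L \<in> {0..L}" by (auto simp: m_def algebra_simps)
    then show ?thesis using B(2)[of "x + of_int m * L"] per by simp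
  qed
  then show thesis using that B(1) by blast
qed

lemma grad_lipschitz:
  fixes V :: "real ^ 'n \<Rightarrow> real"
  assumes V: "C_class 3 V" and S: "compact S" "convex S"
  obtains C where "C \<ge> 0" "\<And>x y. x \<in> S \<Longrightarrow> y \<in> S \<Longrightarrow> norm (grad V x - grad V y) \<le> C * norm (x - y)"
proof -
  have comp: "C_class (Suc 1) (\<lambda>x. grad V x $ i)" for i
    using C_class_grad_component[OF V, of "axis i 1"] by (simp add: grad_def numeral_2_eq_2)
  have "\<exists>C\<ge>0. \<forall>x\<in>S. \<forall>y\<in>S. norm (grad V x $ i - grad V y $ i) \<le> C * norm (x - y)" for i
    using C_class_lipschitz[OF comp S] by metis
  then obtain C where C: "\<And>i. C i \<ge> 0" "\<And>i x y. x \<in> S \<Longrightarrow> y \<in> S \<Longrightarrow> \<bar>grad V x $ i - grad V y $ i\<bar> \<le> C i * norm (x - y)"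
    unfolding real_norm_def by metis
  show thesis
  proof
    show "(\<Sum>i\<in>UNIV. C i) \<ge> 0" by (intro sum_nonneg C)
    fix x y assume "x \<in> S" "y \<in> S"
    then have "(\<Sum>i\<in>UNIV. \<bar>(grad V x - grad V y) $ i\<bar>) \<le> (\<Sum>i\<in>UNIV. C i * norm (x - y))"
      using C by (intro sum_mono) simp
    then show "norm (grad V x - grad V y) \<le> (\<Sum>i\<in>UNIV. C i) * norm (x - y)"
      using norm_le_l1_cart[of "grad V x - grad V y"] by (simp add: sum_distrib_right)
  qed
qed

lemma setting_exists:
  fixes V :: "real ^ 'n \<Rightarrow> real" and G :: "real ^ 'n \<Rightarrow> real ^ 'n"
  assumes V: "C_class 4 V" and G: "C_class 2 G" and q: "unit_speed_param 3 L M q" and lam: "lam > 0"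
    and grad_q: "\<And>\<theta>. grad V (q \<theta>) = 0"
    and H_tangent: "\<And>\<theta>. hessian V (q \<theta>) *v velocity q \<theta> = 0"
    and H_normal: "\<And>\<theta> w. w \<bullet> velocity q \<theta> = 0 \<Longrightarrow> (hessian V (q \<theta>) *v w) \<bullet> w \<ge> lam * (norm w)\<^sup>2"
  obtains \<kappa> R CV CH CG BG where "setting V G M q L lam \<kappa> R CV CH CG BG"
proof -
  have V3: "C_class 3 V" using C_class_mono[OF V] by simp
  have qp: "unit_speed_param (Suc 2) L M q" using q by (simp add: numeral_3_eq_3 numeral_2_eq_2)
  have q3: "C_class (Suc (Suc (Suc 0))) q" using q by (simp only: unit_speed_param_def numeral_3_eq_3)
  note q2 = C_class_velocity(2)[OF q3]
  note q1 = C_class_velocity(2)[OF q2]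
  have L: "L > 0" by (rule period_pos[OF qp])
  have per0: "q (x + of_int m * L) = q x" for x m by (rule param_shift[OF qp])
  have per1: "velocity q (x + of_int m * L) = velocity q x" for x m
    by (rule velocity_shift[OF per0 C_class_velocity(1)[OF q3]])
  have per2: "velocity (velocity q) (x + of_int m * L) = velocity (velocity q) x" for x m
    by (rule velocity_shift[OF per1 C_class_velocity(1)[OF q2]])
  obtain B where B: "B > 0" "\<And>x. norm (q x) \<le> B"
    using periodic_bounded[OF L C_class_continuous[OF q3] per0] by blast
  obtain \<kappa> where \<kappa>: "\<kappa> > 0" "\<And>x. norm (velocity (velocity q) x) \<le> \<kappa>"
    using periodic_bounded[OF L C_class_continuous[OF q1] per2] by blast
  define S where "S = cball (0::real ^ 'n) (B + 2)"
  have S: "compact S" "convex S" by (auto simp: S_def)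
  have G': "C_class (Suc 1) G" using G by (simp only: numeral_2_eq_2 One_nat_def)
  obtain CV where CV: "CV \<ge> 0" "\<And>x y. x \<in> S \<Longrightarrow> y \<in> S \<Longrightarrow> norm (grad V x - grad V y) \<le> CV * norm (x - y)"
    using grad_lipschitz[OF V3 S] by blast
  obtain CH where CH: "CH \<ge> 0" "\<And>x y w. x \<in> S \<Longrightarrow> y \<in> S \<Longrightarrow> norm (hessian V x *v w - hessian V y *v w) \<le> CH * norm (x - y) * norm w"
    using hessian_lipschitz[OF V3 S] by blast
  obtain CG where CG: "CG \<ge> 0" "\<And>x y. x \<in> S \<Longrightarrow> y \<in> S \<Longrightarrow> norm (G x - G y) \<le> CG * norm (x - y)"
    using C_class_lipschitz[OF G' S] by blast
  have "bounded (G ` S)"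
    by (intro compact_imp_bounded compact_continuous_image C_class_continuous[OF G] S)
  then obtain BG where BG: "BG > 0" "\<And>x. x \<in> S \<Longrightarrow> norm (G x) \<le> BG" unfolding bounded_pos by auto
  have "setting V G M q L lam \<kappa> (B + 2) CV CH CG BG"
    by unfold_locales (use assms B \<kappa> CV CH CG BG in \<open>auto simp: S_def mem_cball_0 less_imp_le\<close>)
  then show thesis by (rule that)
qed

lemma ennreal_comparison:
  fixes W Wr :: ennreal
  assumes "W \<le> Wr" "Wr \<le> ennreal E" "ennreal \<alpha> * Wr \<le> W" and "0 \<le> \<alpha>" "\<alpha> \<le> 1" "0 \<le> E"
  shows "W < \<infinity>" "Wr < \<infinity>" "\<bar>enn2real W - enn2real Wr\<bar> \<le> (1 - \<alpha>) * E"
proof -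
  show fin: "Wr < \<infinity>" using assms(2) by (rule order.strict_trans1) simp
  with assms(1) show "W < \<infinity>" by (rule order.strict_trans1)
  obtain x where x: "x \<ge> 0" "Wr = ennreal x" using fin by (cases Wr) auto
  obtain y where y: "y \<ge> 0" "W = ennreal y" using \<open>W < \<infinity>\<close> by (cases W) auto
  have "y \<le> x" "x \<le> E" using assms(1,2,6) x y by auto
  moreover have "\<alpha> * x \<le> y" using assms(3,4) x y by (simp add: ennreal_mult[symmetric])
  moreover have "(1 - \<alpha>) * x \<le> (1 - \<alpha>) * E" using \<open>x \<le> E\<close> assms(5) by (intro mult_left_mono) auto
  ultimately show "\<bar>enn2real W - enn2real Wr\<bar> \<le> (1 - \<alpha>) * E" using x y by (simp add: algebra_simps)
qed

theorem corollary1p2: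
  fixes V :: "real ^ 'n \<Rightarrow> real"
    and G :: "real ^ 'n \<Rightarrow> real ^ 'n"
    and M :: "(real ^ 'n) set"
    and q :: "real \<Rightarrow> real ^ 'n"
    and L lam \<theta>0 \<Delta>1 \<Delta>2 :: real
    and \<phi> qt qd :: "real \<Rightarrow> real \<Rightarrow> real ^ 'n"
    and Ld \<theta>d \<phi>A :: "real \<Rightarrow> real"
    and A :: "real \<Rightarrow> real ^ 'n"
  assumes V: "C_class 4 V" and G: "C_class 2 G"
    and q: "unit_speed_param 3 L M q"
    and V_M: "\<And>X. X \<in> M \<Longrightarrow> grad V X = 0 \<and> V X = 0"
    and lam: "lam > 0"
    and H_tangent: "\<And>\<theta> v. v \<in> span {velocity q \<theta>} \<Longrightarrow> hessian V (q \<theta>) *v v = 0"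
    and H_normal: "\<And>\<theta> w. w \<bullet> velocity q \<theta> = 0 \<Longrightarrow>
                     (hessian V (q \<theta>) *v w) \<bullet> w \<ge> lam * (norm w)\<^sup>2"
    and phi: "\<forall>\<^sub>F \<delta> in at_right 0.
                C_class 2 (\<phi> \<delta>) \<and> (\<forall>\<theta>. \<phi> \<delta> (\<theta> + L) = \<phi> \<delta> \<theta>) \<and>
                (\<forall>\<theta>. \<phi> \<delta> \<theta> \<bullet> velocity q \<theta> = 0)"
    and phi_bound: "\<exists>C. \<forall>\<^sub>F \<delta> in at_right 0. \<forall>\<theta>.
                norm (\<phi> \<delta> \<theta>) \<le> C * \<delta> \<and>
                norm (velocity (\<phi> \<delta>) \<theta>) \<le> C * \<delta> \<and>
                norm (velocity (velocity (\<phi> \<delta>)) \<theta>) \<le> C * \<delta>"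
    and qt: "\<And>\<delta> \<theta>. qt \<delta> \<theta> = q \<theta> + \<phi> \<delta> \<theta>"
    and NHIM: "\<forall>\<^sub>F \<delta> in at_right 0.
                 stable_normally_hyperbolic (perturbed_field V G \<delta>) (qt \<delta>)"
    and Ld: "\<And>\<delta>. Ld \<delta> = curve_length L (qt \<delta>)"
    and qd: "\<forall>\<^sub>F \<delta> in at_right 0. unit_speed_param 2 (Ld \<delta>) (range (qt \<delta>)) (qd \<delta>)"
    and orientation: "\<forall>\<^sub>F \<delta> in at_right 0. \<forall>\<theta> s.
                 qt \<delta> \<theta> = qd \<delta> s \<longrightarrow> velocity (qt \<delta>) \<theta> \<bullet> velocity (qd \<delta>) s > 0"
    and Delta: "\<Delta>1 > 0" "\<Delta>2 > 0"
    and b: "\<And>\<delta>. \<delta> > 0 \<Longrightarrow> stable_hyperbolic_zero (b_unpert G q \<delta>) \<theta>0"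
    and b_basin: "\<And>\<delta>. \<delta> > 0 \<Longrightarrow>
                 {\<theta>0 - \<Delta>1..\<theta>0 + \<Delta>2} \<subseteq> circle_basin L (b_unpert G q \<delta>) \<theta>0"
    and A: "\<forall>\<^sub>F \<delta> in at_right 0. A \<delta> = qt \<delta> (\<theta>d \<delta>) \<and> A \<delta> = qd \<delta> (\<phi>A \<delta>)"
    and thetad: "\<exists>C. \<forall>\<^sub>F \<delta> in at_right 0. \<bar>\<theta>d \<delta> - \<theta>0\<bar> \<le> C * \<delta>"
    and bd: "\<forall>\<^sub>F \<delta> in at_right 0.
               stable_hyperbolic_zero (b_pert (perturbed_field V G \<delta>) (qd \<delta>)) (\<phi>A \<delta>)"
    and bd_basin: "\<forall>\<^sub>F \<delta> in at_right 0.
               {\<phi>A \<delta> - \<Delta>1..\<phi>A \<delta> + \<Delta>2} \<subseteq>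
               circle_basin (Ld \<delta>) (b_pert (perturbed_field V G \<delta>) (qd \<delta>)) (\<phi>A \<delta>)"
    and A_stable: "\<forall>\<^sub>F \<delta> in at_right 0.
               asymptotically_stable_point (perturbed_field V G \<delta>) (A \<delta>)"
  shows "\<exists>\<delta>0>0. \<exists>C. \<forall>\<delta>. 0 < \<delta> \<and> \<delta> \<le> \<delta>0 \<longrightarrow>
           (\<forall>\<phi>d \<in> {\<phi>A \<delta> - \<Delta>1..\<phi>A \<delta> + \<Delta>2}.
              let W = quasipotential (perturbed_field V G \<delta>) (A \<delta>) (qd \<delta> \<phi>d);
                  Wred = circle_quasipotential (Ld \<delta>)
                           (b_pert (perturbed_field V G \<delta>) (qd \<delta>)) (\<phi>A \<delta>) \<phi>d
              in W < \<infinity> \<and> Wred < \<infinity> \<and>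
                 \<bar>enn2real W - enn2real Wred\<bar> \<le> C * (\<delta> ^ 3 * \<bar>ln \<delta>\<bar> ^ 3))"
proof -
  have qp: "unit_speed_param (Suc 2) L M q" using q by (simp add: numeral_3_eq_3 numeral_2_eq_2)
  have gq: "grad V (q \<theta>) = 0" for \<theta> using V_M param_range[OF qp] by blast
  have Ht: "hessian V (q \<theta>) *v velocity q \<theta> = 0" for \<theta> by (intro H_tangent span_base) simp
  obtain \<kappa> R CV CH CG BG where set: "setting V G M q L lam \<kappa> R CV CH CG BG"
    using setting_exists[OF V G q lam gq Ht H_normal] by blast
  let ?W = "\<lambda>\<delta> y. quasipotential (perturbed_field V G \<delta>) (A \<delta>) (qd \<delta> y)"
  let ?Wr = "\<lambda>\<delta> y. circle_quasipotential (Ld \<delta>) (b_pert (perturbed_field V G \<delta>) (qd \<delta>)) (\<phi>A \<delta>) y"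
  interpret setting V G M q L lam \<kappa> R CV CH CG BG by (rule set)
  obtain P0 where P0: "\<forall>\<^sub>F \<delta> in at_right 0. \<forall>\<theta>. norm (\<phi> \<delta> \<theta>) \<le> P0 * \<delta> \<and>
      norm (velocity (\<phi> \<delta>) \<theta>) \<le> P0 * \<delta> \<and> norm (velocity (velocity (\<phi> \<delta>)) \<theta>) \<le> P0 * \<delta>"
    using phi_bound by blast
  \<comment> \<open>The absolute value makes the constant nonnegative and only weakens the bounds,
    as \<open>\<delta> > 0\<close>.\<close>
  define P where "P = \<bar>P0\<bar>"
  have P: "P \<ge> 0" by (simp add: P_def)
  have "1 / (8 * \<kappa>) > 0" using \<kappa>(1) by simp
  then obtain rq where rq: "rq > 0" "\<And>\<theta> \<theta>'. norm (q \<theta> - q \<theta>') < rq \<Longrightarrow> \<exists>m::int. \<bar>\<theta> + of_int m * L - \<theta>'\<bar> < 1 / (8 * \<kappa>)"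
    using param_near[OF qp] by metis
  define c0 where "c0 = 2 * (CV * P + BG)"
  have c0: "c0 \<ge> 0" using CV(1) BG(1) P by (simp add: c0_def)
  \<comment> \<open>A sum of nonnegative terms dominates each of the lower bounds on
    \<open>c\<close> in \<open>comparison\<close>.\<close>
  define c where "c = 1 + c0 + \<kappa> + 4 * P\<^sup>2 + lam * P + CH + (CH * P + CG + c0 * \<kappa>)"
  have nn: "\<kappa> \<ge> 0" "4 * P\<^sup>2 \<ge> 0" "lam * P \<ge> 0" "CH \<ge> 0" "CH * P \<ge> 0" "CG \<ge> 0" "c0 * \<kappa> \<ge> 0"
    using \<kappa>(1) P lam CH(1) CG(1) c0 by auto
  have c: "c \<ge> 1" "c0 \<le> c" "\<kappa> \<le> c" "4 * P\<^sup>2 \<le> c" "lam * P \<le> c" "CH \<le> c" "CH * P + CG + c0 * \<kappa> \<le> c"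
    unfolding c_def using nn c0 by linarith+
  \<comment> \<open>In order: the foot point construction, the radius allowed in
    \<open>field_estimates\<close>, the identification of the end point (together with
    \<open>2 * P * \<delta> \<le> rq / 4\<close>), and the margin in
    \<open>calibration_scalar\<close>. None involves \<open>\<delta>\<close>, so the exit cost is a
    fixed positive number.\<close>
  define r where "r = min (min (1 / (16 * \<kappa>)) 1) (min (rq / 2) (lam / (8 * c)))"
  have r: "0 < r" "r \<le> 1 / (16 * \<kappa>)" "r \<le> 1" "r \<le> rq / 2" "r \<le> lam / (8 * c)"
    using \<kappa>(1) rq(1) lam c(1) by (auto simp: r_def)
  define C where "C = c + 4 * (12 * c + 128 * c\<^sup>2)\<^sup>2 / lam\<^sup>2"
  have C: "C \<ge> 0" using c(1) by (simp add: C_def)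
  have L: "L > 0" by (rule period_pos[OF qp])
  define K where "K = 4 * c * L"
  have K: "K \<ge> 0" using c(1) L by (simp add: K_def)
  \<comment> \<open>The bound \<open>lam\<^sup>2 / 8\<close> is half of the smallness budget of
    \<open>comparison\<close>, the other half being \<open>rl\<close>; the last condition gives
    \<open>1 \<le> \<bar>ln \<delta>\<bar>\<close>.\<close>
  have evs: "\<forall>\<^sub>F \<delta> in at_right (0::real). 1 * \<delta> \<le> 1" "\<forall>\<^sub>F \<delta> in at_right 0. P * \<delta> \<le> 1 / (16 * \<kappa>)"
    "\<forall>\<^sub>F \<delta> in at_right 0. P * \<delta> \<le> 1 / 2" "\<forall>\<^sub>F \<delta> in at_right 0. P * \<delta> \<le> rq / 8"
    "\<forall>\<^sub>F \<delta> in at_right 0. (lam * c + 10 * c\<^sup>2) * \<delta> \<le> lam\<^sup>2 / 8" "\<forall>\<^sub>F \<delta> in at_right 0. C * \<delta> \<le> 1 / 2"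
    "\<forall>\<^sub>F \<delta> in at_right 0. K * \<delta> \<le> lam / 2 * r\<^sup>2" "\<forall>\<^sub>F \<delta> in at_right (0::real). 1 * \<delta> \<le> exp (- 1)"
    by (intro eventually_linear_le; use \<kappa>(1) P rq(1) lam c(1) C K r(1) in simp)+
  have ev0: "\<forall>\<^sub>F \<delta> in at_right (0::real). \<delta> > 0" by (simp add: eventually_at_right_less)
  have "\<forall>\<^sub>F \<delta> in at_right 0. \<forall>y. 
       ?W \<delta> y < \<infinity> \<and>
       ?Wr \<delta> y < \<infinity> \<and>
       \<bar>enn2real (?W \<delta> y) -
         enn2real (?Wr \<delta> y)\<bar>
       \<le> C * K * (\<delta> ^ 3 * \<bar>ln \<delta>\<bar> ^ 3)"
    using ev0 evs phi P0 NHIM qd orientation A bd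
  proof eventually_elim
    case (elim \<delta>)
    have qt_eq: "qt \<delta> = (\<lambda>\<theta>. q \<theta> + \<phi> \<delta> \<theta>)" using qt by auto
    have \<delta>: "0 < \<delta>" "\<delta> \<le> 1" using elim by auto
    have P0\<delta>: "P0 * \<delta> \<le> P * \<delta>" using \<delta> by (simp add: P_def)
    define \<alpha> where "\<alpha> = 1 - C * \<delta>\<^sup>2"
    have "C * \<delta>\<^sup>2 \<le> C * \<delta>" using C \<delta> by (simp add: power2_eq_square mult_left_mono mult_left_le)
    then have \<alpha>: "1/2 \<le> \<alpha>" using elim by (simp add: \<alpha>_def)
    have \<alpha>1: "\<alpha> \<le> 1" using C by (simp add: \<alpha>_def)
    have rl: "lam * c * r \<le> lam\<^sup>2 / 8"
    proof -
      have "lam * c * r \<le> lam * c * (lam / (8 * c))" using r(5) lam c(1) by (intro mult_left_mono) auto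
      then show ?thesis using c(1) by (simp add: power2_eq_square)
    qed
    have cmp: "?W \<delta> y
          \<le> ?Wr \<delta> y \<and>
        ?Wr \<delta> y \<le> ennreal (K * \<delta>) \<and>
        ennreal \<alpha> * ?Wr \<delta> y
          \<le> ?W \<delta> y" for y
    proof -
      have 1: "C_class 2 (\<phi> \<delta>)" "\<And>\<theta>. \<phi> \<delta> (\<theta> + L) = \<phi> \<delta> \<theta>" "\<And>\<theta>. \<phi> \<delta> \<theta> \<bullet> velocity q \<theta> = 0"
        using elim by blast+
      have 2: "norm (\<phi> \<delta> \<theta>) \<le> P * \<delta>" "norm (velocity (\<phi> \<delta>) \<theta>) \<le> P * \<delta>" for \<theta>
        using elim P0\<delta> order_trans by blast+
      have 3: "invariant_under_flow (perturbed_field V G \<delta>) (range (\<lambda>\<theta>. q \<theta> + \<phi> \<delta> \<theta>))"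
        using elim unfolding stable_normally_hyperbolic_def qt_eq by blast
      have 4: "unit_speed_param 2 (Ld \<delta>) (range (\<lambda>\<theta>. q \<theta> + \<phi> \<delta> \<theta>)) (qd \<delta>)"
        using elim unfolding qt_eq by blast
      have 5: "Ld \<delta> = curve_length L (\<lambda>\<theta>. q \<theta> + \<phi> \<delta> \<theta>)" using Ld qt_eq by simp
      have 6: "q \<theta> + \<phi> \<delta> \<theta> = qd \<delta> s \<Longrightarrow> velocity (\<lambda>\<theta>. q \<theta> + \<phi> \<delta> \<theta>) \<theta> \<bullet> velocity (qd \<delta>) s > 0" for \<theta> s
        using elim unfolding qt_eq by blast
      have 7: "qd \<delta> (\<phi>A \<delta>) = q (\<theta>d \<delta>) + \<phi> \<delta> (\<theta>d \<delta>)" and A\<delta>: "A \<delta> = qd \<delta> (\<phi>A \<delta>)"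
        using elim qt by auto
      have 8: "b_pert (perturbed_field V G \<delta>) (qd \<delta>) (\<phi>A \<delta>) = 0"
        using elim unfolding stable_hyperbolic_zero_def by blast
      have 9: "r + 2 * P * \<delta> < rq" using elim r(4) rq(1) by simp
      have 10: "lam * c * (\<delta> + r) + 10 * c\<^sup>2 * \<delta> \<le> lam\<^sup>2 / 4" using elim rl by (simp add: algebra_simps)
      have 11: "4 * c * L * \<delta> \<le> lam / 2 * r\<^sup>2" using elim by (simp add: K_def)
      have P\<delta>: "P * \<delta> \<le> 1 / (16 * \<kappa>)" "P * \<delta> \<le> 1/2" using elim by blast+
      note cmp = comparison[OF \<delta> P P\<delta> 1 2 3 4 5 6 7 8 r(1,2,3) 9 rq(2) c(1) c(2)[unfolded c0_def] c(3-6)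
          c(7)[unfolded c0_def] 10 C_def \<alpha>_def \<alpha> 11, of y]
      show ?thesis using cmp unfolding A\<delta> K_def by blast
    qed
    have E0: "0 \<le> K * \<delta>" using K \<delta> by simp
    have ln: "1 \<le> \<bar>ln \<delta>\<bar>"
    proof -
      have "ln \<delta> \<le> ln (exp (- 1))" using elim by (subst ln_le_cancel_iff) auto
      then show ?thesis by simp
    qed
    \<comment> \<open>The estimate obtained is of order \<open>\<delta>^3\<close>; the logarithmic
      factor is at least 1 and only enlarges it.\<close>
    have "(1 - \<alpha>) * (K * \<delta>) = C * K * (\<delta> ^ 3 * 1)" by (simp add: \<alpha>_def power2_eq_square power3_eq_cube)
    also have "\<dots> \<le> C * K * (\<delta> ^ 3 * \<bar>ln \<delta>\<bar> ^ 3)"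
      using C K \<delta> ln by (intro mult_left_mono one_le_power) auto
    finally have final: "(1 - \<alpha>) * (K * \<delta>) \<le> C * K * (\<delta> ^ 3 * \<bar>ln \<delta>\<bar> ^ 3)" .
    show ?case
    proof
      fix y
      note ec = ennreal_comparison[OF cmp[of y, THEN conjunct1] cmp[of y, THEN conjunct2, THEN conjunct1] cmp[of y, THEN conjunct2, THEN conjunct2] _ \<alpha>1 E0]
      have "0 \<le> \<alpha>" using \<alpha> by simp
      from ec[OF this] final show "?W \<delta> y < \<infinity> \<and>
       ?Wr \<delta> y < \<infinity> \<and>
       \<bar>enn2real (?W \<delta> y) -
         enn2real (?Wr \<delta> y)\<bar>
       \<le> C * K * (\<delta> ^ 3 * \<bar>ln \<delta>\<bar> ^ 3)" by linarith
    qed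
  qed
  then obtain \<delta>1 where "\<delta>1 > 0" and \<delta>1: "\<And>\<delta> y. 0 < \<delta> \<Longrightarrow> \<delta> < \<delta>1 \<Longrightarrow>
       ?W \<delta> y < \<infinity> \<and>
       ?Wr \<delta> y < \<infinity> \<and>
       \<bar>enn2real (?W \<delta> y) -
         enn2real (?Wr \<delta> y)\<bar>
       \<le> C * K * (\<delta> ^ 3 * \<bar>ln \<delta>\<bar> ^ 3)"
    unfolding eventually_at_right_field by blast
  \<comment> \<open>Halving \<open>\<delta>1\<close> passes from the strict bound on
    \<open>\<delta>\<close> to the closed one.\<close>
  show ?thesis
    unfolding Let_def
    by (intro exI[of _ "\<delta>1 / 2"] exI[of _ "C * K"] conjI allI impI ballI \<delta>1[THEN conjunct1] \<delta>1[THEN conjunct2, THEN conjunct1] \<delta>1[THEN conjunct2, THEN conjunct2])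
       (use \<open>\<delta>1 > 0\<close> in auto)
qed

end
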